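(* Let $T>0$, $I=[0,T]$, $E=C^\infty(S^1)\times C^\infty(I\times S^1\times\mathbf R)$ and $F=C^\infty(I\times S^1)$. Let $\Sigma$ be the set of all $((y_0,\varphi),y)$ with $(y_0,\varphi)\in E$, $y\in C^1(I\times S^1)$ and $$y(t,\eta)=y_0(\eta-t)+\int_0^t\varphi\bigl(\tau,\eta-t+\tau,y(\tau,\eta-t+\tau)\bigr)\,d\tau\qquad\text{for all }t\in I,\ \eta\in\mathbf R$$ (equivalently, $\partial_1y+\partial_2y=\varphi(t,\eta,y(t,\eta))$ with $y(0,\cdot)=y_0$). Then $(E,F,\Sigma)\in C^\infty_\pi$; that is, $\Sigma$ is (the graph of) a function $(y_0,\varphi)\mapsto y$ with open domain in $E$, values in $F$, and is of class $C^\infty_\pi$.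
   Context: All spaces are real and functions real-valued. A function "on $\cdots\times S^1\times\cdots$" means a function on $\cdots\times\mathbf R\times\cdots$ that is $1$-periodic in the corresponding variable. For $i\in\{0,1,\dots\}\cup\{\infty\}$, $C^i$ on sets such as $\mathbf R$, $I\times\mathbf R$, $I\times\mathbf R\times\mathbf R$ denotes the functions that are continuous, $C^i$ in the interior, with all partial derivatives of order $<i+1$ extending continuously to the whole set, with the topology of uniform convergence of these derivatives on compact sets; the spaces with $S^1$ are the subspaces of periodic functions with the induced topology. Class $C^\infty_\pi$ (Keller): for locally convex $E,F$ and a function $f$ with $\operatorname{dom}f\subseteq E$ and values in $F$, put $d_uf(x)=\lim_{t\to0}t^{-1}(f(x+tu)-f(x))$ and $d(u_1,\dots,u_l)f=d_{u_l}\cdots d_{u_1}f$. $(E,F,f)\in C^\infty_\pi$ means: $\operatorname{dom}f$ is open in $E$ and for every integer $l\ge0$ and $x\in\operatorname{dom}f$, the map $d^lf(x):(u_1,\dots,u_l)\mapsto d(u_1,\dots,u_l)f(x)$ is everywhere defined, $l$-linear and continuous $E^l\to F$, and for every zero neighbourhood $W$ in $F$ there is a zero neighbourhood $U$ in $E$ such that for every $\varepsilon>0$ there is a zero neighbourhood $V$ in $E$ with $(d^lf(x+v)-d^lf(x))[U^l]\subseteq\varepsilon W$ for all $v\in V$. *)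

theory Defs
  imports "HOL-Analysis.Analysis" "HOL-Library.Function_Algebras" "HOL-Library.Extended_Nat"
begin

instantiation "fun" :: (type, real_vector) real_vector
begin

definition scaleR_fun :: "real \<Rightarrow> ('a \<Rightarrow> 'b) \<Rightarrow> 'a \<Rightarrow> 'b"
  where "scaleR_fun c f = (\<lambda>x. c *\<^sub>R f x)"

instance
  by standard (auto simp: scaleR_fun_def plus_fun_def scaleR_add_right scaleR_add_left)

end


subsection \<open>Spaces of differentiable functions\<close>

text \<open>
  A function on a set \<open>D\<close> is represented by a total function that vanishes off \<open>D\<close>, so that the
  pointwise vector space operations on the function type are the ones of the function space.
\<close>

text \<open>Iterated partial derivatives; the last vector of the list is differentiated along first.\<close>

fun partial :: "'a::euclidean_space list \<Rightarrow> ('a \<Rightarrow> real) \<Rightarrow> 'a \<Rightarrow> real" where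
  "partial [] f = f"
| "partial (b # bs) f = (\<lambda>x. deriv (\<lambda>t. partial bs f (x + t *\<^sub>R b)) 0)"

text \<open>
  The second condition says that all partial derivatives of order \<open>< i + 1\<close> exist in the interior
  of \<open>D\<close>, the third that they are continuous there and extend continuously to \<open>D\<close>.
\<close>

definition C_on :: "enat \<Rightarrow> 'a::euclidean_space set \<Rightarrow> ('a \<Rightarrow> real) set" where
  "C_on i D = {f. (\<forall>x. x \<notin> D \<longrightarrow> f x = 0) \<and> continuous_on D f \<and>
     (\<forall>b bs. set (b # bs) \<subseteq> Basis \<and> enat (length (b # bs)) < i + 1 \<longrightarrow>
        (\<forall>x \<in> interior D. (\<lambda>t. partial bs f (x + t *\<^sub>R b)) field_differentiable at 0)) \<and>
     (\<forall>bs. set bs \<subseteq> Basis \<and> enat (length bs) < i + 1 \<longrightarrow>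
        (\<exists>g. continuous_on D g \<and> (\<forall>x \<in> interior D. g x = partial bs f x)))}"

text \<open>
  The continuous extension to \<open>D\<close> of a partial derivative (\<open>D\<close> is contained in the closure of its
  interior in all uses below, so the extension is unique and is given by this limit).
\<close>

definition ext_partial :: "'a::euclidean_space set \<Rightarrow> 'a list \<Rightarrow> ('a \<Rightarrow> real) \<Rightarrow> 'a \<Rightarrow> real" where
  "ext_partial D bs f x = Lim (at x within interior D) (partial bs f)"

text \<open>
  Uniform convergence of all partial derivatives of order \<open>< i + 1\<close> on compact subsets of \<open>D\<close>.
\<close>

definition C_topology :: "enat \<Rightarrow> 'a::euclidean_space set \<Rightarrow> ('a \<Rightarrow> real) topology" where
  "C_topology i D = topology_generated_by
     {{g \<in> C_on i D. \<forall>x \<in> K. \<bar>ext_partial D bs g x - ext_partial D bs f x\<bar> < e} | f bs K e.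
        f \<in> C_on i D \<and> set bs \<subseteq> Basis \<and> enat (length bs) < i + 1 \<and>
        compact K \<and> K \<subseteq> D \<and> (0::real) < e}"

text \<open>
  \<open>S\<^sup>1\<close>-factors: the subspace of functions that are \<open>1\<close>-periodic in the coordinate with unit
  vector \<open>u\<close>.
\<close>

definition C_periodic :: "enat \<Rightarrow> 'a \<Rightarrow> 'a::euclidean_space set \<Rightarrow> ('a \<Rightarrow> real) topology" where
  "C_periodic i u D = subtopology (C_topology i D) {f. \<forall>x. f (x + u) = f x}"


subsection \<open>The class \<open>C\<^sup>\<infinity>\<^sub>\<pi>\<close>\<close>

text \<open>
  A topological vector space is given by a topology whose underlying set is a linear subspace of
  the ambient vector space type. Locally convex spaces are Hausdorff, so that limits are unique.
\<close>

definition locally_convex :: "'a::real_vector topology \<Rightarrow> bool" where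
  "locally_convex X \<longleftrightarrow> subspace (topspace X) \<and> Hausdorff_space X \<and>
     continuous_map (prod_topology X X) X (\<lambda>(x, y). x + y) \<and>
     continuous_map (prod_topology euclideanreal X) X (\<lambda>(c, x). c *\<^sub>R x) \<and>
     (\<forall>U. openin X U \<and> 0 \<in> U \<longrightarrow> (\<exists>V. openin X V \<and> 0 \<in> V \<and> V \<subseteq> U \<and> convex V))"

definition zero_nhd :: "'a::real_vector topology \<Rightarrow> 'a set \<Rightarrow> bool" where
  "zero_nhd X U \<longleftrightarrow> U \<subseteq> topspace X \<and> (\<exists>O'. openin X O' \<and> 0 \<in> O' \<and> O' \<subseteq> U)"

text \<open>Partial functions are identified with their graphs.\<close>

definition graph_app :: "('a \<times> 'b) set \<Rightarrow> 'a \<Rightarrow> 'b" where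
  "graph_app f x = (THE y. (x, y) \<in> f)"

definition dir_deriv ::
  "'b topology \<Rightarrow> 'a \<Rightarrow> ('a::real_vector \<times> 'b::real_vector) set \<Rightarrow> ('a \<times> 'b) set" where
  "dir_deriv F u f = {(x, v). x \<in> Domain f \<and> (\<forall>\<^sub>F t in at 0. x + t *\<^sub>R u \<in> Domain f) \<and>
     limitin F (\<lambda>t. inverse t *\<^sub>R (graph_app f (x + t *\<^sub>R u) - graph_app f x)) v (at (0::real))}"

text \<open>The first vector of the list is differentiated along first.\<close>

fun dir_derivs ::
  "'b topology \<Rightarrow> 'a list \<Rightarrow> ('a::real_vector \<times> 'b::real_vector) set \<Rightarrow> ('a \<times> 'b) set" where
  "dir_derivs F [] f = f"
| "dir_derivs F (u # us) f = dir_derivs F us (dir_deriv F u f)"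

text \<open>
  \<open>E\<^sup>l\<close> is the product topology on extensional functions on the index set \<open>{..<l}\<close>.
\<close>

definition nth_deriv :: "'b topology \<Rightarrow> nat \<Rightarrow> ('a::real_vector \<times> 'b::real_vector) set \<Rightarrow>
    'a \<Rightarrow> (nat \<Rightarrow> 'a) \<Rightarrow> 'b" where
  "nth_deriv F l f x u = graph_app (dir_derivs F (map u [0..<l]) f) x"

definition multilinear_on ::
  "'a set \<Rightarrow> nat \<Rightarrow> ((nat \<Rightarrow> 'a::real_vector) \<Rightarrow> 'b::real_vector) \<Rightarrow> bool" where
  "multilinear_on A l m \<longleftrightarrow>
     (\<forall>u \<in> {..<l} \<rightarrow>\<^sub>E A. \<forall>i < l. \<forall>a \<in> A. \<forall>b \<in> A. \<forall>c.
        m (u(i := a + b)) = m (u(i := a)) + m (u(i := b)) \<and>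
        m (u(i := c *\<^sub>R a)) = c *\<^sub>R m (u(i := a)))"

definition C_inf_pi ::
  "('a::real_vector topology \<times> 'b::real_vector topology \<times> ('a \<times> 'b) set) set" where
  "C_inf_pi = {(E, F, f). locally_convex E \<and> locally_convex F \<and>
     single_valued f \<and> Range f \<subseteq> topspace F \<and> openin E (Domain f) \<and>
     (\<forall>l. \<forall>x \<in> Domain f.
        (\<forall>u \<in> {..<l} \<rightarrow>\<^sub>E topspace E. x \<in> Domain (dir_derivs F (map u [0..<l]) f)) \<and>
        multilinear_on (topspace E) l (nth_deriv F l f x) \<and>
        continuous_map (product_topology (\<lambda>_. E) {..<l}) F (nth_deriv F l f x) \<and>
        (\<forall>W. zero_nhd F W \<longrightarrow> (\<exists>U. zero_nhd E U \<and> (\<forall>\<epsilon>>0. \<exists>V. zero_nhd E V \<and>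
           (\<forall>v \<in> V. x + v \<in> Domain f \<and>
              (\<lambda>u. nth_deriv F l f (x + v) u - nth_deriv F l f x u) ` ({..<l} \<rightarrow>\<^sub>E U)
                \<subseteq> (\<lambda>w. \<epsilon> *\<^sub>R w) ` W)))))}"


subsection \<open>The solution relation\<close>

definition E_space :: "real \<Rightarrow> ((real \<Rightarrow> real) \<times> (real \<times> real \<times> real \<Rightarrow> real)) topology" where
  "E_space T = prod_topology (C_periodic \<infinity> 1 UNIV)
                             (C_periodic \<infinity> (0, 1, 0) ({0..T} \<times> UNIV \<times> UNIV))"

definition F_space :: "enat \<Rightarrow> real \<Rightarrow> (real \<times> real \<Rightarrow> real) topology" where
  "F_space i T = C_periodic i (0, 1) ({0..T} \<times> UNIV)"

definition solution_graph ::
  "real \<Rightarrow> (((real \<Rightarrow> real) \<times> (real \<times> real \<times> real \<Rightarrow> real)) \<times> (real \<times> real \<Rightarrow> real)) set" where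
  "solution_graph T = {((y0, \<phi>), y). (y0, \<phi>) \<in> topspace (E_space T) \<and> y \<in> topspace (F_space 1 T) \<and>
     (\<forall>t \<in> {0..T}. \<forall>\<eta>. y (t, \<eta>) =
        y0 (\<eta> - t) + integral {0..t} (\<lambda>\<tau>. \<phi> (\<tau>, \<eta> - t + \<tau>, y (\<tau>, \<eta> - t + \<tau>))))}"

end

theory Submission
  imports Defs
begin

text \<open>
  Along a characteristic \<open>\<eta> = \<xi> + t\<close> the transport equation is a scalar ordinary differential equation
  with parameter \<open>\<xi>\<close>. Solvability is an open condition on the data by Banach's fixed point theorem and Gronwall's
  inequality, and the derivative of the solution, in \<open>\<xi>\<close> as well as in the data, solves a linear scalar
  equation and is therefore given explicitly by exponentials and integrals. The class of all
  expressions in the data, their derivatives along the solution, exponentials and integrals along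
  characteristics is thus closed under differentiation in \<open>t\<close>, in \<open>\<xi>\<close> and in the data; since each
  expression depends continuously on the data, uniformly in \<open>(t, \<xi>)\<close>, all derivatives of the
  solution operator exist and are continuous with respect to all seminorms. Local boundedness of the
  derivative of order \<open>l + 1\<close> gives the uniform estimate of \<open>C\<^sup>\<infinity>\<^sub>\<pi>\<close> for the derivative of order \<open>l\<close>.
\<close>

section \<open>Topologies defined by an increasing sequence of seminorms\<close>

text \<open>Frechet spaces offer no inverse function theorem to fall back on, and inserting
  \<open>y\<close> into \<phi> costs derivatives of \<phi>, so no single Banach space carries all
  orders. Closed formulas take its place: differentiation is a map on the syntax \<open>expr\<close>
  and can be iterated without limit. A seminorm of the target then concerns finitely many
  expressions only, and one statement about all of them, uniform continuity in the data
  (\<open>ev_uniform_limit\<close>), supports every limit. Periodicity supplies compactness in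
  \<xi>, so that each expression is bounded although the value variable of \<phi> ranges over the
  whole line. Space and data derivatives are two instances of one parameter derivative of a scalar
  integral equation. The formal derivations do not commute as syntax; that their values do is a
  separate argument (\<open>pd_dv_commute\<close>). In \<open>C_inf_pi\<close> the neighbourhood
  \<open>U\<close> precedes \<epsilon>: on one fixed ball the derivative of order
  \<open>l + 1\<close> is bounded by 1, and shrinking its last argument alone yields the factor
  \<epsilon>.\<close>

locale graded_seminorms =
  fixes X :: "'a::real_vector topology" and p :: "nat \<Rightarrow> 'a \<Rightarrow> real"
  assumes subspace_carrier: "subspace (topspace X)"
    and triangle: "\<lbrakk>x \<in> topspace X; y \<in> topspace X\<rbrakk> \<Longrightarrow> p n (x + y) \<le> p n x + p n y"
    and scale: "x \<in> topspace X \<Longrightarrow> p n (c *\<^sub>R x) = \<bar>c\<bar> * p n x"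
    and mono: "\<lbrakk>m \<le> n; x \<in> topspace X\<rbrakk> \<Longrightarrow> p m x \<le> p n x"
    and separating: "\<lbrakk>x \<in> topspace X; \<And>n. p n x = 0\<rbrakk> \<Longrightarrow> x = 0"
    and openin_iff: "openin X U \<longleftrightarrow> U \<subseteq> topspace X \<and>
      (\<forall>x \<in> U. \<exists>n. \<exists>e>0. \<forall>y \<in> topspace X. p n (y - x) < e \<longrightarrow> y \<in> U)"
begin

lemma carrier_closed:
  "0 \<in> topspace X"
  "x \<in> topspace X \<Longrightarrow> y \<in> topspace X \<Longrightarrow> x + y \<in> topspace X"
  "x \<in> topspace X \<Longrightarrow> y \<in> topspace X \<Longrightarrow> x - y \<in> topspace X"
  "x \<in> topspace X \<Longrightarrow> c *\<^sub>R x \<in> topspace X"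
  using subspace_carrier by (auto simp: subspace_def subspace_diff)

lemma seminorm_zero: "p n 0 = 0"
  using scale[OF carrier_closed(1), of n 0] by simp

lemma seminorm_minus_commute:
  assumes "x \<in> topspace X" "y \<in> topspace X"
  shows "p n (x - y) = p n (y - x)"
  using scale[OF carrier_closed(3)[OF assms], of n "-1"] by simp

lemma triangle_diff:
  assumes "x \<in> topspace X" "y \<in> topspace X" "z \<in> topspace X"
  shows "p n (x - z) \<le> p n (x - y) + p n (y - z)"
  using triangle[of "x - y" "y - z" n] assms carrier_closed by simp

lemma seminorm_nonneg:
  assumes "x \<in> topspace X" shows "0 \<le> p n x"
  using triangle_diff[of x 0 x n] scale[OF assms, of n "-1"] assms carrier_closed(1) seminorm_zero
  by simp

lemma openin_ball:
  assumes "x \<in> topspace X"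
  shows "openin X {y \<in> topspace X. p n (y - x) < e}"
  unfolding openin_iff
proof (intro conjI ballI)
  fix y assume y: "y \<in> {y \<in> topspace X. p n (y - x) < e}"
  have "z \<in> {y \<in> topspace X. p n (y - x) < e}"
    if "z \<in> topspace X" "p n (z - y) < e - p n (y - x)" for z
    using triangle_diff[of z y x n] y that assms by auto
  with y show "\<exists>n'. \<exists>e'>0. \<forall>z \<in> topspace X. p n' (z - y) < e' \<longrightarrow>
      z \<in> {y \<in> topspace X. p n (y - x) < e}"
    by (intro exI[of _ n] exI[of _ "e - p n (y - x)"]) auto
qed auto

lemma zero_nhd_iff:
  "zero_nhd X U \<longleftrightarrow> U \<subseteq> topspace X \<and> (\<exists>n. \<exists>e>0. \<forall>y \<in> topspace X. p n y < e \<longrightarrow> y \<in> U)"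
proof
  assume "zero_nhd X U"
  then obtain V where V: "openin X V" "0 \<in> V" "V \<subseteq> U" "U \<subseteq> topspace X"
    by (auto simp: zero_nhd_def)
  then show "U \<subseteq> topspace X \<and> (\<exists>n. \<exists>e>0. \<forall>y \<in> topspace X. p n y < e \<longrightarrow> y \<in> U)"
    unfolding openin_iff by (metis diff_zero subsetD)
next
  assume R: "U \<subseteq> topspace X \<and> (\<exists>n. \<exists>e>0. \<forall>y \<in> topspace X. p n y < e \<longrightarrow> y \<in> U)"
  then obtain n e where "e > 0" "\<forall>y \<in> topspace X. p n y < e \<longrightarrow> y \<in> U" by blast
  then show "zero_nhd X U"
    unfolding zero_nhd_def using R openin_ball[OF carrier_closed(1), of n e] carrier_closed(1)
    by (intro conjI exI[of _ "{y \<in> topspace X. p n (y - 0) < e}"]) (auto simp: seminorm_zero)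
qed

lemma zero_nhd_ball: "e > 0 \<Longrightarrow> zero_nhd X {y \<in> topspace X. p n y < e}"
  unfolding zero_nhd_iff by blast

lemma limitin_iff:
  "limitin X f l F \<longleftrightarrow> l \<in> topspace X \<and>
     (\<forall>n. \<forall>e>0. \<forall>\<^sub>F a in F. f a \<in> topspace X \<and> p n (f a - l) < e)"
proof (intro iffI conjI allI impI)
  assume L: "limitin X f l F"
  then show l: "l \<in> topspace X" by (simp add: limitin_def)
  fix n and e :: real assume "e > 0"
  with L l openin_ball[OF l, of n e] show "\<forall>\<^sub>F a in F. f a \<in> topspace X \<and> p n (f a - l) < e"
    unfolding limitin_def by (auto dest!: spec[of _ "{y \<in> topspace X. p n (y - l) < e}"] simp: seminorm_zero)
next
  assume R: "l \<in> topspace X \<and> (\<forall>n. \<forall>e>0. \<forall>\<^sub>F a in F. f a \<in> topspace X \<and> p n (f a - l) < e)"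
  show "limitin X f l F"
    unfolding limitin_def
  proof (intro conjI allI impI)
    fix U assume U: "openin X U \<and> l \<in> U"
    then obtain n e where ne: "e > 0" "\<forall>y \<in> topspace X. p n (y - l) < e \<longrightarrow> y \<in> U"
      unfolding openin_iff by blast
    then have "\<forall>\<^sub>F a in F. f a \<in> topspace X \<and> p n (f a - l) < e"
      using R by blast
    then show "\<forall>\<^sub>F a in F. f a \<in> U"
      by (rule eventually_mono) (use ne in blast)
  qed (use R in blast)
qed

lemma Hausdorff: "Hausdorff_space X"
  unfolding Hausdorff_space_def
proof (intro allI impI)
  fix x y assume A: "x \<in> topspace X \<and> y \<in> topspace X \<and> x \<noteq> y"
  then obtain n where n: "p n (x - y) \<noteq> 0"
    using separating[of "x - y"] carrier_closed by auto
  define e where "e = p n (x - y) / 2"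
  have e: "e > 0"
    using n seminorm_nonneg[of "x - y" n] A carrier_closed by (simp add: e_def)
  have "disjnt {z \<in> topspace X. p n (z - x) < e} {z \<in> topspace X. p n (z - y) < e}"
    using A triangle_diff[of x _ y n] seminorm_minus_commute[of x _ n]
    by (fastforce simp: disjnt_iff e_def)
  then show "\<exists>U V. openin X U \<and> openin X V \<and> x \<in> U \<and> y \<in> V \<and> disjnt U V"
    using openin_ball A e seminorm_zero
    by (intro exI[of _ "{z \<in> topspace X. p n (z - x) < e}"]
        exI[of _ "{z \<in> topspace X. p n (z - y) < e}"]) auto
qed

lemma continuous_map_into:
  assumes "\<And>x. x \<in> topspace Y \<Longrightarrow> f x \<in> topspace X"
    and "\<And>x n e. \<lbrakk>x \<in> topspace Y; e > 0\<rbrakk> \<Longrightarrow>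
      \<exists>U. openin Y U \<and> x \<in> U \<and> (\<forall>y\<in>U. p n (f y - f x) < e)"
  shows "continuous_map Y X f"
  unfolding continuous_map_def
proof (intro conjI allI impI)
  fix V assume V: "openin X V"
  show "openin Y {x \<in> topspace Y. f x \<in> V}"
  proof (subst openin_subopen, intro ballI)
    fix x assume "x \<in> {x \<in> topspace Y. f x \<in> V}"
    then have x: "x \<in> topspace Y" "f x \<in> V" by auto
    obtain n e where ne: "e > 0" "\<forall>y \<in> topspace X. p n (y - f x) < e \<longrightarrow> y \<in> V"
      using V x unfolding openin_iff by blast
    obtain U where "openin Y U" "x \<in> U" "\<forall>y\<in>U. p n (f y - f x) < e"
      using assms(2)[OF x(1) ne(1), of n] by blast
    then show "\<exists>U. openin Y U \<and> x \<in> U \<and> U \<subseteq> {x \<in> topspace Y. f x \<in> V}"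
      using ne(2) assms(1) openin_subset by (intro exI[of _ U]) blast
  qed
qed (use assms(1) in auto)

lemma continuous_map_add: "continuous_map (prod_topology X X) X (\<lambda>(x, y). x + y)"
proof (rule continuous_map_into)
  fix x n and e :: real assume x: "x \<in> topspace (prod_topology X X)" and e: "e > 0"
  obtain a b where ab: "x = (a, b)" by fastforce
  have m: "a \<in> topspace X" "b \<in> topspace X" using x ab by auto
  define d where "d = e / 2"
  have d: "d > 0" using e by (simp add: d_def)
  let ?U = "\<lambda>a. {y \<in> topspace X. p n (y - a) < d}"
  have "p n ((c + c') - (a + b)) < e" if "c \<in> ?U a" "c' \<in> ?U b" for c c'
    using triangle[of "c - a" "c' - b" n] that m carrier_closed
    by (auto simp: algebra_simps d_def)
  then show "\<exists>U. openin (prod_topology X X) U \<and> x \<in> U \<and>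
      (\<forall>y\<in>U. p n ((case y of (x, y) \<Rightarrow> x + y) - (case x of (x, y) \<Rightarrow> x + y)) < e)"
    using m openin_ball d ab seminorm_zero
    by (intro exI[of _ "?U a \<times> ?U b"]) (auto simp: openin_prod_Times_iff)
qed (auto intro: carrier_closed)

lemma continuous_map_scaleR:
  "continuous_map (prod_topology euclideanreal X) X (\<lambda>(c, x). c *\<^sub>R x)"
proof (rule continuous_map_into)
  fix x n and e :: real
  assume x: "x \<in> topspace (prod_topology euclideanreal X)" and e: "e > 0"
  obtain c a where ca: "x = (c, a)" by fastforce
  have m: "a \<in> topspace X" using x ca by auto
  \<comment> \<open>The difference is split as \<open>d (b - a) + (d - c) a\<close>. The bound
    \<open>r\<close> makes the second term at most \<open>e / 2\<close> and keeps
    \<open>|d| <= |c| + 1\<close>, for which \<open>s\<close> is chosen. The added ones avoid zero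
    denominators and give a strict inequality.\<close>
  define r where "r = min 1 (e / (2 * (p n a + 1)))"
  define s where "s = e / (2 * (\<bar>c\<bar> + 1))"
  have pa: "p n a \<ge> 0" using m seminorm_nonneg by blast
  have rs: "r > 0" "s > 0" using e pa by (auto simp: r_def s_def)
  have "p n (d *\<^sub>R b - c *\<^sub>R a) < e" if d: "d \<in> ball c r" and b: "b \<in> topspace X" "p n (b - a) < s" for d b
  proof -
    have "p n (d *\<^sub>R b - c *\<^sub>R a) \<le> p n (d *\<^sub>R (b - a)) + p n ((d - c) *\<^sub>R a)"
      using triangle[of "d *\<^sub>R (b - a)" "(d - c) *\<^sub>R a" n] b m carrier_closed
      by (simp add: algebra_simps)
    also have "\<dots> = \<bar>d\<bar> * p n (b - a) + \<bar>d - c\<bar> * p n a"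
      using scale b m carrier_closed by simp
    also have "\<dots> < (\<bar>c\<bar> + 1) * s + r * (p n a + 1)"
    proof -
      have 1: "\<bar>d - c\<bar> < r" using d by (simp add: dist_real_def abs_minus_commute)
      then have 2: "\<bar>d\<bar> \<le> \<bar>c\<bar> + 1" by (auto simp: r_def)
      have "\<bar>d\<bar> * p n (b - a) \<le> (\<bar>c\<bar> + 1) * s"
        using 2 b(2) seminorm_nonneg[of "b - a" n] b m carrier_closed rs
        by (intro mult_mono) auto
      moreover have "\<bar>d - c\<bar> * p n a < r * (p n a + 1)"
        using 1 pa by (intro mult_strict_mono') auto
      ultimately show ?thesis by linarith
    qed
    also have "\<dots> \<le> e / 2 + e / 2"
    proof (rule add_mono)
      show "(\<bar>c\<bar> + 1) * s \<le> e / 2" by (simp add: s_def field_simps)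
      have "r * (p n a + 1) \<le> (e / (2 * (p n a + 1))) * (p n a + 1)"
        using pa by (intro mult_right_mono) (auto simp: r_def)
      also have "\<dots> = e / 2" using pa by (simp add: field_simps)
      finally show "r * (p n a + 1) \<le> e / 2" .
    qed
    finally show ?thesis by simp
  qed
  then show "\<exists>U. openin (prod_topology euclideanreal X) U \<and> x \<in> U \<and>
      (\<forall>y\<in>U. p n ((case y of (c, x) \<Rightarrow> c *\<^sub>R x) - (case x of (c, x) \<Rightarrow> c *\<^sub>R x)) < e)"
    using m openin_ball rs ca seminorm_zero
    by (intro exI[of _ "ball c r \<times> {y \<in> topspace X. p n (y - a) < s}"])
      (auto simp: openin_prod_Times_iff)
qed (auto intro: carrier_closed)

lemma locally_convex: "locally_convex X"
  unfolding locally_convex_def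
proof (intro conjI allI impI)
  fix U assume "openin X U \<and> 0 \<in> U"
  then obtain n e where ne: "e > 0" "\<forall>y \<in> topspace X. p n y < e \<longrightarrow> y \<in> U"
    unfolding openin_iff by (metis diff_zero)
  define V where "V = {y \<in> topspace X. p n (y - 0) < e}"
  have "convex V"
    unfolding convex_def
  proof (intro ballI allI impI)
    fix x y and u v :: real
    assume A: "x \<in> V" "y \<in> V" "0 \<le> u" "0 \<le> v" "u + v = 1"
    then have m: "x \<in> topspace X" "y \<in> topspace X" "p n x < e" "p n y < e" by (auto simp: V_def)
    have "p n (u *\<^sub>R x + v *\<^sub>R y) \<le> u * p n x + v * p n y"
      using triangle[of "u *\<^sub>R x" "v *\<^sub>R y" n] m carrier_closed A scale by simp
    also have "\<dots> < e"
      using A m by (metis convex_bound_lt)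
    finally show "u *\<^sub>R x + v *\<^sub>R y \<in> V" using m carrier_closed by (simp add: V_def)
  qed
  then show "\<exists>V. openin X V \<and> 0 \<in> V \<and> V \<subseteq> U \<and> convex V"
    using openin_ball[OF carrier_closed(1), of n e] ne carrier_closed(1)
    by (intro exI[of _ V]) (auto simp: V_def seminorm_zero)
qed (use subspace_carrier Hausdorff continuous_map_add continuous_map_scaleR in auto)

end

text \<open>Monotonicity in the index allows two indices to be replaced by their maximum, so sums of
  seminorms of equal index already describe the product topology.\<close>

lemma graded_seminorms_prod:
  assumes "graded_seminorms X p" "graded_seminorms Y q"
  shows "graded_seminorms (prod_topology X Y) (\<lambda>n x. p n (fst x) + q n (snd x))"
proof -
  interpret X: graded_seminorms X p by fact
  interpret Y: graded_seminorms Y q by fact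
  show ?thesis
  proof
    show "subspace (topspace (prod_topology X Y))"
      unfolding subspace_def using X.carrier_closed Y.carrier_closed by (auto simp: zero_prod_def)
  next
    fix x y n assume "x \<in> topspace (prod_topology X Y)" "y \<in> topspace (prod_topology X Y)"
    then show "p n (fst (x + y)) + q n (snd (x + y)) \<le>
        p n (fst x) + q n (snd x) + (p n (fst y) + q n (snd y))"
      using X.triangle[of "fst x" "fst y" n] Y.triangle[of "snd x" "snd y" n]
      by (auto simp: mem_Times_iff)
  next
    fix x n c assume "x \<in> topspace (prod_topology X Y)"
    then show "p n (fst (c *\<^sub>R x)) + q n (snd (c *\<^sub>R x)) = \<bar>c\<bar> * (p n (fst x) + q n (snd x))"
      using X.scale[of "fst x" n c] Y.scale[of "snd x" n c]
      by (auto simp: mem_Times_iff algebra_simps)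
  next
    fix m n :: nat and x assume "m \<le> n" "x \<in> topspace (prod_topology X Y)"
    then show "p m (fst x) + q m (snd x) \<le> p n (fst x) + q n (snd x)"
      using X.mono Y.mono by (auto simp: mem_Times_iff intro: add_mono)
  next
    fix x assume A: "x \<in> topspace (prod_topology X Y)" "\<And>n. p n (fst x) + q n (snd x) = 0"
    have "p n (fst x) = 0 \<and> q n (snd x) = 0" for n
      using A(2)[of n] A(1) X.seminorm_nonneg[of "fst x" n] Y.seminorm_nonneg[of "snd x" n]
      by (auto simp: mem_Times_iff)
    then show "x = 0"
      using X.separating[of "fst x"] Y.separating[of "snd x"] A(1)
      by (auto simp: mem_Times_iff prod_eq_iff)
  next
    fix U
    show "openin (prod_topology X Y) U \<longleftrightarrow> U \<subseteq> topspace (prod_topology X Y) \<and>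
      (\<forall>x \<in> U. \<exists>n. \<exists>e>0. \<forall>y \<in> topspace (prod_topology X Y).
        p n (fst (y - x)) + q n (snd (y - x)) < e \<longrightarrow> y \<in> U)" (is "?L \<longleftrightarrow> ?R")
    proof
      assume L: ?L
      have "\<exists>n. \<exists>e>0. \<forall>y \<in> topspace (prod_topology X Y).
        p n (fst (y - x)) + q n (snd (y - x)) < e \<longrightarrow> y \<in> U" if x: "x \<in> U" for x
      proof -
        obtain V W where VW: "openin X V" "openin Y W" "fst x \<in> V" "snd x \<in> W" "V \<times> W \<subseteq> U"
          using L x unfolding openin_prod_topology_alt by (metis prod.collapse)
        obtain n d where nd: "d > 0" "\<forall>y \<in> topspace X. p n (y - fst x) < d \<longrightarrow> y \<in> V"
          using VW X.openin_iff by blast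
        obtain m e where me: "e > 0" "\<forall>y \<in> topspace Y. q m (y - snd x) < e \<longrightarrow> y \<in> W"
          using VW Y.openin_iff by blast
        have xm: "fst x \<in> topspace X" "snd x \<in> topspace Y"
          using VW openin_subset[OF VW(1)] openin_subset[OF VW(2)] by auto
        have "y \<in> U" if y: "y \<in> topspace (prod_topology X Y)"
          and s: "p (max m n) (fst (y - x)) + q (max m n) (snd (y - x)) < min d e" for y
        proof -
          have ym: "fst y - fst x \<in> topspace X" "snd y - snd x \<in> topspace Y"
            using y xm X.carrier_closed Y.carrier_closed by (auto simp: mem_Times_iff)
          have "p n (fst y - fst x) < d" "q m (snd y - snd x) < e"
            using s X.mono[OF _ ym(1), of n "max m n"] Y.mono[OF _ ym(2), of m "max m n"]
              X.seminorm_nonneg[OF ym(1), of "max m n"] Y.seminorm_nonneg[OF ym(2), of "max m n"]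
            by auto
          then have "fst y \<in> V" "snd y \<in> W" using nd me y by (auto simp: mem_Times_iff)
          then show ?thesis using VW(5) by (metis mem_Times_iff subsetD)
        qed
        then show ?thesis
          using nd(1) me(1) by (intro exI[of _ "max m n"] exI[of _ "min d e"] conjI ballI impI) simp_all
      qed
      then show ?R using openin_subset[OF L] by blast
    next
      assume R: ?R
      show ?L
        unfolding openin_prod_topology_alt
      proof (intro allI impI)
        fix a b assume ab: "(a, b) \<in> U"
        then obtain n e where ne: "e > 0" "\<forall>y \<in> topspace (prod_topology X Y).
            p n (fst (y - (a, b))) + q n (snd (y - (a, b))) < e \<longrightarrow> y \<in> U"
          using R by blast
        have m: "a \<in> topspace X" "b \<in> topspace Y" using R ab by auto
        show "\<exists>V W. openin X V \<and> openin Y W \<and> a \<in> V \<and> b \<in> W \<and> V \<times> W \<subseteq> U"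
        proof -
          define d where "d = e / 2"
          have d: "d > 0" "e = d + d" using ne by (auto simp: d_def)
          let ?V = "{y \<in> topspace X. p n (y - a) < d}" and ?W = "{y \<in> topspace Y. q n (y - b) < d}"
          have "?V \<times> ?W \<subseteq> U"
            using ne(2) d(2) by (auto intro: add_strict_mono)
          then show ?thesis
            using X.openin_ball[OF m(1), of n d] Y.openin_ball[OF m(2), of n d] m d(1)
            by (intro exI[of _ ?V] exI[of _ ?W]) (simp add: X.seminorm_zero Y.seminorm_zero)
        qed
      qed
    qed
  qed
qed

section \<open>Spaces of smooth functions\<close>

text \<open>A derivative along a line sees only values near the point, so a formula for
  \<open>partial bs f\<close> on an open set determines the next order. This is the induction step
  of all computations of iterated partial derivatives.\<close>

lemma partial_Cons_eqI:
  assumes "open S" "x \<in> S" "\<And>y. y \<in> S \<Longrightarrow> partial bs f y = h y"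
    and "((\<lambda>t. h (x + t *\<^sub>R b)) has_real_derivative d) (at 0)"
  shows "((\<lambda>t. partial bs f (x + t *\<^sub>R b)) has_real_derivative d) (at 0)"
    and "partial (b # bs) f x = d"
proof -
  have "((\<lambda>t. x + t *\<^sub>R b) \<longlongrightarrow> x + 0 *\<^sub>R b) (nhds 0)"
    by (intro tendsto_intros filterlim_ident)
  then have "\<forall>\<^sub>F t in nhds 0. x + t *\<^sub>R b \<in> S"
    using assms(1,2) by (auto intro: topological_tendstoD)
  then have "\<forall>\<^sub>F t in nhds 0. partial bs f (x + t *\<^sub>R b) = h (x + t *\<^sub>R b)"
    by (rule eventually_mono) (rule assms(3))
  from DERIV_cong_ev[OF refl this refl, of d] assms(4)
  show "((\<lambda>t. partial bs f (x + t *\<^sub>R b)) has_real_derivative d) (at 0)"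
    by blast
  then show "partial (b # bs) f x = d"
    by (simp add: DERIV_imp_deriv)
qed

lemma partial_has_derivative:
  assumes "f \<in> C_on \<infinity> D" "x \<in> interior D" "set (b # bs) \<subseteq> Basis"
  shows "((\<lambda>t. partial bs f (x + t *\<^sub>R b)) has_real_derivative partial (b # bs) f x) (at 0)"
proof -
  have "(\<lambda>t. partial bs f (x + t *\<^sub>R b)) field_differentiable at 0"
    using assms unfolding C_on_def by auto
  then show ?thesis
    by (simp add: DERIV_deriv_iff_field_differentiable)
qed

lemma partial_lincomb:
  assumes "f \<in> C_on \<infinity> D" "g \<in> C_on \<infinity> D" "set bs \<subseteq> Basis" "x \<in> interior D"
  shows "partial bs (a *\<^sub>R f + g) x = a * partial bs f x + partial bs g x"
  using assms(3,4)
proof (induction bs arbitrary: x)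
  case (Cons b bs)
  have "((\<lambda>t. a * partial bs f (x + t *\<^sub>R b) + partial bs g (x + t *\<^sub>R b)) has_real_derivative
      a * partial (b # bs) f x + partial (b # bs) g x) (at 0)"
    by (intro derivative_intros DERIV_cmult partial_has_derivative[OF assms(1)]
        partial_has_derivative[OF assms(2)] Cons.prems)
  with Cons show ?case
    by (intro partial_Cons_eqI(2)[where S = "interior D" and
          h = "\<lambda>y. a * partial bs f y + partial bs g y"]) auto
qed (simp add: scaleR_fun_def plus_fun_def)

lemma partial_zero: "partial bs 0 x = 0"
  by (induction bs arbitrary: x) (auto simp: zero_fun_def)

lemma topspace_C_topology: "topspace (C_topology i D) = C_on i D"
proof
  show "topspace (C_topology i D) \<subseteq> C_on i D"
    unfolding C_topology_def topology_generated_by_topspace by blast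
  have "enat 0 < i + 1" by (cases i) (auto simp: one_enat_def)
  \<comment> \<open>For empty \<open>K\<close> the generating set is all of
    \<open>C_on i D\<close>.\<close>
  then have "f \<in> topspace (C_topology i D)" if "f \<in> C_on i D" for f
    unfolding C_topology_def topology_generated_by_topspace using that
    by (intro UnionI[of "{g \<in> C_on i D. \<forall>x \<in> {}. \<bar>ext_partial D [] g x - ext_partial D [] f x\<bar> < 1}"])
      (auto intro!: exI[of _ f] exI[of _ "[]"] exI[of _ "{}"] exI[of _ "1::real"])
  then show "C_on i D \<subseteq> topspace (C_topology i D)" by blast
qed

text \<open>The inclusion in the closure of the interior makes continuous extensions of partial
  derivatives unique; closedness makes the intersections with balls compact.\<close>

locale regular_domain =
  fixes D :: "'a::euclidean_space set"
  assumes closed_domain: "closed D"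
    and domain_subset: "D \<subseteq> closure (interior D)"
begin

lemma at_within_interior_nontrivial:
  assumes "x \<in> D" shows "at x within interior D \<noteq> bot"
proof -
  have "x islimpt interior D"
  proof (cases "x \<in> interior D")
    case True
    then show ?thesis by (simp add: interior_limit_point)
  next
    case False
    with assms domain_subset show ?thesis by (auto simp: closure_def)
  qed
  then show ?thesis by (simp add: trivial_limit_within)
qed

text \<open>Every point of \<open>D\<close> is a limit point of the interior, so the limit that
  defines the extension is unique. Exhibiting a continuous function with the right interior values
  is therefore the way to compute \<open>ext_partial\<close>.\<close>

lemma ext_partial_eqI:
  assumes "continuous_on D g" "\<And>x. x \<in> interior D \<Longrightarrow> partial bs f x = g x" "x \<in> D"
  shows "ext_partial D bs f x = g x"
proof -
  have "(g \<longlongrightarrow> g x) (at x within interior D)"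
    using assms(1,3) interior_subset[of D] by (meson continuous_on_def tendsto_within_subset)
  then have "(partial bs f \<longlongrightarrow> g x) (at x within interior D)"
    by (rule Lim_transform_eventually)
      (use assms(2) in \<open>auto simp: eventually_at_filter\<close>)
  then show ?thesis
    unfolding ext_partial_def
    using at_within_interior_nontrivial[OF assms(3)] by (intro tendsto_Lim) auto
qed

lemma
  assumes "f \<in> C_on \<infinity> D" "set bs \<subseteq> Basis"
  shows continuous_on_ext_partial: "continuous_on D (ext_partial D bs f)"
    and ext_partial_interior: "x \<in> interior D \<Longrightarrow> ext_partial D bs f x = partial bs f x"
proof -
  have "\<exists>g. continuous_on D g \<and> (\<forall>x \<in> interior D. g x = partial bs f x)"
    using assms unfolding C_on_def by auto
  then obtain g where g: "continuous_on D g" "\<And>x. x \<in> interior D \<Longrightarrow> partial bs f x = g x"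
    by fastforce
  have e: "ext_partial D bs f x = g x" if "x \<in> D" for x
    using ext_partial_eqI[OF g that] .
  show "continuous_on D (ext_partial D bs f)"
    using g(1) e by (simp cong: continuous_on_cong)
  show "x \<in> interior D \<Longrightarrow> ext_partial D bs f x = partial bs f x"
    using e g(2) interior_subset by fastforce
qed

lemma ext_partial_Nil:
  assumes "f \<in> C_on \<infinity> D" "x \<in> D" shows "ext_partial D [] f x = f x"
  using assms by (intro ext_partial_eqI) (auto simp: C_on_def)

lemma ext_partial_lincomb:
  assumes "f \<in> C_on \<infinity> D" "g \<in> C_on \<infinity> D" "set bs \<subseteq> Basis" "x \<in> D"
  shows "ext_partial D bs (a *\<^sub>R f + g) x = a * ext_partial D bs f x + ext_partial D bs g x"
proof (rule ext_partial_eqI)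
  show "continuous_on D (\<lambda>x. a * ext_partial D bs f x + ext_partial D bs g x)"
    using assms by (intro continuous_intros continuous_on_ext_partial)
qed (use assms in \<open>simp_all only: partial_lincomb ext_partial_interior\<close>)

lemma C_on_lincomb:
  assumes "f \<in> C_on \<infinity> D" "g \<in> C_on \<infinity> D"
  shows "a *\<^sub>R f + g \<in> C_on \<infinity> D"
  unfolding C_on_def
proof (intro CollectI conjI allI impI ballI)
  fix x assume "x \<notin> D" then show "(a *\<^sub>R f + g) x = 0"
    using assms by (simp add: C_on_def scaleR_fun_def)
next
  have "continuous_on D (\<lambda>x. a * f x + g x)"
    using assms by (auto intro!: continuous_intros simp: C_on_def)
  then show "continuous_on D (a *\<^sub>R f + g)"
    by (simp add: scaleR_fun_def plus_fun_def)
next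
  fix b x :: 'a and bs assume b: "set (b # bs) \<subseteq> Basis \<and> enat (length (b # bs)) < \<infinity> + 1" "x \<in> interior D"
  have "((\<lambda>t. a * partial bs f (x + t *\<^sub>R b) + partial bs g (x + t *\<^sub>R b)) has_real_derivative
      a * partial (b # bs) f x + partial (b # bs) g x) (at 0)"
    using b by (intro derivative_intros DERIV_cmult partial_has_derivative[OF assms(1)]
        partial_has_derivative[OF assms(2)]) auto
  with b assms show "(\<lambda>t. partial bs (a *\<^sub>R f + g) (x + t *\<^sub>R b)) field_differentiable at 0"
    unfolding field_differentiable_def
    by (intro exI partial_Cons_eqI(1)[where S = "interior D" and
          h = "\<lambda>y. a * partial bs f y + partial bs g y"]) (auto intro: partial_lincomb)
next
  fix bs :: "'a list" assume "set bs \<subseteq> Basis \<and> enat (length bs) < \<infinity> + 1"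
  with assms show "\<exists>h. continuous_on D h \<and> (\<forall>x \<in> interior D. h x = partial bs (a *\<^sub>R f + g) x)"
    by (intro exI[of _ "\<lambda>x. a * ext_partial D bs f x + ext_partial D bs g x"] conjI ballI
        continuous_intros continuous_on_ext_partial)
      (simp_all only: partial_lincomb ext_partial_interior)
qed

lemma C_on_zero: "0 \<in> C_on \<infinity> D"
  unfolding C_on_def
proof (intro CollectI conjI allI impI ballI)
  show "continuous_on D 0" by (simp add: zero_fun_def)
  show "\<exists>g. continuous_on D g \<and> (\<forall>x \<in> interior D. g x = partial bs 0 x)" for bs
    by (intro exI[of _ "\<lambda>x. 0"]) (simp add: partial_zero)
qed (simp_all add: partial_zero)

lemma subspace_C_on: "subspace (C_on \<infinity> D)"
  unfolding subspace_def
proof (intro conjI ballI allI)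
  show "x + y \<in> C_on \<infinity> D" if "x \<in> C_on \<infinity> D" "y \<in> C_on \<infinity> D" for x y
    using C_on_lincomb[OF that, of 1] by simp
  show "c *\<^sub>R x \<in> C_on \<infinity> D" if "x \<in> C_on \<infinity> D" for x c
    using C_on_lincomb[OF that C_on_zero, of c] by simp
qed (rule C_on_zero)

lemma
  assumes "f \<in> C_on \<infinity> D" "set bs \<subseteq> Basis" "x \<in> D"
  shows ext_partial_scale: "ext_partial D bs (a *\<^sub>R f) x = a * ext_partial D bs f x"
    and ext_partial_add: "g \<in> C_on \<infinity> D \<Longrightarrow>
      ext_partial D bs (f + g) x = ext_partial D bs f x + ext_partial D bs g x"
    and ext_partial_diff: "g \<in> C_on \<infinity> D \<Longrightarrow>
      ext_partial D bs (f - g) x = ext_partial D bs f x - ext_partial D bs g x"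
proof -
  have z: "ext_partial D bs 0 x = 0"
    using assms(3) by (intro ext_partial_eqI[of "\<lambda>x. 0"]) (auto simp: partial_zero)
  show "ext_partial D bs (a *\<^sub>R f) x = a * ext_partial D bs f x"
    using ext_partial_lincomb[OF assms(1) C_on_zero assms(2,3), of a] z by simp
  show "ext_partial D bs (f + g) x = ext_partial D bs f x + ext_partial D bs g x"
    if "g \<in> C_on \<infinity> D"
    using ext_partial_lincomb[OF assms(1) that assms(2,3), of 1] by simp
  show "ext_partial D bs (f - g) x = ext_partial D bs f x - ext_partial D bs g x"
    if "g \<in> C_on \<infinity> D"
    using ext_partial_lincomb[OF that assms(1) assms(2,3), of "-1"] by simp
qed

text \<open>The index bounds the order of differentiation and the radius at once, so that a single
  sequence of seminorms suffices. \<open>insert 0\<close> fixes the supremum when no point of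
  \<open>D\<close> lies in the ball.\<close>

definition C_seminorm :: "nat \<Rightarrow> ('a \<Rightarrow> real) \<Rightarrow> real" where
  "C_seminorm n f = Sup (insert 0 {\<bar>ext_partial D bs f x\<bar> | bs x.
     set bs \<subseteq> Basis \<and> length bs \<le> n \<and> x \<in> D \<inter> cball 0 (real n)})"

lemma ext_partial_le_seminorm:
  assumes "f \<in> C_on \<infinity> D" "set bs \<subseteq> Basis" "length bs \<le> n" "x \<in> D" "norm x \<le> real n"
  shows "\<bar>ext_partial D bs f x\<bar> \<le> C_seminorm n f"
proof -
  let ?B = "{bs. set bs \<subseteq> (Basis :: 'a set) \<and> length bs \<le> n}"
  let ?K = "D \<inter> cball 0 (real n)"
  have "bdd_above (\<Union>bs\<in>?B. (\<lambda>x. \<bar>ext_partial D bs f x\<bar>) ` ?K)"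
  proof (subst bdd_above_UN)
    show "finite ?B" by (simp add: finite_lists_length_le)
    have "compact ((\<lambda>x. \<bar>ext_partial D bs f x\<bar>) ` ?K)" if "bs \<in> ?B" for bs
      using that closed_domain assms(1)
      by (intro compact_continuous_image continuous_intros
          continuous_on_subset[OF continuous_on_ext_partial]) (auto simp: compact_Int_closed closed_Int_compact)
    then show "\<forall>bs\<in>?B. bdd_above ((\<lambda>x. \<bar>ext_partial D bs f x\<bar>) ` ?K)"
      by (intro ballI bounded_imp_bdd_above compact_imp_bounded)
  qed
  moreover have "{\<bar>ext_partial D bs f x\<bar> | bs x. set bs \<subseteq> Basis \<and> length bs \<le> n \<and> x \<in> ?K}
      = (\<Union>bs\<in>?B. (\<lambda>x. \<bar>ext_partial D bs f x\<bar>) ` ?K)"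
    by blast
  ultimately show ?thesis
    unfolding C_seminorm_def using assms by (intro cSup_upper) auto
qed

lemma C_seminorm_le:
  assumes "c \<ge> 0" "\<And>bs x. \<lbrakk>set bs \<subseteq> Basis; length bs \<le> n; x \<in> D; norm x \<le> real n\<rbrakk> \<Longrightarrow>
    \<bar>ext_partial D bs f x\<bar> \<le> c"
  shows "C_seminorm n f \<le> c"
  unfolding C_seminorm_def using assms by (intro cSup_least) auto

lemma C_seminorm_nonneg: "f \<in> C_on \<infinity> D \<Longrightarrow> 0 \<le> C_seminorm n f"
proof (cases "\<exists>x\<in>D. norm x \<le> real n")
  case True
  then obtain x where x: "x \<in> D" "norm x \<le> real n" by blast
  assume "f \<in> C_on \<infinity> D"
  from ext_partial_le_seminorm[OF this, of "[]" n x] x show ?thesis by simp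
next
  case False
  then have "{\<bar>ext_partial D bs f x\<bar> | bs x. set bs \<subseteq> Basis \<and> length bs \<le> n \<and> x \<in> D \<inter> cball 0 (real n)} = {}"
    by auto
  then show ?thesis by (simp only: C_seminorm_def cSup_singleton order_refl)
qed

section \<open>Agreement of the seminorms with the generated topology\<close>

lemma C_seminorm_mono:
  assumes "m \<le> n" "f \<in> C_on \<infinity> D" shows "C_seminorm m f \<le> C_seminorm n f"
  using assms by (intro C_seminorm_le C_seminorm_nonneg ext_partial_le_seminorm) auto

lemma openin_C_topologyD:
  assumes "openin (C_topology \<infinity> D) U" "f \<in> U"
  shows "\<exists>n. \<exists>e>0. \<forall>g \<in> C_on \<infinity> D. C_seminorm n (g - f) < e \<longrightarrow> g \<in> U"
  using assms unfolding C_topology_def openin_topology_generated_by_iff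
proof (induction U arbitrary: f rule: generate_topology_on.induct)
  case (Int a b)
  obtain m d where md: "d > 0" "\<forall>g \<in> C_on \<infinity> D. C_seminorm m (g - f) < d \<longrightarrow> g \<in> a"
    using Int by blast
  obtain n e where ne: "e > 0" "\<forall>g \<in> C_on \<infinity> D. C_seminorm n (g - f) < e \<longrightarrow> g \<in> b"
    using Int by blast
  have f: "f \<in> C_on \<infinity> D"
    using openin_subset[of "C_topology \<infinity> D" a] Int unfolding topspace_C_topology
    by (auto simp: C_topology_def openin_topology_generated_by_iff)
  have "g \<in> a \<inter> b" if g: "g \<in> C_on \<infinity> D" "C_seminorm (max m n) (g - f) < min d e" for g
    using md ne g C_seminorm_mono[of m "max m n" "g - f"] C_seminorm_mono[of n "max m n" "g - f"]
      subspace_diff[OF subspace_C_on g(1) f] by auto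
  moreover have "min d e > 0" using md ne by simp
  ultimately show ?case by blast
next
  case (UN K)
  then obtain k where k: "k \<in> K" "f \<in> k" by blast
  from UN.IH[OF this] obtain n e where
    ne: "e > 0" "\<forall>g \<in> C_on \<infinity> D. C_seminorm n (g - f) < e \<longrightarrow> g \<in> k" by blast
  show ?case
    by (rule exI[of _ n], rule exI[of _ e]) (use ne k(1) in \<open>intro conjI ballI impI UnionI[of k], simp_all only: simp_thms\<close>)
next
  case (Basis s)
  then obtain h bs K e where s: "s = {g \<in> C_on \<infinity> D. \<forall>x \<in> K. \<bar>ext_partial D bs g x - ext_partial D bs h x\<bar> < e}"
    and h: "h \<in> C_on \<infinity> D" "set bs \<subseteq> Basis" "compact K" "K \<subseteq> D" "e > 0" by blast
  have f: "f \<in> C_on \<infinity> D" "\<And>x. x \<in> K \<Longrightarrow> \<bar>ext_partial D bs f x - ext_partial D bs h x\<bar> < e"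
    using Basis s by auto
  \<comment> \<open>On a nonempty compact \<open>K\<close> the difference attains its maximum, still
    below \<open>e\<close>; the gap \<open>e - m\<close> is the room left for perturbing
    \<open>f\<close>.\<close>
  obtain m where m: "m < e" "\<And>x. x \<in> K \<Longrightarrow> \<bar>ext_partial D bs f x - ext_partial D bs h x\<bar> \<le> m"
  proof (cases "K = {}")
    case True then show ?thesis using that[of "e - 1"] by auto
  next
    case False
    have "continuous_on K (\<lambda>x. \<bar>ext_partial D bs f x - ext_partial D bs h x\<bar>)"
      using f h by (intro continuous_intros continuous_on_subset[OF continuous_on_ext_partial]) auto
    from continuous_attains_sup[OF h(3) False this] f(2) that show ?thesis by blast
  qed
  obtain R where R: "\<And>x. x \<in> K \<Longrightarrow> norm x \<le> R"
    using h(3) compact_imp_bounded bounded_iff by metis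
  define n where "n = max (length bs) (nat \<lceil>R\<rceil>)"
  have n: "length bs \<le> n" "\<And>x. x \<in> K \<Longrightarrow> norm x \<le> real n"
    using R real_nat_ceiling_ge[of R] by (fastforce simp: n_def)+
  have "g \<in> s" if g: "g \<in> C_on \<infinity> D" "C_seminorm n (g - f) < e - m" for g
  proof -
    have "\<bar>ext_partial D bs g x - ext_partial D bs h x\<bar> < e" if x: "x \<in> K" for x
    proof -
      have "\<bar>ext_partial D bs (g - f) x\<bar> \<le> C_seminorm n (g - f)"
        using h n x g f by (intro ext_partial_le_seminorm subspace_diff[OF subspace_C_on]) auto
      then show ?thesis
        using m(2)[OF x] g(2) ext_partial_diff[of g bs x f] g f h x by fastforce
    qed
    then show ?thesis using g by (simp add: s)
  qed
  moreover have "e - m > 0" using m by simp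
  ultimately show ?case by blast
qed auto

text \<open>Only finitely many lists of basis vectors have length at most \<open>n\<close>, so a
  finite intersection of generating sets lies in the ball. The radius \<open>e / 2\<close> makes up
  for the strictness lost in the supremum.\<close>

lemma openin_C_topology_nhd:
  assumes "f \<in> C_on \<infinity> D" "e > 0"
  shows "\<exists>V. openin (C_topology \<infinity> D) V \<and> f \<in> V \<and> (\<forall>g\<in>V. C_seminorm n (g - f) < e)"
proof -
  let ?B = "{bs. set bs \<subseteq> (Basis :: 'a set) \<and> length bs \<le> n}"
  let ?K = "D \<inter> cball 0 (real n)"
  let ?S = "\<lambda>bs. {g \<in> C_on \<infinity> D. \<forall>x \<in> ?K. \<bar>ext_partial D bs g x - ext_partial D bs f x\<bar> < e / 2}"
  have "openin (C_topology \<infinity> D) (\<Inter>bs\<in>?B. ?S bs)"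
  proof (intro openin_Inter)
    show "finite (?S ` ?B)" by (simp add: finite_lists_length_le)
    show "?S ` ?B \<noteq> {}" by (auto intro: exI[of _ "[]"])
    fix W assume "W \<in> ?S ` ?B"
    then obtain bs where bs: "bs \<in> ?B" "W = ?S bs" by blast
    have "compact ?K" using closed_domain by (simp add: closed_Int_compact)
    with bs assms show "openin (C_topology \<infinity> D) W"
      unfolding C_topology_def
      by (intro topology_generated_by_Basis CollectI exI[of _ f] exI[of _ bs] exI[of _ ?K] exI[of _ "e/2"]) auto
  qed
  moreover have "f \<in> (\<Inter>bs\<in>?B. ?S bs)" using assms by auto
  moreover have "C_seminorm n (g - f) < e" if g: "g \<in> (\<Inter>bs\<in>?B. ?S bs)" for g
  proof -
    have gC: "g \<in> C_on \<infinity> D" using INT_D[OF g, of "[]"] by simp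
    have "C_seminorm n (g - f) \<le> e / 2"
    proof (intro C_seminorm_le)
      fix bs x assume A: "set bs \<subseteq> (Basis :: 'a set)" "length bs \<le> n" "x \<in> D" "norm x \<le> real n"
      then have "g \<in> ?S bs" using g by blast
      then show "\<bar>ext_partial D bs (g - f) x\<bar> \<le> e / 2"
        using A ext_partial_diff[OF gC A(1,3) assms(1)] by force
    qed (use assms in simp)
    then show ?thesis using assms by simp
  qed
  ultimately show ?thesis
    by (intro exI[of _ "\<Inter>bs\<in>?B. ?S bs"] conjI ballI)
qed

lemma graded_seminorms_C_periodic: "graded_seminorms (C_periodic \<infinity> u D) C_seminorm"
proof
  let ?P = "{f :: 'a \<Rightarrow> real. \<forall>x. f (x + u) = f x}"
  have top: "topspace (C_periodic \<infinity> u D) = C_on \<infinity> D \<inter> ?P"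
    by (simp add: C_periodic_def topspace_C_topology)
  show "subspace (topspace (C_periodic \<infinity> u D))"
    unfolding top
    by (intro subspace_inter subspace_C_on) (auto simp: subspace_def scaleR_fun_def)
  show "C_seminorm n (x + y) \<le> C_seminorm n x + C_seminorm n y"
    if "x \<in> topspace (C_periodic \<infinity> u D)" "y \<in> topspace (C_periodic \<infinity> u D)" for x y n
  proof (rule C_seminorm_le)
    have m: "x \<in> C_on \<infinity> D" "y \<in> C_on \<infinity> D" using that top by auto
    then show "0 \<le> C_seminorm n x + C_seminorm n y" using C_seminorm_nonneg by (simp add: add_nonneg_nonneg)
    fix bs z assume A: "set bs \<subseteq> (Basis :: 'a set)" "length bs \<le> n" "z \<in> D" "norm z \<le> real n"
    show "\<bar>ext_partial D bs (x + y) z\<bar> \<le> C_seminorm n x + C_seminorm n y"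
      using ext_partial_add[OF m(1) A(1,3) m(2)] ext_partial_le_seminorm[OF m(1) A]
        ext_partial_le_seminorm[OF m(2) A] by linarith
  qed
  show "C_seminorm n (c *\<^sub>R x) = \<bar>c\<bar> * C_seminorm n x"
    if "x \<in> topspace (C_periodic \<infinity> u D)" for x n c
  proof -
    have *: "C_seminorm n (c *\<^sub>R x) \<le> \<bar>c\<bar> * C_seminorm n x" if m: "x \<in> C_on \<infinity> D" for c x
    proof (rule C_seminorm_le)
      show "0 \<le> \<bar>c\<bar> * C_seminorm n x" using C_seminorm_nonneg[OF m] by simp
      fix bs z assume A: "set bs \<subseteq> (Basis :: 'a set)" "length bs \<le> n" "z \<in> D" "norm z \<le> real n"
      show "\<bar>ext_partial D bs (c *\<^sub>R x) z\<bar> \<le> \<bar>c\<bar> * C_seminorm n x"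
        using ext_partial_scale[OF m A(1,3)] ext_partial_le_seminorm[OF m A]
        by (simp add: abs_mult mult_left_mono)
    qed
    have m: "x \<in> C_on \<infinity> D" using that top by auto
    show ?thesis
    proof (cases "c = 0")
      case True
      then show ?thesis
        using *[OF m, of 0] C_seminorm_nonneg[OF C_on_zero, of n] by simp
    next
      case False
      \<comment> \<open>The reverse inequality results from scaling back by
        \<open>inverse c\<close>.\<close>
      have "C_seminorm n x \<le> \<bar>inverse c\<bar> * C_seminorm n (c *\<^sub>R x)"
        using *[of "c *\<^sub>R x" "inverse c"] subspace_scale[OF subspace_C_on m, of c] False by simp
      then have "\<bar>c\<bar> * C_seminorm n x \<le> C_seminorm n (c *\<^sub>R x)"
        using False by (simp add: field_simps)
      with *[OF m, of c] show ?thesis by simp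
    qed
  qed
  show "C_seminorm m x \<le> C_seminorm n x" if "m \<le> n" "x \<in> topspace (C_periodic \<infinity> u D)" for m n x
    using that top by (intro C_seminorm_mono) auto
  show "x = 0" if x: "x \<in> topspace (C_periodic \<infinity> u D)" and z: "\<And>n. C_seminorm n x = 0" for x
  proof
    fix y
    have m: "x \<in> C_on \<infinity> D" using x top by auto
    show "x y = 0 y"
    proof (cases "y \<in> D")
      case True
      then show ?thesis
        using ext_partial_le_seminorm[OF m, of "[]" "nat \<lceil>norm y\<rceil>" y] z[of "nat \<lceil>norm y\<rceil>"]
          ext_partial_Nil[OF m True] real_nat_ceiling_ge[of "norm y"] by simp
    next
      case False
      then show ?thesis using m by (simp add: C_on_def)
    qed
  qed
  show "openin (C_periodic \<infinity> u D) U \<longleftrightarrow> U \<subseteq> topspace (C_periodic \<infinity> u D) \<and>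
      (\<forall>x \<in> U. \<exists>n. \<exists>e>0. \<forall>y \<in> topspace (C_periodic \<infinity> u D). C_seminorm n (y - x) < e \<longrightarrow> y \<in> U)"
    (is "?L \<longleftrightarrow> ?R") for U
  proof
    assume L: ?L
    then obtain V where V: "openin (C_topology \<infinity> D) V" "U = V \<inter> ?P"
      unfolding C_periodic_def openin_subtopology by blast
    have "\<exists>n. \<exists>e>0. \<forall>y \<in> topspace (C_periodic \<infinity> u D). C_seminorm n (y - x) < e \<longrightarrow> y \<in> U"
      if "x \<in> U" for x
      using openin_C_topologyD[OF V(1), of x] that V(2) top by blast
    then show ?R using openin_subset[OF L] by blast
  next
    assume R: ?R
    show ?L
    proof (subst openin_subopen, intro ballI)
      fix f assume f: "f \<in> U"
      then obtain n e where ne: "e > 0" "\<forall>y \<in> C_on \<infinity> D \<inter> ?P. C_seminorm n (y - f) < e \<longrightarrow> y \<in> U"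
        using R top by metis
      have fm: "f \<in> C_on \<infinity> D" "f \<in> ?P" using f R top by auto
      obtain V where V: "openin (C_topology \<infinity> D) V" "f \<in> V" "\<forall>g\<in>V. C_seminorm n (g - f) < e"
        using openin_C_topology_nhd[OF fm(1) ne(1), of n] by blast
      have "V \<subseteq> C_on \<infinity> D" using openin_subset[OF V(1)] by (simp add: topspace_C_topology)
      with ne V(3) have "V \<inter> ?P \<subseteq> U" by blast
      then show "\<exists>T. openin (C_periodic \<infinity> u D) T \<and> f \<in> T \<and> T \<subseteq> U"
        using V fm by (intro exI[of _ "V \<inter> ?P"]) (auto simp: C_periodic_def openin_subtopology)
    qed
  qed
qed

lemma topspace_C_periodic:
  "topspace (C_periodic \<infinity> u D) = {f \<in> C_on \<infinity> D. \<forall>x. f (x + u) = f x}"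
  by (auto simp: C_periodic_def topspace_C_topology)

end

section \<open>Integral equations in one variable\<close>

lemma continuous_on_compose_pair:
  assumes "continuous_on (A \<times> B) (\<lambda>(x, y). f x y)" "continuous_on S g" "continuous_on S h"
    and "\<And>x. x \<in> S \<Longrightarrow> g x \<in> A" "\<And>x. x \<in> S \<Longrightarrow> h x \<in> B"
  shows "continuous_on S (\<lambda>x. f (g x) (h x))"
  using continuous_on_compose2[OF assms(1) continuous_on_Pair[OF assms(2,3)]] assms(4,5) by auto

lemma continuous_on_compose_triple:
  assumes "continuous_on (A \<times> B \<times> C) (\<lambda>(x, y, z). f x y z)"
    and "continuous_on S g" "continuous_on S h" "continuous_on S k"
    and "\<And>x. x \<in> S \<Longrightarrow> g x \<in> A" "\<And>x. x \<in> S \<Longrightarrow> h x \<in> B" "\<And>x. x \<in> S \<Longrightarrow> k x \<in> C"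
  shows "continuous_on S (\<lambda>x. f (g x) (h x) (k x))"
  using continuous_on_compose2[OF assms(1) continuous_on_Pair[OF assms(2) continuous_on_Pair[OF assms(3,4)]]]
    assms(5-7) by auto

lemma continuous_on_integral_01:
  fixes f :: "'a::topological_space \<Rightarrow> real \<Rightarrow> real"
  assumes "continuous_on (S \<times> {0..1}) (\<lambda>(x, r). f x r)"
  shows "continuous_on S (\<lambda>x. integral {0..1} (f x))"
  using integral_continuous_on_param[of S 0 1 f] assms by simp

text \<open>The substitution \<tau> = \<open>t * r\<close> moves the variable upper limit into the
  integrand, which leaves an integral over a fixed interval depending on a parameter. At
  \<open>t = 0\<close> the substitution degenerates, but both sides vanish.\<close>

lemma continuous_on_integral_upto:
  fixes f :: "'a::topological_space \<Rightarrow> real \<Rightarrow> real"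
  assumes "continuous_on (S \<times> {0..T}) (\<lambda>(s, t). f s t)"
  shows "continuous_on (S \<times> {0..T}) (\<lambda>(s, t). integral {0..t} (f s))"
proof -
  have "continuous_on ((S \<times> {0..T}) \<times> cbox 0 1) (\<lambda>x. (fst (fst x), snd (fst x) * snd x))"
    by (intro continuous_intros)
  moreover have "(\<lambda>x. (fst (fst x), snd (fst x) * snd x)) ` ((S \<times> {0..T}) \<times> cbox 0 1) \<subseteq> S \<times> {0..T}"
    by (auto intro: mult_nonneg_nonneg order_trans[OF mult_left_le])
  ultimately have "continuous_on ((S \<times> {0..T}) \<times> cbox 0 1)
      ((\<lambda>(s, t). f s t) \<circ> (\<lambda>x. (fst (fst x), snd (fst x) * snd x)))"
    by (intro continuous_on_compose continuous_on_subset[OF assms]) auto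
  then have "continuous_on ((S \<times> {0..T}) \<times> cbox 0 1) (\<lambda>(x, r). f (fst x) (snd x * r))"
    by (simp add: o_def case_prod_beta)
  from continuous_on_integral_01[OF this[unfolded cbox_interval]]
  have "continuous_on (S \<times> {0..T}) (\<lambda>x. snd x * integral {0..1} (\<lambda>r. f (fst x) (snd x * r)))"
    by (intro continuous_intros)
  moreover have "snd x * integral {0..1} (\<lambda>r. f (fst x) (snd x * r)) = (case x of (s, t) \<Rightarrow> integral {0..t} (f s))"
    if "x \<in> S \<times> {0..T}" for x
  proof (cases "snd x = 0")
    case False
    then have "snd x > 0" using that by auto
    moreover from this have "(\<lambda>r. r / snd x) ` {0..snd x} = {0..1}"
      by (subst image_divide_atLeastAtMost) auto
    ultimately show ?thesis
      using integral_stretch_real[of "snd x" 0 "snd x" "f (fst x)"]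
      by (simp add: case_prod_beta)
  qed (auto simp: case_prod_beta)
  ultimately show ?thesis by (rule continuous_on_eq)
qed

lemma integral_upto_has_derivative:
  fixes f :: "real \<Rightarrow> real"
  assumes "continuous_on {0..T} f" "t \<in> {0..T}"
  shows "((\<lambda>t. integral {0..t} f) has_real_derivative f t) (at t within {0..T})"
  using assms by (rule integral_has_real_derivative)

lemma integral_eq_of_derivative:
  fixes f :: "real \<Rightarrow> real"
  assumes "a \<le> b" "\<And>x. x \<in> {a..b} \<Longrightarrow> (f has_real_derivative f' x) (at x within {a..b})"
  shows "integral {a..b} f' = f b - f a"
  using fundamental_theorem_of_calculus[OF assms(1), of f f'] assms(2)
  by (simp add: has_real_derivative_iff_has_vector_derivative integral_unique)

text \<open>Variation of constants: multiplied by the integrating factor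
  \<open>exp (- ?B t)\<close>, the solution has a derivative in which the term with \<open>d\<close>
  cancels.\<close>

lemma linear_integral_equation:
  fixes \<alpha> \<beta> d :: "real \<Rightarrow> real"
  assumes "continuous_on {0..T} \<alpha>" "continuous_on {0..T} \<beta>" "continuous_on {0..T} d"
    and eq: "\<And>t. t \<in> {0..T} \<Longrightarrow> d t = c + integral {0..t} (\<lambda>\<tau>. \<alpha> \<tau> + \<beta> \<tau> * d \<tau>)"
    and t: "t \<in> {0..T}"
  shows "d t = exp (integral {0..t} \<beta>) *
    (c + integral {0..t} (\<lambda>\<tau>. exp (- integral {0..\<tau>} \<beta>) * \<alpha> \<tau>))"
proof -
  let ?B = "\<lambda>t. integral {0..t} \<beta>"
  let ?m = "\<lambda>t. exp (- ?B t) * d t"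
  have "(d has_real_derivative \<alpha> s + \<beta> s * d s) (at s within {0..T})" if s: "s \<in> {0..T}" for s
  proof -
    have "((\<lambda>t. c + integral {0..t} (\<lambda>\<tau>. \<alpha> \<tau> + \<beta> \<tau> * d \<tau>)) has_real_derivative
        0 + (\<alpha> s + \<beta> s * d s)) (at s within {0..T})"
      using assms s by (intro derivative_intros integral_upto_has_derivative continuous_intros)
    then show ?thesis
      by (rule has_field_derivative_transform_within[OF _ zero_less_one s, THEN DERIV_cong])
        (use eq in auto)
  qed
  then have "(?m has_real_derivative exp (- ?B s) * \<alpha> s) (at s within {0..T})" if "s \<in> {0..T}" for s
    using that assms
    by (auto intro!: derivative_eq_intros integral_upto_has_derivative simp: algebra_simps)
  then have "integral {0..t} (\<lambda>\<tau>. exp (- ?B \<tau>) * \<alpha> \<tau>) = ?m t - ?m 0"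
    using t by (intro integral_eq_of_derivative[of 0 t ?m]) (auto intro: DERIV_subset[of _ _ _ "{0..T}"])
  moreover have "d 0 = c" using eq[of 0] t by simp
  ultimately show ?thesis by (simp add: exp_minus field_simps)
qed

text \<open>The averaged derivative, unlike the derivative at an intermediate point, depends
  continuously on \<open>v\<close> and \<open>w\<close>, also where they coincide. This makes the
  coefficients \<beta> below continuous.\<close>

lemma integral_mean_value:
  fixes f f' :: "real \<Rightarrow> real"
  assumes "\<And>x. (f has_real_derivative f' x) (at x)" "continuous_on UNIV f'"
  shows "f w - f v = integral {0..1} (\<lambda>r. f' (v + r * (w - v))) * (w - v)"
proof -
  have "integral {0..1} (\<lambda>r. f' (v + r * (w - v)) * (w - v)) = f (v + 1 * (w - v)) - f (v + 0 * (w - v))"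
    by (intro integral_eq_of_derivative) (auto intro!: derivative_eq_intros DERIV_chain2[OF assms(1)])
  then show ?thesis by simp
qed

text \<open>The hypothesis says exactly that \<open>exp (- L * t)\<close> times its right-hand side
  has a nonpositive derivative.\<close>

lemma gronwall:
  fixes u :: "real \<Rightarrow> real"
  assumes "continuous_on {0..T} u" "L \<ge> 0"
    and le: "\<And>t. t \<in> {0..T} \<Longrightarrow> u t \<le> a + L * integral {0..t} u"
    and t: "t \<in> {0..T}"
  shows "u t \<le> a * exp (L * t)"
proof -
  let ?k = "\<lambda>t. exp (- L * t) * (a + L * integral {0..t} u)"
  let ?k' = "\<lambda>s. exp (- L * s) * (L * (u s - (a + L * integral {0..s} u)))"
  have d: "(?k has_real_derivative ?k' s) (at s within {0..T})" if "s \<in> {0..T}" for s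
    using that assms(1)
    by (auto intro!: derivative_eq_intros integral_upto_has_derivative simp: algebra_simps)
  have "?k t \<le> ?k 0"
  proof (cases "t = 0")
    case False
    have "(?k has_derivative (\<lambda>h. ?k' s * h)) (at s within {0..t})" if "0 \<le> s" "s \<le> t" for s
      using DERIV_subset[OF d, of s "{0..t}"] that t by (simp add: has_field_derivative_def)
    then obtain s where s: "s \<in> {0<..<t}" "?k t - ?k 0 = ?k' s * (t - 0)"
      using mvt_simple[of 0 t ?k "\<lambda>s h. ?k' s * h"] t False by auto
    have "?k' s \<le> 0"
      using le[of s] assms(2) s t by (intro mult_nonneg_nonpos) auto
    with s t show ?thesis by (smt (verit) atLeastAtMost_iff mult_nonpos_nonneg)
  qed simp
  then show ?thesis using le[OF t] by (simp add: exp_minus field_simps)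
qed

text \<open>By the integral mean value formula, the difference of the two solutions solves a linear
  equation exactly, with the averaged derivative \<beta> as coefficient. The perturbation \<alpha>
  is zero for uniqueness and the change of the right-hand side for differentiation in a
  parameter.\<close>

lemma integral_equation_difference:
  fixes g \<gamma> :: "real \<Rightarrow> real \<Rightarrow> real"
  assumes g: "\<And>t v. t \<in> {0..T} \<Longrightarrow> (g t has_real_derivative \<gamma> t v) (at v)"
    and cont: "continuous_on ({0..T} \<times> UNIV) (\<lambda>(t, v). \<gamma> t v)" "continuous_on ({0..T} \<times> UNIV) (\<lambda>(t, v). g t v)"
      "continuous_on {0..T} \<alpha>"
    and z: "continuous_on {0..T} z" "\<And>t. t \<in> {0..T} \<Longrightarrow> z t = a + integral {0..t} (\<lambda>\<tau>. g \<tau> (z \<tau>))"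
    and w: "continuous_on {0..T} w"
      "\<And>t. t \<in> {0..T} \<Longrightarrow> w t = b + integral {0..t} (\<lambda>\<tau>. g \<tau> (w \<tau>) + \<alpha> \<tau>)"
    and t: "t \<in> {0..T}"
  defines "\<beta> \<equiv> \<lambda>\<tau>. integral {0..1} (\<lambda>r. \<gamma> \<tau> (z \<tau> + r * (w \<tau> - z \<tau>)))"
  shows "w t - z t = exp (integral {0..t} \<beta>) *
    (b - a + integral {0..t} (\<lambda>\<tau>. exp (- integral {0..\<tau>} \<beta>) * \<alpha> \<tau>))"
proof (rule linear_integral_equation[OF cont(3) _ _ _ t])
  show "continuous_on {0..T} \<beta>"
    unfolding \<beta>_def
    by (rule continuous_on_integral_01, unfold case_prod_beta,
      intro continuous_on_compose_pair[OF cont(1)] continuous_intros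
        continuous_on_compose2[OF z(1)] continuous_on_compose2[OF w(1)]) auto
  fix s assume s: "s \<in> {0..T}"
  then have sub: "{0..s} \<subseteq> {0..T}" by auto
  have gc: "continuous_on {0..s} (\<lambda>\<tau>. g \<tau> (v \<tau>))" if "continuous_on {0..T} v" for v
    by (rule continuous_on_compose_pair[OF cont(2)]) (use sub that in \<open>auto intro: continuous_on_subset\<close>)
  have "w s - z s = (b - a) + integral {0..s} (\<lambda>\<tau>. (g \<tau> (w \<tau>) + \<alpha> \<tau>) - g \<tau> (z \<tau>))"
    using z(2)[OF s] w(2)[OF s]
    by (subst integral_diff) (auto intro!: integrable_continuous_real continuous_on_add gc z w
        continuous_on_subset[OF cont(3) sub])
  also have "integral {0..s} (\<lambda>\<tau>. (g \<tau> (w \<tau>) + \<alpha> \<tau>) - g \<tau> (z \<tau>)) =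
      integral {0..s} (\<lambda>\<tau>. \<alpha> \<tau> + \<beta> \<tau> * (w \<tau> - z \<tau>))"
  proof (rule integral_cong)
    fix \<tau> assume "\<tau> \<in> {0..s}"
    then have \<tau>: "\<tau> \<in> {0..T}" using sub by blast
    have "continuous_on UNIV (\<gamma> \<tau>)"
      by (rule continuous_on_compose_pair[OF cont(1)]) (use \<tau> in auto)
    from integral_mean_value[OF g[OF \<tau>] this, of "w \<tau>" "z \<tau>"]
    show "(g \<tau> (w \<tau>) + \<alpha> \<tau>) - g \<tau> (z \<tau>) = \<alpha> \<tau> + \<beta> \<tau> * (w \<tau> - z \<tau>)" by (simp add: \<beta>_def)
  qed
  finally show "w s - z s = b - a + integral {0..s} (\<lambda>\<tau>. \<alpha> \<tau> + \<beta> \<tau> * (w \<tau> - z \<tau>))" .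
qed (use z w in \<open>auto intro!: continuous_intros\<close>)

text \<open>Banach's theorem is applied to bounded continuous functions of time and \<xi> together,
  which gives joint continuity at once. The unknown is \<open>exp (- 2 * L * t)\<close> times the
  solution; this weight makes the contraction factor 1/2 for every length of the time
  interval.\<close>

lemma integral_equation_exists:
  fixes h :: "real \<Rightarrow> real \<Rightarrow> real \<Rightarrow> real"
  assumes T: "T \<ge> 0"
    and h: "continuous_on ({0..T} \<times> UNIV \<times> UNIV) (\<lambda>(t, \<xi>, v). h t \<xi> v)"
    and bound: "\<And>t \<xi> v. t \<in> {0..T} \<Longrightarrow> \<bar>h t \<xi> v\<bar> \<le> B"
    and lipschitz: "\<And>t \<xi> v w. t \<in> {0..T} \<Longrightarrow> \<bar>h t \<xi> v - h t \<xi> w\<bar> \<le> L * \<bar>v - w\<bar>" "L > 0"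
    and a: "continuous_on UNIV a" "\<And>\<xi>. \<bar>a \<xi>\<bar> \<le> A"
  obtains z where "continuous_on ({0..T} \<times> UNIV) (\<lambda>(t, \<xi>). z t \<xi>)"
    "\<And>t \<xi>. t \<in> {0..T} \<Longrightarrow> z t \<xi> = a \<xi> + integral {0..t} (\<lambda>\<tau>. h \<tau> \<xi> (z \<tau> \<xi>))"
proof -
  \<comment> \<open>Time is clamped to the interval because the fixed point lives in a space of
    functions on the whole plane.\<close>
  define c where "c t = max 0 (min T t)" for t
  have c: "c t \<in> {0..T}" "t \<in> {0..T} \<Longrightarrow> c t = t" for t using T by (auto simp: c_def)
  define k where "k u \<xi> \<tau> = h \<tau> \<xi> (exp (2 * L * \<tau>) * apply_bcontfun u (\<tau>, \<xi>))" for u \<xi> \<tau>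
  define G where "G u t \<xi> = a \<xi> + integral {0..t} (k u \<xi>)" for u t \<xi>
  define P where "P u = (\<lambda>(t, \<xi>). exp (- 2 * L * c t) * G u (c t) \<xi>)" for u
  have uc: "continuous_on X (apply_bcontfun (u :: (real \<times> real) \<Rightarrow>\<^sub>C real))" for u X
    by (rule continuous_on_subset[OF continuous_on_apply_bcontfun]) auto
  have hc: "continuous_on (UNIV \<times> {0..T}) (\<lambda>(\<xi>, \<tau>). k u \<xi> \<tau>)" for u
  proof -
    have "continuous_on (UNIV \<times> {0..T}) (\<lambda>x :: real \<times> real. apply_bcontfun u (snd x, fst x))"
      by (rule continuous_on_compose2[OF uc[of UNIV]]) (auto intro!: continuous_intros)
    then show ?thesis
      unfolding k_def case_prod_beta
      by (intro continuous_on_compose_triple[OF h] continuous_on_mult continuous_intros) auto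
  qed
  have hi: "(k u \<xi>) integrable_on {0..t}"
    if "t \<in> {0..T}" for u t \<xi>
    using that by (intro integrable_continuous_real)
      (rule continuous_on_compose_pair[OF hc[of u], of _ "\<lambda>\<tau>. \<xi>" "\<lambda>\<tau>. \<tau>"], auto)
  have Gc: "continuous_on ({0..T} \<times> UNIV) (\<lambda>(t, \<xi>). G u t \<xi>)" for u
    unfolding G_def case_prod_beta
    by (intro continuous_on_add continuous_on_compose2[OF a(1)]
       continuous_on_compose_pair[OF continuous_on_integral_upto[OF hc[of u]]] continuous_intros) auto
  have Pb: "P u \<in> bcontfun" for u
  proof (rule bcontfun_normI)
    show "continuous_on UNIV (P u)"
      unfolding P_def case_prod_beta
      using c(1) by (intro continuous_on_mult continuous_on_compose_pair[OF Gc[of u]])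
        (auto simp: c_def intro!: continuous_intros)
    fix x :: "real \<times> real"
    obtain t \<xi> where x: "x = (t, \<xi>)" by fastforce
    have "norm (integral {0..c t} (k u \<xi>))
        \<le> integral {0..c t} (\<lambda>\<tau>. B)"
      using c(1)[of t] bound
      by (intro integral_norm_bound_integral hi) (auto simp: k_def simp del: integral_const_real)
    then have "\<bar>integral {0..c t} (k u \<xi>)\<bar> \<le> B * c t"
      using c(1)[of t] by (simp add: mult.commute)
    also have "\<dots> \<le> \<bar>B\<bar> * T" using c(1)[of t] by (intro mult_mono) auto
    finally have "\<bar>G u (c t) \<xi>\<bar> \<le> A + \<bar>B\<bar> * T" using a(2)[of \<xi>] by (simp add: G_def)
    moreover have "exp (- 2 * L * c t) \<le> 1" using c(1)[of t] lipschitz(2) by simp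
    ultimately show "norm (P u x) \<le> 1 * (A + \<bar>B\<bar> * T)"
      unfolding x P_def by (simp only: prod.case real_norm_def abs_mult abs_exp_cancel) (intro mult_mono, auto)
  qed
  define F where "F u = Bcontfun (P u)" for u
  have F: "apply_bcontfun (F u) = P u" for u using Pb by (simp add: F_def Bcontfun_inverse)
  have "dist (F u) (F v) \<le> 1/2 * dist u v" for u v
  proof (rule dist_bound)
    fix x :: "real \<times> real"
    obtain t \<xi> where x: "x = (t, \<xi>)" by fastforce
    let ?I = "\<lambda>u. integral {0..c t} (k u \<xi>)"
    \<comment> \<open>The weight is chosen for this integral:
      \<open>L * exp (2 * L * \<tau>)\<close> integrates to less than half of
      \<open>exp (2 * L * t)\<close>, which is the origin of the factor 1/2.\<close>
    have e: "((\<lambda>\<tau>. (L * dist u v) * exp (2 * L * \<tau>)) has_integral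
        (dist u v / 2 * exp (2 * L * c t) - dist u v / 2 * exp (2 * L * 0))) {0..c t}"
      using c(1)[of t] lipschitz(2)
      by (intro fundamental_theorem_of_calculus)
        (auto simp: has_real_derivative_iff_has_vector_derivative[symmetric] intro!: derivative_eq_intros)
    have "\<bar>?I u - ?I v\<bar> \<le> integral {0..c t} (\<lambda>\<tau>. (L * dist u v) * exp (2 * L * \<tau>))"
      unfolding integral_diff[OF hi[OF c(1)] hi[OF c(1)], symmetric] real_norm_def[symmetric]
    proof (rule integral_norm_bound_integral)
      fix \<tau> assume \<tau>: "\<tau> \<in> {0..c t}"
      have "\<bar>k u \<xi> \<tau> - k v \<xi> \<tau>\<bar>
        \<le> L * \<bar>exp (2 * L * \<tau>) * apply_bcontfun u (\<tau>, \<xi>) - exp (2 * L * \<tau>) * apply_bcontfun v (\<tau>, \<xi>)\<bar>"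
        using \<tau> c(1)[of t] unfolding k_def by (intro lipschitz(1)) auto
      also have "\<dots> = L * (exp (2 * L * \<tau>) * dist (apply_bcontfun u (\<tau>, \<xi>)) (apply_bcontfun v (\<tau>, \<xi>)))"
        by (simp add: dist_real_def abs_mult right_diff_distrib[symmetric])
      also have "\<dots> \<le> L * (exp (2 * L * \<tau>) * dist u v)"
        using lipschitz(2) by (intro mult_left_mono dist_bounded) auto
      finally show "norm (k u \<xi> \<tau> - k v \<xi> \<tau>)
        \<le> L * dist u v * exp (2 * L * \<tau>)" by (simp add: mult_ac)
    qed (use e in \<open>auto intro!: integrable_diff hi c\<close>)
    also have "\<dots> = dist u v / 2 * exp (2 * L * c t) - dist u v / 2"
      using integral_unique[OF e] by simp
    also have "\<dots> \<le> dist u v / 2 * exp (2 * L * c t)" by simp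
    finally have "exp (- 2 * L * c t) * \<bar>?I u - ?I v\<bar> \<le> exp (- 2 * L * c t) * (dist u v / 2 * exp (2 * L * c t))"
      by (rule mult_left_mono) simp
    also have "\<dots> = 1/2 * dist u v" by (simp add: exp_minus)
    finally show "dist (apply_bcontfun (F u) x) (apply_bcontfun (F v) x) \<le> 1/2 * dist u v"
      by (simp add: F P_def x G_def dist_real_def abs_mult right_diff_distrib[symmetric])
  qed
  then obtain u where u: "F u = u"
    using banach_fix_type[of "1/2" F] by auto
  define z where "z t \<xi> = exp (2 * L * t) * apply_bcontfun u (t, \<xi>)" for t \<xi>
  show ?thesis
  proof
    show "continuous_on ({0..T} \<times> UNIV) (\<lambda>(t, \<xi>). z t \<xi>)"
      unfolding z_def case_prod_beta by (intro continuous_intros) (simp add: uc)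
    fix t \<xi> assume "t \<in> {0..T}"
    then have "apply_bcontfun u (t, \<xi>) = exp (- 2 * L * t) * G u t \<xi>"
      using arg_cong[OF u, of "\<lambda>u. apply_bcontfun u (t, \<xi>)"] c(2)[of t] by (simp add: F P_def)
    then show "z t \<xi> = a \<xi> + integral {0..t} (\<lambda>\<tau>. h \<tau> \<xi> (z \<tau> \<xi>))"
      by (simp add: z_def G_def k_def[abs_def] exp_minus)
  qed
qed

text \<open>For interior times the increment of \<open>P t\<close> is the integral of
  \<open>Q t\<close>. Both sides are continuous in time, so the identity persists at
  \<open>0\<close> and \<open>T\<close>, where it gives back the derivative. Membership in
  \<open>C_on\<close> asserts derivatives in the interior only.\<close>

lemma derivative_up_to_boundary:
  fixes P Q :: "real \<Rightarrow> real \<Rightarrow> real"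
  assumes "T > 0" "continuous_on ({0..T} \<times> UNIV) (\<lambda>(t, r). P t r)"
    and Q: "continuous_on ({0..T} \<times> UNIV) (\<lambda>(t, r). Q t r)"
    and deriv: "\<And>t r. t \<in> {0<..<T} \<Longrightarrow> (P t has_real_derivative Q t r) (at r)"
    and t: "t \<in> {0..T}"
  shows "(P t has_real_derivative Q t r) (at r)"
proof -
  have Pc: "continuous_on {0..T} (\<lambda>t. P t r)" for r
    by (rule continuous_on_compose_pair[OF assms(2)]) auto
  have Qc: "continuous_on {a..b} (Q t)" for a b
    by (rule continuous_on_compose_pair[OF Q]) (use t in auto)
  have eq: "P t b - P t a - integral {a..b} (Q t) = 0" if "a \<le> b" for a b
  proof (rule continuous_constant_on_closure[of "{0<..<T}" "\<lambda>t. P t b - P t a - integral {a..b} (Q t)"])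
    have "continuous_on ({0..T} \<times> cbox a b) (\<lambda>(t, r). Q t r)"
      by (rule continuous_on_subset[OF Q]) auto
    from integral_continuous_on_param[OF this]
    show "continuous_on (closure {0<..<T}) (\<lambda>t. P t b - P t a - integral {a..b} (Q t))"
      using assms(1) by (auto intro!: continuous_intros Pc)
    show "P s b - P s a - integral {a..b} (Q s) = 0" if "s \<in> {0<..<T}" for s
      using integral_eq_of_derivative[OF \<open>a \<le> b\<close>, of "P s" "Q s"] deriv[OF that]
      by (simp add: has_field_derivative_at_within)
  qed (use t assms(1) in auto)
  have "((\<lambda>x. P t (r - 1) + integral {r - 1..x} (Q t)) has_real_derivative 0 + Q t r) (at r within {r - 1..r + 1})"
    by (intro derivative_intros integral_has_real_derivative Qc) auto
  then have "((\<lambda>x. P t (r - 1) + integral {r - 1..x} (Q t)) has_real_derivative Q t r) (at r)"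
    by (simp add: at_within_Icc_at)
  then show ?thesis
  proof (rule has_field_derivative_transform_within_open[of _ _ _ "{r - 1<..<r + 1}"])
    show "P t (r - 1) + integral {r - 1..x} (Q t) = P t x" if "x \<in> {r - 1<..<r + 1}" for x
      using eq[of "r - 1" x] that by simp
  qed auto
qed

text \<open>Writing the change of the right-hand side as \<open>s\<close> times a continuous
  \<alpha> puts an explicit factor \<open>s\<close> into the exact formula for
  \<open>z s t - z 0 t\<close>. Division by \<open>s\<close> and continuity then give the
  derivative; of the solutions themselves only joint continuity is used.\<close>

lemma ode_parameter_derivative:
  fixes z \<gamma> :: "real \<Rightarrow> real \<Rightarrow> real" and g \<alpha> :: "real \<Rightarrow> real \<Rightarrow> real \<Rightarrow> real"
  assumes J: "open J" "0 \<in> J"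
    and z: "continuous_on (J \<times> {0..T}) (\<lambda>(s, t). z s t)"
      "\<And>s t. s \<in> J \<Longrightarrow> t \<in> {0..T} \<Longrightarrow> z s t = a s + integral {0..t} (\<lambda>\<tau>. g s \<tau> (z s \<tau>))"
    and g: "continuous_on ({0..T} \<times> UNIV) (\<lambda>(t, v). g 0 t v)"
      "\<And>t v. t \<in> {0..T} \<Longrightarrow> (g 0 t has_real_derivative \<gamma> t v) (at v)"
      "continuous_on ({0..T} \<times> UNIV) (\<lambda>(t, v). \<gamma> t v)"
    and \<alpha>: "continuous_on (J \<times> {0..T} \<times> UNIV) (\<lambda>(s, t, v). \<alpha> s t v)"
      "\<And>s t v. s \<in> J \<Longrightarrow> t \<in> {0..T} \<Longrightarrow> g s t v - g 0 t v = s * \<alpha> s t v"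
    and a: "(a has_real_derivative a1) (at 0)"
    and t: "t \<in> {0..T}"
  shows "((\<lambda>s. z s t) has_real_derivative
    exp (integral {0..t} (\<lambda>\<tau>. \<gamma> \<tau> (z 0 \<tau>))) *
      (a1 + integral {0..t} (\<lambda>\<tau>. exp (- integral {0..\<tau>} (\<lambda>\<sigma>. \<gamma> \<sigma> (z 0 \<sigma>))) * \<alpha> 0 \<tau> (z 0 \<tau>)))) (at 0)"
proof -
  have zc: "continuous_on {0..T} (z s)" if "s \<in> J" for s
    by (rule continuous_on_compose_pair[OF z(1)]) (use that in auto)
  define \<beta> where "\<beta> s \<tau> = integral {0..1} (\<lambda>r. \<gamma> \<tau> (z 0 \<tau> + r * (z s \<tau> - z 0 \<tau>)))" for s \<tau>
  define B where "B s t = integral {0..t} (\<beta> s)" for s t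
  define R where "R s t = integral {0..t} (\<lambda>\<tau>. exp (- B s \<tau>) * \<alpha> s \<tau> (z s \<tau>))" for s t
  have bc: "continuous_on (J \<times> {0..T}) (\<lambda>(s, t). \<beta> s t)"
    unfolding \<beta>_def case_prod_beta
    by (rule continuous_on_integral_01, unfold case_prod_beta,
      intro continuous_on_compose_pair[OF g(3)] continuous_on_add continuous_on_mult continuous_on_diff
        continuous_on_compose2[OF zc[OF J(2)]] continuous_on_compose_pair[OF z(1)] continuous_intros) auto
  have Bc: "continuous_on (J \<times> {0..T}) (\<lambda>(s, t). B s t)"
    unfolding B_def by (rule continuous_on_integral_upto[OF bc])
  have ac: "continuous_on (J \<times> {0..T}) (\<lambda>(s, t). \<alpha> s t (z s t))"
    unfolding case_prod_beta
    by (intro continuous_on_compose_triple[OF \<alpha>(1)] continuous_on_compose_pair[OF z(1)] continuous_intros) auto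
  have Rc: "continuous_on (J \<times> {0..T}) (\<lambda>(s, t). R s t)"
    unfolding R_def using Bc ac
    by (intro continuous_on_integral_upto) (auto simp: case_prod_beta intro!: continuous_intros)
  have slice: "continuous_on {0..T} (f s)" if "continuous_on (J \<times> {0..T}) (\<lambda>(s, t). f s t)" "s \<in> J"
    for f :: "real \<Rightarrow> real \<Rightarrow> real" and s
    by (rule continuous_on_compose_pair[OF that(1)]) (use that in auto)
  have slice': "(\<lambda>s. f s t) \<midarrow>0\<rightarrow> f 0 t" if "continuous_on (J \<times> {0..T}) (\<lambda>(s, t). f s t)"
    for f :: "real \<Rightarrow> real \<Rightarrow> real"
  proof -
    have "continuous_on J (\<lambda>s. f s t)"
      by (rule continuous_on_compose_pair[OF that]) (use t in auto)
    then show ?thesis using J by (simp add: continuous_on_eq_continuous_at isCont_def)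
  qed
  \<comment> \<open>\<open>z s\<close> solves the equation for \<open>g 0\<close> with the
    perturbation \<open>s * \<alpha>\<close>, so the comparison is exact for every \<open>s\<close>
    and not merely to first order.\<close>
  have eq: "z s t - z 0 t = exp (B s t) * ((a s - a 0) + s * R s t)" if s: "s \<in> J" for s
  proof -
    have "z s t - z 0 t = exp (integral {0..t} (\<beta> s)) * (a s - a 0 +
        integral {0..t} (\<lambda>\<tau>. exp (- integral {0..\<tau>} (\<beta> s)) * (s * \<alpha> s \<tau> (z s \<tau>))))"
      unfolding \<beta>_def
    proof (rule integral_equation_difference[OF g(2,3,1) _ zc[OF J(2)] z(2)[OF J(2)] zc[OF s] _ t])
      show "continuous_on {0..T} (\<lambda>\<tau>. s * \<alpha> s \<tau> (z s \<tau>))"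
        by (intro continuous_on_mult continuous_on_const slice[OF ac s])
      fix t assume t: "t \<in> {0..T}"
      have "g 0 \<tau> (z s \<tau>) + s * \<alpha> s \<tau> (z s \<tau>) = g s \<tau> (z s \<tau>)" if "\<tau> \<in> {0..t}" for \<tau>
        using \<alpha>(2)[OF s, of \<tau> "z s \<tau>"] that t by simp
      then show "z s t = a s + integral {0..t} (\<lambda>\<tau>. g 0 \<tau> (z s \<tau>) + s * \<alpha> s \<tau> (z s \<tau>))"
        using integral_cong[of "{0..t}" "\<lambda>\<tau>. g 0 \<tau> (z s \<tau>) + s * \<alpha> s \<tau> (z s \<tau>)" "\<lambda>\<tau>. g s \<tau> (z s \<tau>)"] z(2)[OF s t] by simp
    qed
    also have "(\<lambda>\<tau>. exp (- integral {0..\<tau>} (\<beta> s)) * (s * \<alpha> s \<tau> (z s \<tau>))) =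
        (\<lambda>\<tau>. s * (exp (- B s \<tau>) * \<alpha> s \<tau> (z s \<tau>)))"
      by (simp add: B_def mult.left_commute)
    also have "integral {0..t} \<dots> = s * R s t"
      unfolding R_def by (rule integral_mult_right)
    finally show ?thesis by (simp add: B_def)
  qed
  have "(\<lambda>s. exp (B s t) * ((a s - a 0) / (s - 0) + R s t)) \<midarrow>0\<rightarrow> exp (B 0 t) * (a1 + R 0 t)"
    using a by (intro tendsto_intros slice' Bc Rc) (simp add: has_field_derivative_iff)
  moreover have "\<forall>\<^sub>F s in at 0. exp (B s t) * ((a s - a 0) / (s - 0) + R s t) = (z s t - z 0 t) / (s - 0)"
    by (rule eventually_mono[OF eventually_at_in_open[OF J]]) (use eq in \<open>auto simp: field_simps\<close>)
  ultimately have "((\<lambda>s. z s t) has_real_derivative exp (B 0 t) * (a1 + R 0 t)) (at 0)"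
    unfolding has_field_derivative_iff by (rule Lim_transform_eventually)
  moreover have "\<beta> 0 = (\<lambda>\<tau>. \<gamma> \<tau> (z 0 \<tau>))" by (rule ext) (simp add: \<beta>_def)
  ultimately show ?thesis by (simp add: B_def R_def)
qed

text \<open>Total differentiability needs only one of the two partial derivatives to be continuous;
  the other is used at the point alone.\<close>

lemma has_derivative_two_variables:
  fixes f :: "'a::real_normed_vector \<Rightarrow> real \<Rightarrow> real"
  assumes "open X" "x \<in> X" "((\<lambda>x. f x v) has_derivative fx) (at x)"
    and d: "\<And>y w. y \<in> X \<Longrightarrow> (f y has_real_derivative fv y w) (at w)"
    and c: "continuous_on (X \<times> UNIV) (\<lambda>(x, v). fv x v)"
  shows "((\<lambda>p. f (fst p) (snd p)) has_derivative (\<lambda>h. fx (fst h) + fv x v * snd h)) (at (x, v))"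
proof -
  have "((\<lambda>(x, v). f x v) has_derivative (\<lambda>(tx, tv). fx tx + blinfun_apply (blinfun_scaleR_left (fv x v)) tv)) (at (x, v) within X \<times> UNIV)"
  proof (rule has_derivative_partialsI)
    show "((\<lambda>x. f x v) has_derivative fx) (at x within X)"
      using assms(3) has_derivative_at_withinI by blast
    have o: "open (X \<times> (UNIV :: real set))" using assms(1) by (intro open_Times) auto
    then have "continuous (at (x, v) within X \<times> UNIV) (\<lambda>p. fv (fst p) (snd p))"
      using c assms(2) by (simp add: continuous_on_eq_continuous_within case_prod_beta)
    then show "continuous (at (x, v) within X \<times> UNIV) (\<lambda>(x, v). blinfun_scaleR_left (fv x v))"
      unfolding case_prod_beta
      by (rule bounded_linear.continuous[OF bounded_linear_blinfun_scaleR_left])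
  qed (use d in \<open>auto simp: has_field_derivative_def mult.commute[of _ "fv _ _"] intro: has_derivative_at_withinI\<close>)
  moreover have "at (x, v) within X \<times> UNIV = at (x, v)"
    using assms(1,2) by (intro at_within_open open_Times) auto
  ultimately show ?thesis unfolding case_prod_beta by (simp add: mult.commute)
qed

text \<open>Dependence on data is controlled by uniform convergence; this turns it into the joint
  continuity in parameter and time that the differentiation lemmas require.\<close>

lemma continuous_on_of_uniform_limits:
  fixes f :: "'a::metric_space \<Rightarrow> 'b::topological_space \<Rightarrow> real"
  assumes "\<And>s. s \<in> J \<Longrightarrow> uniform_limit X f (f s) (at s within J)"
    and "\<And>s. s \<in> J \<Longrightarrow> continuous_on X (f s)"
  shows "continuous_on (J \<times> X) (\<lambda>(s, t). f s t)"
proof -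
  have "((\<lambda>p. f (fst p) (snd p)) \<longlongrightarrow> f s t) (at (s, t) within J \<times> X)" if st: "s \<in> J" "t \<in> X" for s t
  proof (rule tendstoI)
    fix e :: real assume e: "e > 0"
    have "\<forall>\<^sub>F s' in at s within J. \<forall>t'\<in>X. dist (f s' t') (f s t') < e / 2"
      using uniform_limitD[OF assms(1)[OF st(1)], of "e / 2"] e by simp
    then obtain d where d: "d > 0" "\<And>s'. s' \<in> J \<Longrightarrow> s' \<noteq> s \<Longrightarrow> dist s' s < d \<Longrightarrow> \<forall>t'\<in>X. dist (f s' t') (f s t') < e / 2"
      unfolding eventually_at by metis
    have 1: "\<forall>\<^sub>F p in at (s, t) within J \<times> X. dist (fst p) s < d"
      by (rule tendstoD[OF _ d(1)]) (auto intro!: tendsto_eq_intros)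
    have "continuous_on (J \<times> X) (\<lambda>p. f s (snd p))"
      by (rule continuous_on_compose2[OF assms(2)[OF st(1)]]) (auto intro!: continuous_intros)
    then have "((\<lambda>p. f s (snd p)) \<longlongrightarrow> f s t) (at (s, t) within J \<times> X)"
      using st by (auto simp: continuous_on_def)
    then have 2: "\<forall>\<^sub>F p in at (s, t) within J \<times> X. dist (f s (snd p)) (f s t) < e / 2"
      using e by (intro tendstoD) auto
    have 3: "\<forall>\<^sub>F p in at (s, t) within J \<times> X. p \<in> J \<times> X"
      by (simp add: eventually_at_filter)
    show "\<forall>\<^sub>F p in at (s, t) within J \<times> X. dist (f (fst p) (snd p)) (f s t) < e"
      using 1 2 3
    proof eventually_elim
      case (elim p)
      then have "dist (f (fst p) (snd p)) (f s (snd p)) < e / 2"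
        using d(2)[of "fst p"] e by (cases "fst p = s") auto
      with elim(2) show ?case
        using dist_triangle[of "f (fst p) (snd p)" "f s t" "f s (snd p)"] by linarith
    qed
  qed
  then show ?thesis by (auto simp: continuous_on_def case_prod_beta)
qed

section \<open>The data of the transport equation\<close>

text \<open>Reduction to one period is what lets seminorms over bounded sets control suprema over
  the whole line.\<close>

lemma periodic_frac:
  fixes f :: "real \<Rightarrow> 'a"
  assumes "\<And>x. f (x + 1) = f x"
  shows "f (frac x) = f x"
proof -
  have n: "f (y + real n) = f y" for y and n :: nat
  proof (induction n)
    case (Suc n)
    then show ?case using assms[of "y + real n"] by (simp add: algebra_simps)
  qed simp
  have "f (y + of_int k) = f y" for y and k :: int
    using n[of y "nat k"] n[of "y + of_int k" "nat (- k)"] by (cases "k \<ge> 0") auto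
  from this[of "frac x" "\<lfloor>x\<rfloor>"] show ?thesis by (simp add: frac_def)
qed

lemma partial_translate:
  assumes "\<And>x. f (x + u) = f x"
  shows "partial bs f (x + u) = partial bs f x"
proof (induction bs arbitrary: x)
  case (Cons b bs)
  have "partial bs f (x + u + t *\<^sub>R b) = partial bs f (x + t *\<^sub>R b)" for t
    using Cons[of "x + t *\<^sub>R b"] by (simp add: algebra_simps)
  then show ?case by simp
qed (use assms in simp)

lemma (in regular_domain) ext_partial_translate:
  assumes "f \<in> C_on \<infinity> D" "\<And>x. f (x + u) = f x" "\<And>x. x + u \<in> D \<longleftrightarrow> x \<in> D" "set bs \<subseteq> Basis" "x \<in> D"
  shows "ext_partial D bs f (x + u) = ext_partial D bs f x"
proof -
  have "(+) u ` D = D"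
    using assms(3) by (force simp: image_iff add.commute intro: bexI[of _ "_ - u"])
  then have i: "(+) u ` interior D = interior D"
    by (metis interior_translation)
  show ?thesis
  proof (rule ext_partial_eqI[symmetric, OF _ _ assms(5)])
    show "continuous_on D (\<lambda>x. ext_partial D bs f (x + u))"
      by (rule continuous_on_compose2[OF continuous_on_ext_partial[OF assms(1,4)]])
        (use assms(3) in \<open>auto intro!: continuous_intros\<close>)
    fix x assume "x \<in> interior D"
    then have "x + u \<in> interior D" using i by (metis add.commute image_eqI)
    then show "partial bs f x = ext_partial D bs f (x + u)"
      using assms by (simp add: ext_partial_interior partial_translate)
  qed
qed

interpretation line: regular_domain "UNIV :: real set"
  by standard auto

text \<open>Keeps \<open>{0..T} \<times> UNIV \<times> UNIV\<close> in the form in which it occurs in the definitions.\<close>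

declare UNIV_Times_UNIV [simp del]

text \<open>Naming the basis vectors by a type makes every list of them admissible, so no side
  condition accompanies the derivatives of \<phi>.\<close>

datatype axis = Time | Space | Value

primrec axis_vec :: "axis \<Rightarrow> real \<times> real \<times> real" where
  "axis_vec Time = (1, 0, 0)"
| "axis_vec Space = (0, 1, 0)"
| "axis_vec Value = (0, 0, 1)"

lemma axis_vec_Basis: "set (map axis_vec ks) \<subseteq> Basis"
proof -
  have "axis_vec k \<in> Basis" for k by (cases k) (auto simp: Basis_prod_def zero_prod_def)
  then show ?thesis by auto
qed

type_synonym datum = "(real \<Rightarrow> real) \<times> (real \<times> real \<times> real \<Rightarrow> real)"

definition init :: "datum \<Rightarrow> nat \<Rightarrow> real \<Rightarrow> real" where
  "init x m = ext_partial UNIV (replicate m 1) (fst x)"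

lemma replicate_Basis: "set (replicate m (1 :: real)) \<subseteq> Basis"
  by auto

locale time_interval =
  fixes T :: real
  assumes T_pos: "T > 0"
begin

abbreviation I where "I \<equiv> {0..T}"

sublocale strip: regular_domain "I \<times> (UNIV :: real set)"
proof
  show "I \<times> UNIV \<subseteq> closure (interior (I \<times> (UNIV :: real set)))"
    using T_pos by (simp add: interior_Times closure_Times)
qed (auto intro: closed_Times)

sublocale slab: regular_domain "I \<times> (UNIV :: real set) \<times> (UNIV :: real set)"
proof
  show "I \<times> UNIV \<times> UNIV \<subseteq> closure (interior (I \<times> (UNIV :: real set) \<times> (UNIV :: real set)))"
    using T_pos by (simp add: interior_Times closure_Times)
  show "closed (I \<times> (UNIV :: real set) \<times> (UNIV :: real set))"
    by (intro closed_Times) auto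
qed

definition E_seminorm :: "nat \<Rightarrow> datum \<Rightarrow> real" where
  "E_seminorm n x = line.C_seminorm n (fst x) + slab.C_seminorm n (snd x)"

sublocale E: graded_seminorms "E_space T" E_seminorm
  unfolding E_space_def E_seminorm_def
  by (intro graded_seminorms_prod line.graded_seminorms_C_periodic slab.graded_seminorms_C_periodic)

sublocale F: graded_seminorms "F_space \<infinity> T" strip.C_seminorm
  unfolding F_space_def by (rule strip.graded_seminorms_C_periodic)

abbreviation carrier where "carrier \<equiv> topspace (E_space T)"

lemma carrier_iff:
  "x \<in> carrier \<longleftrightarrow> fst x \<in> C_on \<infinity> UNIV \<and> (\<forall>\<xi>. fst x (\<xi> + 1) = fst x \<xi>) \<and>
     snd x \<in> C_on \<infinity> (I \<times> UNIV \<times> UNIV) \<and> (\<forall>p. snd x (p + (0, 1, 0)) = snd x p)"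
  by (auto simp: E_space_def line.topspace_C_periodic slab.topspace_C_periodic mem_Times_iff)

definition coef :: "datum \<Rightarrow> axis list \<Rightarrow> real \<Rightarrow> real \<Rightarrow> real \<Rightarrow> real" where
  "coef x ks t \<eta> v = ext_partial (I \<times> UNIV \<times> UNIV) (map axis_vec ks) (snd x) (t, \<eta>, v)"

lemma init_lincomb:
  assumes "x \<in> carrier" "y \<in> carrier"
  shows "init (x + y) m \<xi> = init x m \<xi> + init y m \<xi>"
    and "init (x - y) m \<xi> = init x m \<xi> - init y m \<xi>"
    and "init (c *\<^sub>R x) m \<xi> = c * init x m \<xi>"
  using assms replicate_Basis[of m] unfolding init_def carrier_iff
  by (auto simp: line.ext_partial_add line.ext_partial_diff line.ext_partial_scale)

lemma coef_lincomb:
  assumes "x \<in> carrier" "y \<in> carrier" "t \<in> I"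
  shows "coef (x + y) ks t \<eta> v = coef x ks t \<eta> v + coef y ks t \<eta> v"
    and "coef (x - y) ks t \<eta> v = coef x ks t \<eta> v - coef y ks t \<eta> v"
    and "coef (c *\<^sub>R x) ks t \<eta> v = c * coef x ks t \<eta> v"
  using assms axis_vec_Basis[of ks] unfolding coef_def carrier_iff
  by (auto simp: slab.ext_partial_add slab.ext_partial_diff slab.ext_partial_scale simp del: set_map)

lemma init_0: "x \<in> carrier \<Longrightarrow> init x 0 \<xi> = fst x \<xi>"
  by (simp add: init_def carrier_iff line.ext_partial_Nil)

lemma init_periodic: "x \<in> carrier \<Longrightarrow> init x m (\<xi> + 1) = init x m \<xi>"
  unfolding init_def carrier_iff
  by (intro line.ext_partial_translate replicate_Basis) auto

lemma init_derivative:
  assumes "x \<in> carrier"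
  shows "(init x m has_real_derivative init x (Suc m) \<xi>) (at \<xi>)"
proof -
  have e: "init x m \<xi> = partial (replicate m 1) (fst x) \<xi>" for m \<xi>
    using assms replicate_Basis[of m] unfolding init_def carrier_iff
    by (intro line.ext_partial_interior) auto
  have "((\<lambda>t. partial (replicate m 1) (fst x) (\<xi> + t *\<^sub>R 1)) has_real_derivative partial (1 # replicate m 1) (fst x) \<xi>) (at 0)"
    using assms by (intro partial_has_derivative[of _ UNIV]) (auto simp: carrier_iff)
  then have "((\<lambda>t. init x m (t + \<xi>)) has_real_derivative init x (Suc m) \<xi>) (at 0)"
    by (simp add: e add.commute del: partial.simps)
  then show ?thesis
    using DERIV_shift[of "init x m" "init x (Suc m) \<xi>" 0 \<xi>] by simp
qed

lemma init_continuous: "x \<in> carrier \<Longrightarrow> continuous_on X (init x m)"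
  by (meson init_derivative DERIV_isCont continuous_at_imp_continuous_on)

lemma coef_continuous:
  assumes "x \<in> carrier"
  shows "continuous_on (I \<times> UNIV \<times> UNIV) (\<lambda>(t, \<eta>, v). coef x ks t \<eta> v)"
proof -
  have "continuous_on (I \<times> UNIV \<times> UNIV) (ext_partial (I \<times> UNIV \<times> UNIV) (map axis_vec ks) (snd x))"
    using assms by (intro slab.continuous_on_ext_partial axis_vec_Basis) (simp add: carrier_iff)
  then show ?thesis by (simp add: coef_def case_prod_beta)
qed

lemma coef_Nil: "x \<in> carrier \<Longrightarrow> t \<in> I \<Longrightarrow> coef x [] t \<eta> v = snd x (t, \<eta>, v)"
  by (simp add: coef_def carrier_iff slab.ext_partial_Nil)

lemma coef_periodic:
  assumes "x \<in> carrier" "t \<in> I"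
  shows "coef x ks t (\<eta> + 1) v = coef x ks t \<eta> v"
proof -
  have "ext_partial (I \<times> UNIV \<times> UNIV) (map axis_vec ks) (snd x) ((t, \<eta>, v) + (0, 1, 0)) =
      ext_partial (I \<times> UNIV \<times> UNIV) (map axis_vec ks) (snd x) (t, \<eta>, v)"
    using assms by (intro slab.ext_partial_translate axis_vec_Basis) (auto simp: carrier_iff)
  then show ?thesis by (simp add: coef_def)
qed

lemma coef_derivative_interior:
  assumes "x \<in> carrier" "t \<in> {0<..<T}"
  shows "((\<lambda>s. case (t, \<eta>, v) + s *\<^sub>R axis_vec k of (t, \<eta>, v) \<Rightarrow> coef x ks t \<eta> v) has_real_derivative
    coef x (k # ks) t \<eta> v) (at 0)"
proof -
  have m: "snd x \<in> C_on \<infinity> (I \<times> UNIV \<times> UNIV)" using assms by (simp add: carrier_iff)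
  have e: "coef x ks t \<eta> v = partial (map axis_vec ks) (snd x) (t, \<eta>, v)" if "t \<in> {0<..<T}" for ks t \<eta> v
    using m that unfolding coef_def
    by (intro slab.ext_partial_interior axis_vec_Basis) (simp_all add: interior_Times)
  have d: "((\<lambda>s. partial (map axis_vec ks) (snd x) ((t, \<eta>, v) + s *\<^sub>R axis_vec k)) has_real_derivative
      partial (axis_vec k # map axis_vec ks) (snd x) (t, \<eta>, v)) (at 0)"
    using m assms axis_vec_Basis[of "k # ks"] by (intro partial_has_derivative[of _ "I \<times> UNIV \<times> UNIV"]) (auto simp: interior_Times)
  have "(((\<lambda>p. fst p) \<circ> (\<lambda>s. (t, \<eta>, v) + s *\<^sub>R axis_vec k)) \<longlongrightarrow> fst ((t, \<eta>, v) + 0 *\<^sub>R axis_vec k)) (nhds 0)"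
    unfolding o_def by (intro tendsto_intros filterlim_ident)
  then have "\<forall>\<^sub>F s in nhds 0. fst ((t, \<eta>, v) + s *\<^sub>R axis_vec k) \<in> {0<..<T}"
    using assms by (intro topological_tendstoD) (auto simp: o_def)
  moreover have "(case p of (t, \<eta>, v) \<Rightarrow> coef x ks t \<eta> v) = partial (map axis_vec ks) (snd x) p"
    if "fst p \<in> {0<..<T}" for p
    using that e by (cases p) auto
  ultimately have ev: "\<forall>\<^sub>F s in nhds 0. (case (t, \<eta>, v) + s *\<^sub>R axis_vec k of (t, \<eta>, v) \<Rightarrow> coef x ks t \<eta> v) =
      partial (map axis_vec ks) (snd x) ((t, \<eta>, v) + s *\<^sub>R axis_vec k)"
    by (rule eventually_mono)
  show ?thesis
    using DERIV_cong_ev[OF refl ev refl] d e[OF assms(2), of "k # ks"] by (simp del: partial.simps)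
qed

lemma coef_derivative_Time:
  assumes "x \<in> carrier" "t \<in> {0<..<T}"
  shows "((\<lambda>t. coef x ks t \<eta> v) has_real_derivative coef x (Time # ks) t \<eta> v) (at t)"
  using coef_derivative_interior[OF assms, where \<eta> = \<eta> and v = v and k = Time and ks = ks] DERIV_shift[of "\<lambda>t. coef x ks t \<eta> v" _ 0 t]
  by (simp add: add.commute)

lemma coef_derivative_Space:
  assumes "x \<in> carrier" "t \<in> I"
  shows "((\<lambda>\<eta>. coef x ks t \<eta> v) has_real_derivative coef x (Space # ks) t \<eta> v) (at \<eta>)"
proof (rule derivative_up_to_boundary[OF T_pos _ _ _ assms(2), where P = "\<lambda>t \<eta>. coef x ks t \<eta> v"])
  show "((\<lambda>\<eta>. coef x ks t \<eta> v) has_real_derivative coef x (Space # ks) t \<eta> v) (at \<eta>)"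
    if "t \<in> {0<..<T}" for t \<eta>
    using coef_derivative_interior[OF assms(1) that, where \<eta> = \<eta> and v = v and k = Space and ks = ks] DERIV_shift[of "\<lambda>\<eta>. coef x ks t \<eta> v" _ 0 \<eta>]
    by (simp add: add.commute)
qed (auto simp: case_prod_beta intro!: continuous_on_compose_triple[OF coef_continuous[OF assms(1)]] continuous_intros)

lemma coef_derivative_Value:
  assumes "x \<in> carrier" "t \<in> I"
  shows "((\<lambda>v. coef x ks t \<eta> v) has_real_derivative coef x (Value # ks) t \<eta> v) (at v)"
proof (rule derivative_up_to_boundary[OF T_pos _ _ _ assms(2), where P = "\<lambda>t v. coef x ks t \<eta> v"])
  show "((\<lambda>v. coef x ks t \<eta> v) has_real_derivative coef x (Value # ks) t \<eta> v) (at v)"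
    if "t \<in> {0<..<T}" for t v
    using coef_derivative_interior[OF assms(1) that, where \<eta> = \<eta> and v = v and k = Value and ks = ks] DERIV_shift[of "\<lambda>v. coef x ks t \<eta> v" _ 0 v]
    by (simp add: add.commute)
qed (auto simp: case_prod_beta intro!: continuous_on_compose_triple[OF coef_continuous[OF assms(1)]] continuous_intros)

text \<open>The condition \<open>1 <= n\<close> places a full period inside the ball of radius
  \<open>n\<close>, hence a bound for all \<xi>.\<close>

lemma init_le_seminorm:
  assumes "x \<in> carrier" "m \<le> n" "1 \<le> n"
  shows "\<bar>init x m \<xi>\<bar> \<le> E_seminorm n x"
proof -
  have x: "fst x \<in> C_on \<infinity> UNIV" "snd x \<in> C_on \<infinity> (I \<times> UNIV \<times> UNIV)" using assms by (auto simp: carrier_iff)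
  have "norm (frac \<xi>) \<le> real n" using assms frac_lt_1[of \<xi>] frac_ge_0[of \<xi>] by simp
  then have "\<bar>init x m (frac \<xi>)\<bar> \<le> line.C_seminorm n (fst x)"
    unfolding init_def using assms x replicate_Basis[of m]
    by (intro line.ext_partial_le_seminorm) auto
  then show ?thesis
    using periodic_frac[of "init x m" \<xi>] init_periodic[OF assms(1)] slab.C_seminorm_nonneg[OF x(2), of n]
    by (simp add: E_seminorm_def)
qed

text \<open>The summands of \<open>T + 1 + R\<close> bound the time, one period of the space
  variable, and the value.\<close>

lemma coef_le_seminorm:
  assumes "x \<in> carrier" "length ks \<le> n" "t \<in> I" "\<bar>v\<bar> \<le> R" "T + 1 + R \<le> real n"
  shows "\<bar>coef x ks t \<eta> v\<bar> \<le> E_seminorm n x"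
proof -
  have x: "fst x \<in> C_on \<infinity> UNIV" "snd x \<in> C_on \<infinity> (I \<times> UNIV \<times> UNIV)" using assms by (auto simp: carrier_iff)
  have "norm (t, frac \<eta>, v) \<le> \<bar>t\<bar> + (\<bar>frac \<eta>\<bar> + \<bar>v\<bar>)"
    using norm_Pair_le[of t "(frac \<eta>, v)"] norm_Pair_le[of "frac \<eta>" v] by simp
  then have "norm (t, frac \<eta>, v) \<le> real n"
    using assms frac_lt_1[of \<eta>] frac_ge_0[of \<eta>] by simp
  then have "\<bar>coef x ks t (frac \<eta>) v\<bar> \<le> slab.C_seminorm n (snd x)"
    unfolding coef_def using assms x axis_vec_Basis[of ks]
    by (intro slab.ext_partial_le_seminorm) auto
  then show ?thesis
    using periodic_frac[of "\<lambda>\<eta>. coef x ks t \<eta> v" \<eta>] coef_periodic[OF assms(1,3)] line.C_seminorm_nonneg[OF x(1), of n]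
    by (simp add: E_seminorm_def)
qed

section \<open>Solutions along characteristics\<close>

text \<open>Solutions are studied in the coordinates \<open>z t \<xi> = y (t, \<xi> + t)\<close>, in which the
  transport equation is a family of ordinary differential equations with parameter \<open>\<xi>\<close>.\<close>

definition is_flow :: "datum \<Rightarrow> (real \<Rightarrow> real \<Rightarrow> real) \<Rightarrow> bool" where
  "is_flow x z \<longleftrightarrow> continuous_on (I \<times> UNIV) (\<lambda>(t, \<xi>). z t \<xi>) \<and>
     (\<forall>t \<in> I. \<forall>\<xi>. z t \<xi> = init x 0 \<xi> + integral {0..t} (\<lambda>\<tau>. coef x [] \<tau> (\<xi> + \<tau>) (z \<tau> \<xi>)))"

definition solvable :: "datum set" where
  "solvable = {x \<in> carrier. \<exists>z. is_flow x z}"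

definition flow :: "datum \<Rightarrow> real \<Rightarrow> real \<Rightarrow> real" where
  "flow x = (SOME z. is_flow x z)"

lemma solvable_carrier: "x \<in> solvable \<Longrightarrow> x \<in> carrier"
  by (simp add: solvable_def)

lemma is_flow_flow: "x \<in> solvable \<Longrightarrow> is_flow x (flow x)"
  unfolding solvable_def flow_def using someI_ex[of "is_flow x"] by blast

lemma flow_continuous: "x \<in> solvable \<Longrightarrow> continuous_on (I \<times> UNIV) (\<lambda>(t, \<xi>). flow x t \<xi>)"
  and flow_eq: "x \<in> solvable \<Longrightarrow> t \<in> I \<Longrightarrow>
    flow x t \<xi> = init x 0 \<xi> + integral {0..t} (\<lambda>\<tau>. coef x [] \<tau> (\<xi> + \<tau>) (flow x \<tau> \<xi>))"
  using is_flow_flow unfolding is_flow_def by blast+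

text \<open>The difference formula with zero perturbation and equal initial values has a vanishing
  factor.\<close>

lemma characteristic_unique:
  assumes x: "x \<in> carrier"
    and z: "continuous_on I z" "\<And>t. t \<in> I \<Longrightarrow> z t = a + integral {0..t} (\<lambda>\<tau>. coef x [] \<tau> (\<xi> + \<tau>) (z \<tau>))"
    and w: "continuous_on I w" "\<And>t. t \<in> I \<Longrightarrow> w t = a + integral {0..t} (\<lambda>\<tau>. coef x [] \<tau> (\<xi> + \<tau>) (w \<tau>))"
    and t: "t \<in> I"
  shows "z t = w t"
proof -
  have "continuous_on (I \<times> UNIV) (\<lambda>(\<tau>, v). coef x ks \<tau> (\<xi> + \<tau>) v)" for ks
    unfolding case_prod_beta
    by (intro continuous_on_compose_triple[OF coef_continuous[OF x]] continuous_intros) auto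
  from integral_equation_difference[where b = a and \<alpha> = "\<lambda>_. 0",
      OF coef_derivative_Value[OF x] this this _ w z(1) _ t] z(2)
  show ?thesis by simp
qed

lemma flow_slice_continuous:
  assumes "is_flow x z" shows "continuous_on I (\<lambda>t. z t \<xi>)"
  using assms unfolding is_flow_def
  by (auto intro!: continuous_on_compose_pair[of I UNIV z] continuous_intros)

lemma is_flow_unique:
  assumes "x \<in> carrier" "is_flow x z" "t \<in> I"
  shows "z t \<xi> = flow x t \<xi>"
proof -
  have "x \<in> solvable" using assms by (auto simp: solvable_def)
  from is_flow_flow[OF this] assms show ?thesis
    using flow_slice_continuous[of x z \<xi>] flow_slice_continuous[of x "flow x" \<xi>]
    by (intro characteristic_unique[of x "\<lambda>t. z t \<xi>" "init x 0 \<xi>" \<xi> "\<lambda>t. flow x t \<xi>"]) (auto simp: is_flow_def)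
qed

text \<open>The translated solution satisfies the same integral equation, so uniqueness applies on
  each characteristic.\<close>

lemma flow_periodic:
  assumes "x \<in> solvable" "t \<in> I"
  shows "flow x t (\<xi> + 1) = flow x t \<xi>"
proof (rule characteristic_unique[where x = x and a = "init x 0 \<xi>" and \<xi> = \<xi> and z = "\<lambda>t. flow x t (\<xi> + 1)" and w = "\<lambda>t. flow x t \<xi>"])
  have x: "x \<in> carrier" using assms solvable_carrier by blast
  fix t assume t: "t \<in> I"
  have "integral {0..t} (\<lambda>\<tau>. coef x [] \<tau> (\<xi> + 1 + \<tau>) (flow x \<tau> (\<xi> + 1))) =
      integral {0..t} (\<lambda>\<tau>. coef x [] \<tau> (\<xi> + \<tau>) (flow x \<tau> (\<xi> + 1)))"
  proof (rule integral_cong)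
    fix \<tau> assume "\<tau> \<in> {0..t}"
    then have "\<tau> \<in> I" using t by auto
    from coef_periodic[OF x this, of "[]" "\<xi> + \<tau>"]
    show "coef x [] \<tau> (\<xi> + 1 + \<tau>) (flow x \<tau> (\<xi> + 1)) = coef x [] \<tau> (\<xi> + \<tau>) (flow x \<tau> (\<xi> + 1))"
      by (simp add: algebra_simps)
  qed
  then show "flow x t (\<xi> + 1) = init x 0 \<xi> + integral {0..t} (\<lambda>\<tau>. coef x [] \<tau> (\<xi> + \<tau>) (flow x \<tau> (\<xi> + 1)))"
    using flow_eq[OF assms(1) t, of "\<xi> + 1"] init_periodic[OF x] by simp
qed (use assms solvable_carrier flow_eq flow_slice_continuous[OF is_flow_flow[OF assms(1)]] in auto)

lemma periodic_bounded:
  fixes f :: "real \<Rightarrow> real \<Rightarrow> real"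
  assumes "continuous_on (I \<times> UNIV) (\<lambda>(t, \<xi>). f t \<xi>)" "\<And>t \<xi>. t \<in> I \<Longrightarrow> f t (\<xi> + 1) = f t \<xi>"
  obtains B where "B \<ge> 0" "\<And>t \<xi>. t \<in> I \<Longrightarrow> \<bar>f t \<xi>\<bar> \<le> B"
proof -
  have "continuous_on (I \<times> {0..1}) (\<lambda>(t, \<xi>). f t \<xi>)"
    by (rule continuous_on_subset[OF assms(1)]) auto
  then have "bounded ((\<lambda>(t, \<xi>). f t \<xi>) ` (I \<times> {0..1}))"
    by (intro compact_imp_bounded compact_continuous_image compact_Times) auto
  then obtain B where B: "\<And>t \<xi>. t \<in> I \<Longrightarrow> \<xi> \<in> {0..1} \<Longrightarrow> \<bar>f t \<xi>\<bar> \<le> B"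
    unfolding bounded_iff by fastforce
  have "\<bar>f t \<xi>\<bar> \<le> \<bar>B\<bar>" if "t \<in> I" for t \<xi>
    using B[OF that, of "frac \<xi>"] periodic_frac[of "f t" \<xi>] assms(2)[OF that] frac_lt_1[of \<xi>] frac_ge_0[of \<xi>]
    by simp
  then show ?thesis using that[of "\<bar>B\<bar>"] by simp
qed

text \<open>The mean value estimate takes one more derivative in the value; hence
  \<open>length ks < n\<close>.\<close>

lemma coef_lipschitz:
  assumes "x \<in> carrier" "t \<in> I" "1 \<le> n" "\<bar>v\<bar> \<le> R" "\<bar>w\<bar> \<le> R" "T + 1 + R \<le> real n" "length ks < n"
  shows "\<bar>coef x ks t \<eta> v - coef x ks t \<eta> w\<bar> \<le> E_seminorm n x * \<bar>v - w\<bar>"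
proof -
  have "norm (coef x ks t \<eta> v - coef x ks t \<eta> w) \<le> E_seminorm n x * norm (v - w)"
  proof (rule field_differentiable_bound[of "{-R..R}" _ "coef x (Value # ks) t \<eta>"])
    show "(coef x ks t \<eta> has_real_derivative coef x (Value # ks) t \<eta> z) (at z within {-R..R})" for z
      using coef_derivative_Value[OF assms(1,2)] has_field_derivative_at_within by blast
    show "norm (coef x (Value # ks) t \<eta> z) \<le> E_seminorm n x" if "z \<in> {-R..R}" for z
      using coef_le_seminorm[OF assms(1) _ assms(2) _ assms(6), of "Value # ks" z] that assms(7) by auto
  qed (use assms in auto)
  then show ?thesis by simp
qed

text \<open>Near a solvable datum the right-hand side is cut off outside a neighbourhood of the range of the
  given solution; the solution of the truncated problem stays close enough for the cut-off to be inactive.\<close>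

lemma flow_stable:
  assumes x: "x \<in> solvable" and "\<epsilon> > 0"
  obtains n e where "e > 0"
    "\<And>x'. \<lbrakk>x' \<in> carrier; E_seminorm n (x' - x) < e\<rbrakk> \<Longrightarrow>
       x' \<in> solvable \<and> (\<forall>t \<in> I. \<forall>\<xi>. \<bar>flow x' t \<xi> - flow x t \<xi>\<bar> \<le> \<epsilon>)"
proof -
  have xc: "x \<in> carrier" using x solvable_carrier by blast
  obtain M where M: "M \<ge> 0" "\<And>t \<xi>. t \<in> I \<Longrightarrow> \<bar>flow x t \<xi>\<bar> \<le> M"
    using periodic_bounded[OF flow_continuous[OF x] flow_periodic[OF x]] by blast
  \<comment> \<open>The margin 1 around the range of the given solution is the room within which the
    cut-off must remain inactive.\<close>
  define R where "R = M + 1"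
  define n where "n = nat \<lceil>T + 1 + R\<rceil>"
  have n: "1 \<le> n" "T + 1 + R \<le> real n" "0 < n"
    using T_pos M(1) by (auto simp: n_def R_def le_nat_iff)
  \<comment> \<open>The summand 1 makes \<open>L\<close> a Lipschitz constant for all data within
    distance 1 of \<open>x\<close>, and \<open>e\<close> is at most 1.\<close>
  define L where "L = E_seminorm n x + 1"
  have L: "L > 0" using E.seminorm_nonneg[OF xc, of n] by (simp add: L_def)
  \<comment> \<open>Changing the data by \<open>e\<close> costs \<open>e\<close> in the initial
    value and at most \<open>T * e\<close> in the integral; Gronwall multiplies the sum by at most
    \<open>exp (L * T)\<close>. The result has to stay below both the margin 1 and
    \<epsilon>.\<close>
  define e where "e = min 1 (min 1 \<epsilon> / ((1 + T) * exp (L * T)))"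
  have Tp: "(1 + T) * exp (L * T) > 0" using T_pos by simp
  have e: "e > 0" "e \<le> 1" "e * ((1 + T) * exp (L * T)) \<le> min 1 \<epsilon>"
  proof -
    have "e \<le> min 1 \<epsilon> / ((1 + T) * exp (L * T))" by (simp add: e_def)
    then show "e * ((1 + T) * exp (L * T)) \<le> min 1 \<epsilon>" using Tp by (simp only: pos_le_divide_eq)
  qed (use assms(2) Tp in \<open>auto simp: e_def\<close>)
  \<comment> \<open>Truncation of the argument is 1-Lipschitz, so the truncated problem is globally
    bounded and Lipschitz with the same constant.\<close>
  define cl where "cl v = max (- R) (min R v)" for v
  have cl: "\<bar>cl v\<bar> \<le> R" "\<bar>v\<bar> \<le> R \<Longrightarrow> cl v = v" "\<bar>cl v - cl w\<bar> \<le> \<bar>v - w\<bar>" for v w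
    using M(1) by (auto simp: cl_def R_def)
  have "x' \<in> solvable \<and> (\<forall>t \<in> I. \<forall>\<xi>. \<bar>flow x' t \<xi> - flow x t \<xi>\<bar> \<le> \<epsilon>)"
    if x': "x' \<in> carrier" "E_seminorm n (x' - x) < e" for x'
  proof -
    have dc: "x' - x \<in> carrier" using x' xc E.carrier_closed by blast
    have L': "E_seminorm n x' \<le> L"
      using E.triangle[OF dc xc, of n] x'(2) e(2) by (simp add: L_def)
    define h where "h t \<xi> v = coef x' [] t (\<xi> + t) (cl v)" for t \<xi> v
    have lip: "\<bar>h t \<xi> v - h t \<xi> w\<bar> \<le> L * \<bar>v - w\<bar>" if "t \<in> I" for t \<xi> v w
    proof -
      have "\<bar>h t \<xi> v - h t \<xi> w\<bar> \<le> E_seminorm n x' * \<bar>cl v - cl w\<bar>"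
        unfolding h_def using n by (intro coef_lipschitz[OF x'(1) that _ cl(1) cl(1)]) auto
      also have "\<dots> \<le> L * \<bar>v - w\<bar>" using L' L cl(3) by (intro mult_mono) auto
      finally show ?thesis .
    qed
    have clc: "continuous_on UNIV cl" unfolding cl_def by (intro continuous_intros)
    have hc: "continuous_on (I \<times> UNIV \<times> UNIV) (\<lambda>(t, \<xi>, v). h t \<xi> v)"
      unfolding h_def case_prod_beta
      by (intro continuous_on_compose_triple[OF coef_continuous[OF x'(1)]] continuous_on_compose2[OF clc] continuous_intros) auto
    obtain z where z: "continuous_on (I \<times> UNIV) (\<lambda>(t, \<xi>). z t \<xi>)"
      "\<And>t \<xi>. t \<in> I \<Longrightarrow> z t \<xi> = init x' 0 \<xi> + integral {0..t} (\<lambda>\<tau>. h \<tau> \<xi> (z \<tau> \<xi>))"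
    proof (rule integral_equation_exists[OF _ hc _ lip L])
      show "\<bar>h t \<xi> v\<bar> \<le> E_seminorm n x'" if "t \<in> I" for t \<xi> v
        unfolding h_def using n by (intro coef_le_seminorm[OF x'(1) _ that cl(1)]) auto
      show "continuous_on UNIV (init x' 0)" using init_continuous[OF x'(1)] .
      show "\<bar>init x' 0 \<xi>\<bar> \<le> E_seminorm n x'" for \<xi> using init_le_seminorm[OF x'(1)] n by simp
    qed (use T_pos in auto)
    have zs: "continuous_on I (\<lambda>t. z t \<xi>)" for \<xi>
      by (rule continuous_on_compose_pair[OF z(1)]) auto
    have fs: "continuous_on I (\<lambda>t. flow x t \<xi>)" for \<xi>
      by (rule continuous_on_compose_pair[OF flow_continuous[OF x]]) auto
    have close: "\<bar>z t \<xi> - flow x t \<xi>\<bar> \<le> min 1 \<epsilon>" if t: "t \<in> I" for t \<xi>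
    proof -
      have hcz: "continuous_on I (\<lambda>\<tau>. h \<tau> \<xi> (z \<tau> \<xi>))"
        by (rule continuous_on_compose_triple[OF hc]) (use zs in auto)
      have hcf: "continuous_on I (\<lambda>\<tau>. coef x [] \<tau> (\<xi> + \<tau>) (flow x \<tau> \<xi>))"
        by (intro continuous_on_compose_triple[OF coef_continuous[OF xc]] continuous_intros fs) auto
      \<comment> \<open>The data are compared at the old solution, where the cut-off does nothing;
        the change of argument is charged to the Lipschitz constant.\<close>
      have pw: "\<bar>h \<tau> \<xi> (z \<tau> \<xi>) - coef x [] \<tau> (\<xi> + \<tau>) (flow x \<tau> \<xi>)\<bar> \<le> e + L * \<bar>z \<tau> \<xi> - flow x \<tau> \<xi>\<bar>"
        if \<tau>: "\<tau> \<in> I" for \<tau>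
      proof -
        have R: "\<bar>flow x \<tau> \<xi>\<bar> \<le> R" using M(2)[OF \<tau>, of \<xi>] by (simp add: R_def)
        have "\<bar>coef (x' - x) [] \<tau> (\<xi> + \<tau>) (flow x \<tau> \<xi>)\<bar> \<le> e"
          using coef_le_seminorm[OF dc _ \<tau> R n(2), of "[]" "\<xi> + \<tau>"] x'(2) by simp
        then have "\<bar>h \<tau> \<xi> (flow x \<tau> \<xi>) - coef x [] \<tau> (\<xi> + \<tau>) (flow x \<tau> \<xi>)\<bar> \<le> e"
          using coef_lincomb(2)[OF x'(1) xc \<tau>] cl(2)[OF R] by (simp add: h_def)
        then show ?thesis using lip[OF \<tau>, of \<xi> "z \<tau> \<xi>" "flow x \<tau> \<xi>"] by linarith
      qed
      have "\<bar>z t \<xi> - flow x t \<xi>\<bar> \<le> e * (1 + T) * exp (L * t)"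
      proof (rule gronwall[of T "\<lambda>t. \<bar>z t \<xi> - flow x t \<xi>\<bar>" L, OF _ _ _ t])
        fix t assume t: "t \<in> I"
        have sub: "{0..t} \<subseteq> I" using t by auto
        have ii: "(\<lambda>\<tau>. h \<tau> \<xi> (z \<tau> \<xi>)) integrable_on {0..t}"
          "(\<lambda>\<tau>. coef x [] \<tau> (\<xi> + \<tau>) (flow x \<tau> \<xi>)) integrable_on {0..t}"
          "(\<lambda>\<tau>. L * \<bar>z \<tau> \<xi> - flow x \<tau> \<xi>\<bar>) integrable_on {0..t}"
          by (intro integrable_continuous_real continuous_intros continuous_on_subset[OF _ sub] hcz hcf zs fs)+
        have "\<bar>init x' 0 \<xi> - init x 0 \<xi>\<bar> \<le> e"
          using init_le_seminorm[OF dc _ n(1), of 0 \<xi>] x'(2) init_lincomb(2)[OF x'(1) xc, of 0 \<xi>] by simp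
        moreover have "norm (integral {0..t} (\<lambda>\<tau>. h \<tau> \<xi> (z \<tau> \<xi>) - coef x [] \<tau> (\<xi> + \<tau>) (flow x \<tau> \<xi>)))
            \<le> integral {0..t} (\<lambda>\<tau>. e + L * \<bar>z \<tau> \<xi> - flow x \<tau> \<xi>\<bar>)"
          using ii pw sub by (intro integral_norm_bound_integral integrable_diff integrable_add
              integrable_const_ivl) auto
        moreover have "integral {0..t} (\<lambda>\<tau>. e + L * \<bar>z \<tau> \<xi> - flow x \<tau> \<xi>\<bar>) =
            t * e + L * integral {0..t} (\<lambda>\<tau>. \<bar>z \<tau> \<xi> - flow x \<tau> \<xi>\<bar>)"
          using t integral_add[of "\<lambda>\<tau>. e" "{0..t}" "\<lambda>\<tau>. L * \<bar>z \<tau> \<xi> - flow x \<tau> \<xi>\<bar>"]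
            ii(3) by (simp add: integrable_const_ivl)
        moreover have "t * e \<le> T * e" using t e(1) by (intro mult_right_mono) auto
        ultimately show "\<bar>z t \<xi> - flow x t \<xi>\<bar> \<le> e * (1 + T) + L * integral {0..t} (\<lambda>\<tau>. \<bar>z \<tau> \<xi> - flow x \<tau> \<xi>\<bar>)"
          using z(2)[OF t, of \<xi>] flow_eq[OF x t, of \<xi>] integral_diff[OF ii(1,2)]
          by (simp add: algebra_simps)
      qed (use L zs fs in \<open>auto intro!: continuous_intros\<close>)
      also have "\<dots> \<le> e * (1 + T) * exp (L * T)"
        using t L e(1) T_pos by (intro mult_left_mono) auto
      finally show ?thesis using e(3) by (simp add: mult.assoc)
    qed
    \<comment> \<open>The new solution stays within the margin, so it solves the problem without
      cut-off.\<close>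
    have "\<bar>z t \<xi>\<bar> \<le> R" if "t \<in> I" for t \<xi>
      using close[OF that, of \<xi>] M(2)[OF that, of \<xi>] by (auto simp: R_def)
    then have "integral {0..t} (\<lambda>\<tau>. h \<tau> \<xi> (z \<tau> \<xi>)) = integral {0..t} (\<lambda>\<tau>. coef x' [] \<tau> (\<xi> + \<tau>) (z \<tau> \<xi>))"
      if "t \<in> I" for t \<xi>
      using that cl(2) by (intro integral_cong) (auto simp: h_def)
    with z have f: "is_flow x' z" by (simp add: is_flow_def)
    then have "x' \<in> solvable" using x' by (auto simp: solvable_def)
    with is_flow_unique[OF x'(1) f] close show ?thesis by fastforce
  qed
  with e(1) that show ?thesis by blast
qed

lemma openin_solvable: "openin (E_space T) solvable"
  unfolding E.openin_iff
proof (intro conjI ballI)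
  fix x assume "x \<in> solvable"
  then obtain n e where "e > 0" "\<And>x'. \<lbrakk>x' \<in> carrier; E_seminorm n (x' - x) < e\<rbrakk> \<Longrightarrow> x' \<in> solvable"
    using flow_stable[OF _ zero_less_one] by metis
  then show "\<exists>n. \<exists>e>0. \<forall>y \<in> carrier. E_seminorm n (y - x) < e \<longrightarrow> y \<in> solvable" by blast
qed (use solvable_carrier in blast)

end

section \<open>A class of functions closed under differentiation\<close>

text \<open>
  Expressions denote functions of a datum \<open>x\<close>, of directions \<open>u i\<close>, and of \<open>(t, \<xi>)\<close>. An index
  \<open>None\<close> refers to \<open>x\<close> and \<open>Some i\<close> to \<open>u i\<close>; the arguments of \<open>Init\<close> and \<open>Coef\<close> record derivatives of
  the data, the latter evaluated along the solution.
\<close>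

datatype expr =
    Sol
  | Init "nat option" nat
  | Coef "nat option" "axis list"
  | Const real
  | Plus expr expr
  | Times expr expr
  | Expo expr
  | Integ expr

text \<open>\<open>Shift\<close> varies the parameter \<xi> and \<open>Dir j\<close> varies the
  datum along \<open>u j\<close>. Either way the flow is a family of scalar integral equations with
  one real parameter, so both derivations share their formulas and proofs.\<close>

datatype derivation = Shift | Dir nat

primrec moved_datum :: "derivation \<Rightarrow> datum \<Rightarrow> (nat \<Rightarrow> datum) \<Rightarrow> real \<Rightarrow> datum" where
  "moved_datum Shift x u s = x"
| "moved_datum (Dir j) x u s = x + s *\<^sub>R u j"

primrec moved_point :: "derivation \<Rightarrow> real \<Rightarrow> real \<Rightarrow> real" where
  "moved_point Shift \<xi> s = \<xi> + s"
| "moved_point (Dir j) \<xi> s = \<xi>"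

lemma moved_0 [simp]: "moved_datum \<delta> x u 0 = x" "moved_point \<delta> \<xi> 0 = \<xi>"
  by (cases \<delta>; simp)+

lemma moved_add:
  "moved_datum \<delta> (moved_datum \<delta> x u s) u r = moved_datum \<delta> x u (s + r)"
  "moved_point \<delta> (moved_point \<delta> \<xi> s) r = moved_point \<delta> \<xi> (s + r)"
  by (cases \<delta>; simp add: scaleR_add_left add.assoc)+

text \<open>The datum enters linearly, so its directional derivative is the direction itself; the
  directions do not move with the datum, hence \<open>Const 0\<close>.\<close>

primrec dinit :: "derivation \<Rightarrow> nat option \<Rightarrow> nat \<Rightarrow> expr" where
  "dinit Shift i m = Init i (Suc m)"
| "dinit (Dir j) i m = (case i of None \<Rightarrow> Init (Some j) m | Some _ \<Rightarrow> Const 0)"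

primrec dcoef :: "derivation \<Rightarrow> nat option \<Rightarrow> axis list \<Rightarrow> expr" where
  "dcoef Shift i ks = Coef i (Space # ks)"
| "dcoef (Dir j) i ks = (case i of None \<Rightarrow> Coef (Some j) ks | Some _ \<Rightarrow> Const 0)"

text \<open>Differentiating the integral equation gives a linear scalar equation, solved by an
  integrating factor.\<close>

definition dsol :: "derivation \<Rightarrow> expr" where
  "dsol \<delta> = (let A = Integ (Coef None [Value]) in
     Times (Expo A) (Plus (dinit \<delta> None 0) (Integ (Times (Expo (Times (Const (- 1)) A)) (dcoef \<delta> None [])))))"

primrec dv :: "derivation \<Rightarrow> expr \<Rightarrow> expr" where
  "dv \<delta> Sol = dsol \<delta>"
| "dv \<delta> (Init i m) = dinit \<delta> i m"
| "dv \<delta> (Coef i ks) = Plus (dcoef \<delta> i ks) (Times (Coef i (Value # ks)) (dsol \<delta>))"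
| "dv \<delta> (Const c) = Const 0"
| "dv \<delta> (Plus a b) = Plus (dv \<delta> a) (dv \<delta> b)"
| "dv \<delta> (Times a b) = Plus (Times (dv \<delta> a) b) (Times a (dv \<delta> b))"
| "dv \<delta> (Expo a) = Times (Expo a) (dv \<delta> a)"
| "dv \<delta> (Integ a) = Integ (dv \<delta> a)"

text \<open>The derivative in \<open>t\<close> at fixed \<open>\<xi>\<close>, that is, along characteristics.\<close>

primrec dc :: "expr \<Rightarrow> expr" where
  "dc Sol = Coef None []"
| "dc (Init i m) = Const 0"
| "dc (Coef i ks) = Plus (Plus (Coef i (Time # ks)) (Coef i (Space # ks)))
     (Times (Coef i (Value # ks)) (Coef None []))"
| "dc (Const c) = Const 0"
| "dc (Plus a b) = Plus (dc a) (dc b)"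
| "dc (Times a b) = Plus (Times (dc a) b) (Times a (dc b))"
| "dc (Expo a) = Times (Expo a) (dc a)"
| "dc (Integ a) = a"

context time_interval
begin

primrec ev :: "expr \<Rightarrow> datum \<Rightarrow> (nat \<Rightarrow> datum) \<Rightarrow> real \<Rightarrow> real \<Rightarrow> real" where
  "ev Sol x u t \<xi> = flow x t \<xi>"
| "ev (Init i m) x u t \<xi> = init (case_option x u i) m \<xi>"
| "ev (Coef i ks) x u t \<xi> = coef (case_option x u i) ks t (\<xi> + t) (flow x t \<xi>)"
| "ev (Const c) x u t \<xi> = c"
| "ev (Plus a b) x u t \<xi> = ev a x u t \<xi> + ev b x u t \<xi>"
| "ev (Times a b) x u t \<xi> = ev a x u t \<xi> * ev b x u t \<xi>"
| "ev (Expo a) x u t \<xi> = exp (ev a x u t \<xi>)"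
| "ev (Integ a) x u t \<xi> = integral {0..t} (\<lambda>\<tau>. ev a x u \<tau> \<xi>)"

definition good :: "datum \<Rightarrow> (nat \<Rightarrow> datum) \<Rightarrow> bool" where
  "good x u \<longleftrightarrow> x \<in> solvable \<and> range u \<subseteq> carrier"

lemma goodD:
  assumes "good x u"
  shows "x \<in> solvable" "x \<in> carrier" "u i \<in> carrier" "case_option x u k \<in> carrier" "range u \<subseteq> carrier"
  using assms solvable_carrier by (auto simp: good_def split: option.split)

section \<open>Boundedness of expressions and their uniform dependence on the data\<close>

lemma ev_continuous:
  assumes "good x u"
  shows "continuous_on (I \<times> UNIV) (\<lambda>(t, \<xi>). ev e x u t \<xi>)"
proof (induction e)
  case Sol
  then show ?case using flow_continuous goodD(1)[OF assms] by simp
next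
  case (Init i m)
  then show ?case
    by (auto simp: case_prod_beta intro!: continuous_on_compose2[OF init_continuous[OF goodD(4)[OF assms], of UNIV]] continuous_intros)
next
  case (Coef i ks)
  then show ?case
    unfolding ev.simps case_prod_beta
    by (intro continuous_on_compose_triple[OF coef_continuous[OF goodD(4)[OF assms]]]
        continuous_on_compose_pair[OF flow_continuous[OF goodD(1)[OF assms]]] continuous_intros) auto
next
  case (Integ a)
  have "continuous_on (UNIV \<times> I) (\<lambda>(\<xi>, t). ev a x u t \<xi>)"
    unfolding case_prod_beta by (intro continuous_on_compose_pair[OF Integ] continuous_intros) auto
  from continuous_on_integral_upto[OF this] show ?case
    unfolding ev.simps case_prod_beta by (intro continuous_on_compose_pair[of UNIV I "\<lambda>\<xi> t. integral {0..t} (\<lambda>\<tau>. ev a x u \<tau> \<xi>)"] continuous_intros)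
      (auto simp: case_prod_beta)
qed (auto simp: case_prod_beta intro!: continuous_intros)

lemma ev_continuous_slice: "good x u \<Longrightarrow> continuous_on I (\<lambda>t. ev e x u t \<xi>)"
  by (rule continuous_on_compose_pair[OF ev_continuous]) auto

lemma ev_integrable: "good x u \<Longrightarrow> t \<in> I \<Longrightarrow> (\<lambda>\<tau>. ev e x u \<tau> \<xi>) integrable_on {0..t}"
  by (intro integrable_continuous_real continuous_on_subset[OF ev_continuous_slice]) auto

lemma ev_periodic:
  assumes "good x u" "t \<in> I"
  shows "ev e x u t (\<xi> + 1) = ev e x u t \<xi>"
  using assms(2)
proof (induction e arbitrary: t)
  case (Coef i ks)
  then show ?case
    using coef_periodic[OF goodD(4)[OF assms(1)] Coef, of i ks "\<xi> + t"] flow_periodic[OF goodD(1)[OF assms(1)] Coef, of \<xi>]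
    by (simp add: add.commute add.left_commute)
next
  case (Integ a)
  then show ?case by (auto intro!: integral_cong)
qed (use assms flow_periodic init_periodic goodD in auto)

lemma ev_bounded:
  assumes "good x u"
  obtains B where "B \<ge> 0" "\<And>t \<xi>. t \<in> I \<Longrightarrow> \<bar>ev e x u t \<xi>\<bar> \<le> B"
  by (rule periodic_bounded[of "ev e x u"]) (use ev_continuous ev_periodic assms in auto)

text \<open>One radius serves all directions, infinitely many in number. In the applications to
  derivatives the lists are padded by zero, so only finitely many of these conditions have
  content.\<close>

definition env_ball :: "nat \<Rightarrow> real \<Rightarrow> datum \<Rightarrow> (nat \<Rightarrow> datum) \<Rightarrow> (datum \<times> (nat \<Rightarrow> datum)) set" where
  "env_ball n e x u = {q. fst q \<in> carrier \<and> range (snd q) \<subseteq> carrier \<and>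
     E_seminorm n (fst q - x) < e \<and> (\<forall>i. E_seminorm n (snd q i - u i) < e)}"

text \<open>As a filter, these neighbourhoods fit the general calculus of uniform limits.\<close>

definition env_nhds :: "datum \<Rightarrow> (nat \<Rightarrow> datum) \<Rightarrow> (datum \<times> (nat \<Rightarrow> datum)) filter" where
  "env_nhds x u = (INF b \<in> UNIV \<times> {0<..}. principal (env_ball (fst b) (snd b) x u))"

lemma eventually_env_nhds:
  assumes "x \<in> carrier" "range u \<subseteq> carrier"
  shows "eventually P (env_nhds x u) \<longleftrightarrow> (\<exists>n. \<exists>e>0. \<forall>q \<in> env_ball n e x u. P q)"
proof -
  have sub: "env_ball (max m n) (min d e) x u \<subseteq> env_ball m d x u \<inter> env_ball n e x u" for m n d e
  proof
    fix q assume q: "q \<in> env_ball (max m n) (min d e) x u"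
    have le: "E_seminorm m w \<le> E_seminorm (max m n) w" "E_seminorm n w \<le> E_seminorm (max m n) w"
      if "w \<in> carrier" for w
      using E.mono[OF _ that] by simp_all
    have c: "fst q \<in> carrier" "range (snd q) \<subseteq> carrier" "E_seminorm (max m n) (fst q - x) < min d e"
      "E_seminorm (max m n) (snd q i - u i) < min d e" for i
      using q unfolding env_ball_def by blast+
    have "snd q i \<in> carrier" "u i \<in> carrier" for i using c(2) assms(2) by blast+
    then show "q \<in> env_ball m d x u \<inter> env_ball n e x u"
      using c(1-2) le[OF E.carrier_closed(3)[OF c(1) assms(1)]] c(3)
        le[OF E.carrier_closed(3)] c(4)
      unfolding env_ball_def by (simp add: min_less_iff_conj) (meson le_less_trans)
  qed
  have "\<exists>b\<in>UNIV \<times> {0<..}. principal (env_ball (fst b) (snd b) x u)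
      \<le> inf (principal (env_ball (fst b1) (snd b1) x u)) (principal (env_ball (fst b2) (snd b2) x u))"
    if "b1 \<in> UNIV \<times> {0<..}" "b2 \<in> UNIV \<times> {0<..}" for b1 b2 :: "nat \<times> real"
    using that sub[of "fst b1" "fst b2" "snd b1" "snd b2"]
    by (intro bexI[of _ "(max (fst b1) (fst b2), min (snd b1) (snd b2))"]) (auto simp: mem_Times_iff)
  then show ?thesis
    unfolding env_nhds_def
    by (subst eventually_INF_base) (auto simp: eventually_principal Bex_def)
qed

lemma eventually_env_close:
  assumes "good x u" "e > 0"
  shows "\<forall>\<^sub>F q in env_nhds x u. case_option (fst q) (snd q) i \<in> carrier \<and>
    E_seminorm n (case_option (fst q) (snd q) i - case_option x u i) < e"
  using assms unfolding eventually_env_nhds[OF goodD(2,5)[OF assms(1)]]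
  by (intro exI[of _ n] exI[of _ e]) (auto simp: env_ball_def split: option.split)

lemma eventually_env_flow:
  assumes "good x u" "e > 0"
  shows "\<forall>\<^sub>F q in env_nhds x u. good (fst q) (snd q) \<and> (\<forall>t\<in>I. \<forall>\<xi>. \<bar>flow (fst q) t \<xi> - flow x t \<xi>\<bar> < e)"
proof -
  obtain n d where nd: "d > 0" "\<And>x'. \<lbrakk>x' \<in> carrier; E_seminorm n (x' - x) < d\<rbrakk> \<Longrightarrow>
       x' \<in> solvable \<and> (\<forall>t \<in> I. \<forall>\<xi>. \<bar>flow x' t \<xi> - flow x t \<xi>\<bar> \<le> e / 2)"
    using flow_stable[OF goodD(1)[OF assms(1)], of "e / 2"] assms(2) by (metis half_gt_zero)
  have "good (fst q) (snd q) \<and> (\<forall>t\<in>I. \<forall>\<xi>. \<bar>flow (fst q) t \<xi> - flow x t \<xi>\<bar> < e)"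
    if "q \<in> env_ball n d x u" for q
  proof -
    have c: "fst q \<in> carrier" "range (snd q) \<subseteq> carrier" "E_seminorm n (fst q - x) < d"
      using that unfolding env_ball_def by blast+
    have "a < e" if "a \<le> e / 2" for a using that assms(2) by simp
    with nd(2)[OF c(1,3)] c(2) show ?thesis unfolding good_def by blast
  qed
  then show ?thesis
    using nd(1) unfolding eventually_env_nhds[OF goodD(2,5)[OF assms(1)]] by blast
qed

text \<open>Structural induction, carried through products and exponentials by boundedness:
  multiplication and \<open>exp\<close> are uniformly continuous on bounded sets only.\<close>

lemma ev_uniform_limit:
  assumes "good x u"
  shows "uniform_limit (I \<times> UNIV) (\<lambda>q p. ev e (fst q) (snd q) (fst p) (snd p))
    (\<lambda>p. ev e x u (fst p) (snd p)) (env_nhds x u)"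
proof (induction e)
  case Sol
  show ?case
    by (rule uniform_limitI, rule eventually_mono[OF eventually_env_flow[OF assms]]) (auto simp: dist_real_def)
next
  case (Init i m)
  show ?case
  proof (rule uniform_limitI)
    fix e :: real assume "e > 0"
    from eventually_env_close[OF assms this, of i "max m 1"]
    show "\<forall>\<^sub>F q in env_nhds x u. \<forall>p\<in>I \<times> UNIV. dist (ev (Init i m) (fst q) (snd q) (fst p) (snd p)) (ev (Init i m) x u (fst p) (snd p)) < e"
    proof eventually_elim
      case (elim q)
      let ?d = "case_option (fst q) (snd q) i" and ?base = "case_option x u i"
      have d: "?d \<in> carrier" "?base \<in> carrier" "E_seminorm (max m 1) (?d - ?base) < e"
        using elim goodD(4)[OF assms] by blast+
      have "\<bar>init (?d - ?base) m \<xi>\<bar> < e" for \<xi>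
        by (rule le_less_trans[OF init_le_seminorm d(3)]) (use d E.carrier_closed in auto)
      then show ?case by (simp add: dist_real_def init_lincomb(2)[OF d(1,2)])
    qed
  qed
next
  case (Coef i ks)
  let ?base = "case_option x u i"
  have d0: "?base \<in> carrier" using goodD(4)[OF assms] .
  obtain M where M: "M \<ge> 0" "\<And>t \<xi>. t \<in> I \<Longrightarrow> \<bar>flow x t \<xi>\<bar> \<le> M"
    using ev_bounded[OF assms, of Sol] by auto
  define R where "R = M + 1"
  \<comment> \<open>The radius must cover the perturbed values as well, and one extra order is
    reserved for the Lipschitz estimate.\<close>
  define n where "n = max (nat \<lceil>T + 1 + R\<rceil>) (Suc (length ks))"
  have n: "T + 1 + R \<le> real n" "length ks < n"
    using real_nat_ceiling_ge[of "T + 1 + R"] unfolding n_def by (auto simp: le_max_iff_disj)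
  define L where "L = E_seminorm n ?base + 1"
  have L: "L > 0" using E.seminorm_nonneg[OF d0, of n] by (simp add: L_def)
  show ?case
  proof (rule uniform_limitI)
    fix e :: real assume e: "e > 0"
    \<comment> \<open>The bound 1 keeps the perturbed flow within \<open>R\<close>; the other bound
      makes the change of argument cost at most \<open>e / 2\<close>, the remaining half going to
      the change of the datum.\<close>
    define r where "r = min 1 (e / (2 * L))"
    have r: "r > 0" "L * r \<le> e / 2"
      using e L by (auto simp: r_def min_mult_distrib_left)
    have e2: "e / 2 > 0" using e by simp
    from eventually_env_close[OF assms e2, of i n] eventually_env_flow[OF assms r(1)]
    show "\<forall>\<^sub>F q in env_nhds x u. \<forall>p\<in>I \<times> UNIV. dist (ev (Coef i ks) (fst q) (snd q) (fst p) (snd p)) (ev (Coef i ks) x u (fst p) (snd p)) < e"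
    proof eventually_elim
      case (elim q)
      let ?d = "case_option (fst q) (snd q) i"
      have d: "?d \<in> carrier" "E_seminorm n (?d - ?base) < e / 2" using elim(1) by blast+
      have dc: "?d - ?base \<in> carrier" using d(1) d0 by (rule E.carrier_closed)
      have "\<bar>coef ?d ks t (\<xi> + t) (flow (fst q) t \<xi>) - coef ?base ks t (\<xi> + t) (flow x t \<xi>)\<bar> < e" if t: "t \<in> I" for t \<xi>
      proof -
        have f: "\<bar>flow (fst q) t \<xi> - flow x t \<xi>\<bar> < r" using elim(2) t by blast
        then have R: "\<bar>flow (fst q) t \<xi>\<bar> \<le> R" "\<bar>flow x t \<xi>\<bar> \<le> R"
          using M(2)[OF t, of \<xi>] by (auto simp: R_def r_def)
        have "\<bar>coef (?d - ?base) ks t (\<xi> + t) (flow (fst q) t \<xi>)\<bar> < e / 2"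
          using coef_le_seminorm[OF dc _ t R(1) n(1), of ks "\<xi> + t"] n(2) d(2) by linarith
        moreover have "\<bar>coef ?base ks t (\<xi> + t) (flow (fst q) t \<xi>) - coef ?base ks t (\<xi> + t) (flow x t \<xi>)\<bar> \<le> e / 2"
        proof -
          have "\<bar>coef ?base ks t (\<xi> + t) (flow (fst q) t \<xi>) - coef ?base ks t (\<xi> + t) (flow x t \<xi>)\<bar>
              \<le> E_seminorm n ?base * \<bar>flow (fst q) t \<xi> - flow x t \<xi>\<bar>"
            using n by (intro coef_lipschitz[OF d0 t _ R]) auto
          also have "\<dots> \<le> L * r"
            using f E.seminorm_nonneg[OF d0, of n] by (intro mult_mono) (auto simp: L_def)
          finally show ?thesis using r(2) by linarith
        qed
        ultimately show ?thesis
          using coef_lincomb(2)[OF d(1) d0 t, of ks "\<xi> + t" "flow (fst q) t \<xi>"] by linarith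
      qed
      then show ?case by (auto simp: dist_real_def)
    qed
  qed
next
  case (Const c)
  then show ?case by (simp add: uniform_limit_const)
next
  case (Plus a b)
  then show ?case by (simp add: uniform_limit_add)
next
  case (Times a b)
  have "bounded ((\<lambda>p. ev e x u (fst p) (snd p)) ` (I \<times> UNIV))" for e
  proof -
    obtain B where "\<And>t \<xi>. t \<in> I \<Longrightarrow> \<bar>ev e x u t \<xi>\<bar> \<le> B" using ev_bounded[OF assms] by blast
    then show ?thesis unfolding bounded_iff by (intro exI[of _ B]) auto
  qed
  from uniform_lim_mult[OF Times this this] show ?case by simp
next
  case (Expo a)
  obtain B where B: "\<And>t \<xi>. t \<in> I \<Longrightarrow> \<bar>ev a x u t \<xi>\<bar> \<le> B" using ev_bounded[OF assms] by blast
  have "\<forall>\<^sub>F q in env_nhds x u. \<forall>p\<in>I \<times> UNIV. dist (ev a (fst q) (snd q) (fst p) (snd p)) (ev a x u (fst p) (snd p)) < 1"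
    using uniform_limitD[OF Expo, of 1] by simp
  then have "\<forall>\<^sub>F q in env_nhds x u. \<forall>p\<in>I \<times> UNIV. ev a (fst q) (snd q) (fst p) (snd p) \<in> cball 0 (B + 1)"
  proof (rule eventually_mono, intro ballI)
    fix q p assume q: "\<forall>p\<in>I \<times> UNIV. dist (ev a (fst q) (snd q) (fst p) (snd p)) (ev a x u (fst p) (snd p)) < 1"
      and p: "p \<in> I \<times> (UNIV :: real set)"
    have "\<bar>ev a x u (fst p) (snd p)\<bar> \<le> B" using B p by auto
    with q[rule_format, OF p] show "ev a (fst q) (snd q) (fst p) (snd p) \<in> cball 0 (B + 1)"
      by (simp add: dist_real_def)
  qed
  moreover have "uniformly_continuous_on (cball 0 (B + 1)) (exp :: real \<Rightarrow> real)"
    by (intro compact_uniformly_continuous continuous_intros) auto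
  ultimately show ?case
    unfolding ev.simps
    by (intro uniform_limit_compose_uniformly_continuous_on[OF Expo, of "cball 0 (B + 1)" exp]) auto
next
  case (Integ a)
  show ?case
  proof (rule uniform_limitI)
    fix e :: real assume e: "e > 0"
    \<comment> \<open>Integration over at most time \<open>T\<close> gives at most
      \<open>e / 2\<close>, which restores the strict inequality.\<close>
    define r where "r = e / (2 * T)"
    have r: "r > 0" using e T_pos by (simp add: r_def)
    from uniform_limitD[OF Integ r] eventually_env_flow[OF assms zero_less_one]
    show "\<forall>\<^sub>F q in env_nhds x u. \<forall>p\<in>I \<times> UNIV. dist (ev (Integ a) (fst q) (snd q) (fst p) (snd p)) (ev (Integ a) x u (fst p) (snd p)) < e"
    proof eventually_elim
      case (elim q)
      then have g: "good (fst q) (snd q)" by blast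
      have "\<bar>integral {0..t} (\<lambda>\<tau>. ev a (fst q) (snd q) \<tau> \<xi>) - integral {0..t} (\<lambda>\<tau>. ev a x u \<tau> \<xi>)\<bar> < e" if t: "t \<in> I" for t \<xi>
      proof -
        have "norm (integral {0..t} (\<lambda>\<tau>. ev a (fst q) (snd q) \<tau> \<xi> - ev a x u \<tau> \<xi>)) \<le> integral {0..t} (\<lambda>\<tau>. r)"
        proof (rule integral_norm_bound_integral)
          show "norm (ev a (fst q) (snd q) \<tau> \<xi> - ev a x u \<tau> \<xi>) \<le> r" if "\<tau> \<in> {0..t}" for \<tau>
          proof -
            have "(\<tau>, \<xi>) \<in> I \<times> UNIV" using that t by auto
            from elim(1)[rule_format, OF this] show ?thesis by (simp add: dist_norm)
          qed
        qed (intro integrable_diff ev_integrable assms g t integrable_const_ivl)+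
        also have "\<dots> \<le> T * r" using t r by (simp add: mult_right_mono)
        also have "\<dots> < e" using e T_pos by (simp add: r_def)
        finally show ?thesis
          using integral_diff[OF ev_integrable[OF g t] ev_integrable[OF assms t]] by simp
      qed
      then show ?case by (auto simp: dist_real_def)
    qed
  qed
qed

lemma filterlim_env_line:
  assumes "x \<in> carrier" "range u \<subseteq> carrier"
  shows "filterlim (\<lambda>s. (x + s *\<^sub>R u j, u)) (env_nhds (x + r *\<^sub>R u j) u) (nhds r)"
  unfolding filterlim_iff
proof (intro allI impI)
  have uj: "u j \<in> carrier" using assms by auto
  then have xr: "x + r *\<^sub>R u j \<in> carrier" for r using assms E.carrier_closed by auto
  fix P assume "eventually P (env_nhds (x + r *\<^sub>R u j) u)"
  then obtain n e where ne: "e > 0" "\<forall>q \<in> env_ball n e (x + r *\<^sub>R u j) u. P q"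
    unfolding eventually_env_nhds[OF xr assms(2)] by blast
  have "((\<lambda>s. \<bar>s - r\<bar> * E_seminorm n (u j)) \<longlongrightarrow> \<bar>r - r\<bar> * E_seminorm n (u j)) (nhds r)"
    by (intro tendsto_intros filterlim_ident)
  then have "\<forall>\<^sub>F s in nhds r. \<bar>s - r\<bar> * E_seminorm n (u j) < e"
    using ne(1) by (intro order_tendstoD) auto
  then show "\<forall>\<^sub>F s in nhds r. P (x + s *\<^sub>R u j, u)"
  proof eventually_elim
    case (elim s)
    have "(x + s *\<^sub>R u j) - (x + r *\<^sub>R u j) = (s - r) *\<^sub>R u j" by (simp add: scaleR_left_diff_distrib)
    then have "E_seminorm n ((x + s *\<^sub>R u j) - (x + r *\<^sub>R u j)) < e"
      using elim E.scale[OF uj, of n "s - r"] by simp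
    then show ?case
      using xr assms(2) E.seminorm_zero ne(1) by (intro ne(2)[rule_format]) (simp add: env_ball_def)
  qed
qed

text \<open>Supplies the joint continuity in parameter and time for differentiating the flow and for
  differentiating under integrals. Along \<open>Shift\<close> it is ordinary continuity in \<xi>;
  along \<open>Dir j\<close> it combines openness of \<open>solvable\<close> with
  \<open>ev_uniform_limit\<close>. One \<open>r\<close> serves all expressions.\<close>

lemma moved_continuous:
  assumes "good x u"
  obtains r where "r > 0" "\<And>s. \<bar>s\<bar> < r \<Longrightarrow> good (moved_datum \<delta> x u s) u"
    "\<And>e \<xi>. continuous_on ({- r<..<r} \<times> I) (\<lambda>(s, t). ev e (moved_datum \<delta> x u s) u t (moved_point \<delta> \<xi> s))"
proof (cases \<delta>)
  case Shift
  have "continuous_on ({- 1<..<1} \<times> I) (\<lambda>(s, t). ev e x u t (\<xi> + s))" for e \<xi>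
    unfolding case_prod_beta by (intro continuous_on_compose_pair[OF ev_continuous[OF assms]] continuous_intros) auto
  then show ?thesis using that[of 1] assms Shift by simp
next
  case (Dir j)
  have "\<forall>\<^sub>F q in env_nhds (x + 0 *\<^sub>R u j) u. good (fst q) (snd q)"
    using eventually_env_flow[OF assms zero_less_one] by (auto elim: eventually_mono)
  from eventually_compose_filterlim[OF this filterlim_env_line[OF goodD(2,5)[OF assms]]]
  obtain r where r: "r > 0" "\<And>s. \<bar>s\<bar> < r \<Longrightarrow> good (x + s *\<^sub>R u j) u"
    unfolding eventually_nhds_metric by (auto simp: dist_real_def)
  have "continuous_on ({- r<..<r} \<times> I) (\<lambda>(s, t). ev e (x + s *\<^sub>R u j) u t \<xi>)" for e \<xi>
  proof (rule continuous_on_of_uniform_limits)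
    fix s assume "s \<in> {- r<..<r}"
    then have g: "good (x + s *\<^sub>R u j) u" using r(2)[of s] by auto
    show "continuous_on I (\<lambda>t. ev e (x + s *\<^sub>R u j) u t \<xi>)" using ev_continuous_slice[OF g] .
    show "uniform_limit I (\<lambda>s t. ev e (x + s *\<^sub>R u j) u t \<xi>) (\<lambda>t. ev e (x + s *\<^sub>R u j) u t \<xi>) (at s within {- r<..<r})"
    proof (rule uniform_limitI)
      fix d :: real assume "d > 0"
      from eventually_compose_filterlim[OF uniform_limitD[OF ev_uniform_limit[OF g] this]
          filterlim_env_line[OF goodD(2,5)[OF assms]]]
      have "\<forall>\<^sub>F s' in nhds s. \<forall>t\<in>I. dist (ev e (x + s' *\<^sub>R u j) u t \<xi>) (ev e (x + s *\<^sub>R u j) u t \<xi>) < d"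
        by (rule eventually_mono) auto
      then show "\<forall>\<^sub>F s' in at s within {- r<..<r}. \<forall>t\<in>I. dist (ev e (x + s' *\<^sub>R u j) u t \<xi>) (ev e (x + s *\<^sub>R u j) u t \<xi>) < d"
        by (auto simp: eventually_at_filter elim: eventually_mono)
    qed
  qed
  then show ?thesis using that[of r] r Dir by simp
qed

end

context time_interval
begin

section \<open>Derivatives of expressions\<close>

lemma dsol_derivative:
  assumes "good x u" "t \<in> I"
  shows "((\<lambda>s. flow (moved_datum \<delta> x u s) t (moved_point \<delta> \<xi> s)) has_real_derivative ev (dsol \<delta>) x u t \<xi>) (at 0)"
proof -
  let ?x = "moved_datum \<delta> x u" and ?p = "moved_point \<delta> \<xi>"
  note c = goodD(2,3)[OF assms(1)]
  obtain r where r: "r > 0" "\<And>s. \<bar>s\<bar> < r \<Longrightarrow> good (?x s) u"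
    "\<And>e. continuous_on ({- r<..<r} \<times> I) (\<lambda>(s, t). ev e (?x s) u t (?p s))"
    by (rule moved_continuous[OF assms(1)]) blast
  have g: "good (?x s) u" if "s \<in> {- r<..<r}" for s
    using r(2)[of s] that by auto
  define J where "J = {- r<..<r}"
  \<comment> \<open>The difference quotient of the right-hand side in the parameter, extended
    continuously to \<open>s = 0\<close>: an averaged space derivative for \<open>Shift\<close>, and
    the direction itself for \<open>Dir j\<close>, since the right-hand side is linear in the
    datum.\<close>
  define \<alpha> where "\<alpha> s \<tau> v = (case \<delta> of
      Shift \<Rightarrow> integral {0..1} (\<lambda>\<rho>. coef x [Space] \<tau> (\<xi> + \<tau> + \<rho> * s) v)
    | Dir j \<Rightarrow> coef (u j) [] \<tau> (\<xi> + \<tau>) v)" for s \<tau> v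
  have \<alpha>0: "\<alpha> 0 \<tau> (flow x \<tau> \<xi>) = ev (dcoef \<delta> None []) x u \<tau> \<xi>" for \<tau>
    by (cases \<delta>) (auto simp: \<alpha>_def)
  have \<alpha>c: "continuous_on (J \<times> I \<times> UNIV) (\<lambda>(s, \<tau>, v). \<alpha> s \<tau> v)"
  proof (cases \<delta>)
    case Shift
    have "continuous_on (J \<times> I \<times> UNIV) (\<lambda>x'. integral {0..1} (\<lambda>\<rho>. coef x [Space] (fst (snd x')) (\<xi> + fst (snd x') + \<rho> * fst x') (snd (snd x'))))"
      unfolding case_prod_beta
      by (rule continuous_on_integral_01, unfold case_prod_beta,
          intro continuous_on_compose_triple[OF coef_continuous[OF c(1)]] continuous_intros) auto
    then show ?thesis by (simp add: \<alpha>_def Shift case_prod_beta)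
  next
    case (Dir j)
    then show ?thesis
      unfolding \<alpha>_def case_prod_beta derivation.case
      by (simp, intro continuous_on_compose_triple[OF coef_continuous[OF c(2)]] continuous_intros) auto
  qed
  have ai: "((\<lambda>s. init (?x s) 0 (?p s)) has_real_derivative ev (dinit \<delta> None 0) x u t \<xi>) (at 0)"
  proof (cases \<delta>)
    case Shift
    then show ?thesis
      using DERIV_shift[of "init x 0" "init x (Suc 0) \<xi>" 0 \<xi>] init_derivative[OF c(1), of 0 \<xi>]
      by (simp add: add.commute)
  next
    case (Dir j)
    have "((\<lambda>s. init x 0 \<xi> + s * init (u j) 0 \<xi>) has_real_derivative init (u j) 0 \<xi>) (at 0)"
      by (auto intro!: derivative_eq_intros)
    then show ?thesis
      using c E.carrier_closed by (simp add: Dir init_lincomb[OF c(1) E.carrier_closed(4)[OF c(2)]] init_lincomb(3)[OF c(2) c(2)])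
  qed
  have \<alpha>e: "coef (?x s) [] \<tau> (?p s + \<tau>) v -
      coef (?x 0) [] \<tau> (?p 0 + \<tau>) v = s * \<alpha> s \<tau> v" if "\<tau> \<in> I" for s \<tau> v
  proof (cases \<delta>)
    case Shift
    have "continuous_on UNIV (\<lambda>\<eta>. coef x [Space] \<tau> \<eta> v)"
      by (rule continuous_on_compose_triple[OF coef_continuous[OF c(1)]]) (use that in auto)
    from integral_mean_value[OF coef_derivative_Space[OF c(1) that, of "[]" v] this, of "\<xi> + \<tau> + s" "\<xi> + \<tau>"]
    show ?thesis by (simp add: Shift \<alpha>_def algebra_simps)
  next
    case (Dir j)
    then show ?thesis
      using coef_lincomb(1)[OF c(1) E.carrier_closed(4)[OF c(2)] that] coef_lincomb(3)[OF c(2) c(2) that]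
      by (simp add: \<alpha>_def)
  qed
  have "((\<lambda>s. flow (?x s) t (?p s)) has_real_derivative
    exp (integral {0..t} (\<lambda>\<tau>. coef x [Value] \<tau> (\<xi> + \<tau>) (flow (?x 0) \<tau> (?p 0)))) *
      (ev (dinit \<delta> None 0) x u t \<xi> + integral {0..t} (\<lambda>\<tau>. exp (- integral {0..\<tau>}
        (\<lambda>\<sigma>. coef x [Value] \<sigma> (\<xi> + \<sigma>) (flow (?x 0) \<sigma> (?p 0)))) *
          \<alpha> 0 \<tau> (flow (?x 0) \<tau> (?p 0))))) (at 0)"
  proof (rule ode_parameter_derivative[where J = J and z = "\<lambda>s t. flow (?x s) t (?p s)" and
        g = "\<lambda>s \<tau> v. coef (?x s) [] \<tau> (?p s + \<tau>) v" and
        \<alpha> = \<alpha> and \<gamma> = "\<lambda>\<tau> v. coef x [Value] \<tau> (\<xi> + \<tau>) v", OF _ _ _ _ _ _ _ \<alpha>c \<alpha>e ai assms(2)])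
    show "open J" "0 \<in> J" using r(1) by (auto simp: J_def)
    show "continuous_on (J \<times> I) (\<lambda>(s, t). flow (?x s) t (?p s))"
      using r(3)[of Sol] by (simp add: J_def)
    show "flow (?x s) t (?p s) = init (?x s) 0 (?p s) +
      integral {0..t} (\<lambda>\<tau>. coef (?x s) [] \<tau> (?p s + \<tau>) (flow (?x s) \<tau> (?p s)))"
      if "s \<in> J" "t \<in> I" for s t
      using flow_eq[OF goodD(1)[OF g]] that by (simp add: J_def)
    show "continuous_on (I \<times> UNIV) (\<lambda>(t, v). coef (?x 0) [] t (?p 0 + t) v)"
      "continuous_on (I \<times> UNIV) (\<lambda>(t, v). coef x [Value] t (\<xi> + t) v)"
      unfolding case_prod_beta moved_0
      by (intro continuous_on_compose_triple[OF coef_continuous[OF c(1)]] continuous_intros; auto)+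
    show "(coef (?x 0) [] t (?p 0 + t) has_real_derivative coef x [Value] t (\<xi> + t) v) (at v)"
      if "t \<in> I" for t v
      using coef_derivative_Value[OF c(1) that] by simp
  qed
  moreover have "ev (dinit \<delta> None 0) x u t \<xi> = ev (dinit \<delta> None 0) x u t' \<xi>" for t'
    by (cases \<delta>) auto
  ultimately show ?thesis by (simp add: \<alpha>0 dsol_def Let_def)
qed

lemma coef_chain:
  assumes "x \<in> carrier" "t \<in> I"
    and "(a has_real_derivative a') (at s)" "(b has_real_derivative b') (at s)"
  shows "((\<lambda>s. coef x ks t (a s) (b s)) has_real_derivative
    coef x (Space # ks) t (a s) (b s) * a' + coef x (Value # ks) t (a s) (b s) * b') (at s)"
proof -
  have "((\<lambda>p. coef x ks t (fst p) (snd p)) has_derivative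
      (\<lambda>h. coef x (Space # ks) t (a s) (b s) * fst h + coef x (Value # ks) t (a s) (b s) * snd h)) (at (a s, b s))"
  proof (rule has_derivative_two_variables[of UNIV])
    show "((\<lambda>\<eta>. coef x ks t \<eta> (b s)) has_derivative (\<lambda>h. coef x (Space # ks) t (a s) (b s) * h)) (at (a s))"
      using coef_derivative_Space[OF assms(1,2)] by (simp add: has_field_derivative_def)
    show "(coef x ks t y has_real_derivative coef x (Value # ks) t y w) (at w)" for y w
      using coef_derivative_Value[OF assms(1,2)] .
    show "continuous_on (UNIV \<times> UNIV) (\<lambda>(\<eta>, v). coef x (Value # ks) t \<eta> v)"
      unfolding case_prod_beta
      by (intro continuous_on_compose_triple[OF coef_continuous[OF assms(1)]] continuous_intros) (use assms in auto)
  qed auto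
  moreover have "((\<lambda>s. (a s, b s)) has_derivative (\<lambda>h. (a' * h, b' * h))) (at s)"
    using assms(3,4) by (intro has_derivative_Pair) (simp_all add: has_field_derivative_def)
  ultimately have "((\<lambda>s. coef x ks t (a s) (b s)) has_derivative
      (\<lambda>h. coef x (Space # ks) t (a s) (b s) * (a' * h) + coef x (Value # ks) t (a s) (b s) * (b' * h))) (at s)"
    using diff_chain_at[of "\<lambda>s. (a s, b s)"] by (fastforce simp: o_def)
  then show ?thesis
    unfolding has_field_derivative_def
    by (rule has_derivative_eq_rhs) (auto simp: algebra_simps)
qed

text \<open>The induction is general in the datum and in \<xi> because differentiating an integral
  requires the derivative of its integrand at all nearby parameters. By \<open>moved_add\<close>
  these are derivatives at 0 of a moved datum and point.\<close>

lemma dv_derivative: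
  assumes "good x u" "t \<in> I"
  shows "((\<lambda>s. ev e (moved_datum \<delta> x u s) u t (moved_point \<delta> \<xi> s)) has_real_derivative ev (dv \<delta> e) x u t \<xi>) (at 0)"
  using assms
proof (induction e arbitrary: x t \<xi>)
  case Sol
  then show ?case using dsol_derivative by simp
next
  case (Init i m)
  note c = goodD(2-4)[OF Init(1)]
  show ?case
  proof (cases \<delta>)
    case Shift
    then show ?thesis
      using DERIV_shift[of "init (case_option x u i) m" "init (case_option x u i) (Suc m) \<xi>" 0 \<xi>]
        init_derivative[OF c(3), of i m \<xi>] by (simp add: add.commute)
  next
    case (Dir j)
    show ?thesis
    proof (cases i)
      case None
      have "((\<lambda>s. init x m \<xi> + s * init (u j) m \<xi>) has_real_derivative init (u j) m \<xi>) (at 0)"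
        by (auto intro!: derivative_eq_intros)
      then show ?thesis
        by (simp add: Dir None init_lincomb(1)[OF c(1) E.carrier_closed(4)[OF c(2)]] init_lincomb(3)[OF c(2) c(2)])
    qed (simp add: Dir)
  qed
next
  case (Coef i ks)
  note c = goodD(2-4)[OF Coef(1)]
  let ?z = "\<lambda>s. flow (moved_datum \<delta> x u s) t (moved_point \<delta> \<xi> s)"
  have z: "(?z has_real_derivative ev (dsol \<delta>) x u t \<xi>) (at 0)" using dsol_derivative[OF Coef] .
  show ?case
  proof (cases \<delta>)
    case Shift
    have "((\<lambda>s. coef (case_option x u i) ks t (\<xi> + s + t) (?z s)) has_real_derivative
      coef (case_option x u i) (Space # ks) t (\<xi> + 0 + t) (?z 0) * 1 +
      coef (case_option x u i) (Value # ks) t (\<xi> + 0 + t) (?z 0) * ev (dsol \<delta>) x u t \<xi>) (at 0)"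
      by (rule coef_chain[OF c(3) Coef(2) _ z]) (auto intro!: derivative_eq_intros)
    then show ?thesis by (simp add: Shift)
  next
    case (Dir j)
    have chain: "((\<lambda>s. coef d ks t (\<xi> + t) (?z s)) has_real_derivative
        coef d (Value # ks) t (\<xi> + t) (?z 0) * ev (dsol \<delta>) x u t \<xi>) (at 0)" if "d \<in> carrier" for d
      by (rule DERIV_cong[OF coef_chain[OF that Coef(2) DERIV_const z]]) simp
    show ?thesis
    proof (cases i)
      case None
      \<comment> \<open>Linearity in the datum separates the two ways in which \<open>s\<close>
        enters; the final factor \<open>0\<close> is the value of \<open>s\<close> in the product
        rule.\<close>
      have "((\<lambda>s. coef x ks t (\<xi> + t) (?z s) + s * coef (u j) ks t (\<xi> + t) (?z s)) has_real_derivative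
          coef x (Value # ks) t (\<xi> + t) (?z 0) * ev (dsol \<delta>) x u t \<xi> +
          (1 * coef (u j) ks t (\<xi> + t) (?z 0) + coef (u j) (Value # ks) t (\<xi> + t) (?z 0) * ev (dsol \<delta>) x u t \<xi> * 0)) (at 0)"
        by (intro DERIV_add DERIV_mult DERIV_ident chain c)
      then show ?thesis
        by (simp add: Dir None coef_lincomb(1)[OF c(1) E.carrier_closed(4)[OF c(2)] Coef(2)]
            coef_lincomb(3)[OF c(2) c(2) Coef(2)] add.commute)
    next
      case (Some k)
      then show ?thesis using chain[OF c(2)[of k]] by (simp add: Dir)
    qed
  qed
next
  case (Integ a)
  obtain r where r: "r > 0" "\<And>s. \<bar>s\<bar> < r \<Longrightarrow> good (moved_datum \<delta> x u s) u"
    "\<And>e \<xi>. continuous_on ({- r<..<r} \<times> I) (\<lambda>(s, t). ev e (moved_datum \<delta> x u s) u t (moved_point \<delta> \<xi> s))"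
    by (rule moved_continuous[OF Integ(2)]) blast
  let ?f = "\<lambda>e s \<tau>. ev e (moved_datum \<delta> x u s) u \<tau> (moved_point \<delta> \<xi> s)"
  have sub: "{- r<..<r} \<times> cbox 0 t \<subseteq> {- r<..<r} \<times> I" using Integ(3) by auto
  have "((\<lambda>s. integral (cbox 0 t) (?f a s)) has_real_derivative integral (cbox 0 t) (?f (dv \<delta> a) 0)) (at 0 within {- r<..<r})"
  proof (rule leibniz_rule_field_derivative)
    fix s \<tau> assume s: "s \<in> {- r<..<r}" and \<tau>: "\<tau> \<in> cbox 0 t"
    have g: "good (moved_datum \<delta> x u s) u" using r(2)[of s] s by auto
    have "\<tau> \<in> I" using \<tau> Integ(3) by auto
    from Integ.IH[OF g this, of "moved_point \<delta> \<xi> s"]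
    have "((\<lambda>h. ?f a (h + s) \<tau>) has_real_derivative ?f (dv \<delta> a) s \<tau>) (at 0)"
      by (simp add: moved_add add.commute)
    then have "((\<lambda>s. ?f a s \<tau>) has_real_derivative ?f (dv \<delta> a) s \<tau>) (at s)"
      using DERIV_shift[of "\<lambda>s. ?f a s \<tau>" "?f (dv \<delta> a) s \<tau>" 0 s] by simp
    then show "((\<lambda>s. ?f a s \<tau>) has_real_derivative ?f (dv \<delta> a) s \<tau>) (at s within {- r<..<r})"
      by (rule has_field_derivative_at_within)
  next
    fix s assume "s \<in> {- r<..<r}"
    then show "?f a s integrable_on cbox 0 t"
      using ev_integrable[OF r(2)[of s] Integ(3)] by auto
  qed (use r(1) continuous_on_subset[OF r(3) sub] in auto)
  moreover have "at 0 within {- r<..<r} = at (0 :: real)"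
    using r(1) by (intro at_within_open) auto
  ultimately have "((\<lambda>s. integral {0..t} (?f a s)) has_real_derivative integral {0..t} (?f (dv \<delta> a) 0)) (at 0)"
    by simp
  then show ?case by simp
qed (auto intro!: derivative_eq_intros)

lemma dv_derivative_at:
  assumes "good (moved_datum \<delta> x u s) u" "t \<in> I"
  shows "((\<lambda>s. ev e (moved_datum \<delta> x u s) u t (moved_point \<delta> \<xi> s)) has_real_derivative
    ev (dv \<delta> e) (moved_datum \<delta> x u s) u t (moved_point \<delta> \<xi> s)) (at s)"
  using dv_derivative[OF assms, of e \<delta> "moved_point \<delta> \<xi> s"]
    DERIV_shift[of "\<lambda>s. ev e (moved_datum \<delta> x u s) u t (moved_point \<delta> \<xi> s)" _ 0 s]
  by (simp add: moved_add add.commute)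

lemma flow_derivative:
  assumes "good x u" "t \<in> {0<..<T}"
  shows "((\<lambda>t. flow x t \<xi>) has_real_derivative coef x [] t (\<xi> + t) (flow x t \<xi>)) (at t)"
proof -
  note c = goodD(1,2)[OF assms(1)]
  have t: "t \<in> I" using assms by auto
  have "continuous_on I (\<lambda>\<tau>. ev (Coef None []) x u \<tau> \<xi>)" using ev_continuous_slice[OF assms(1)] .
  from integral_upto_has_derivative[OF this t]
  have "((\<lambda>t. integral {0..t} (\<lambda>\<tau>. coef x [] \<tau> (\<xi> + \<tau>) (flow x \<tau> \<xi>))) has_real_derivative
      coef x [] t (\<xi> + t) (flow x t \<xi>)) (at t)"
    using assms(2) by (simp add: at_within_Icc_at)
  then have "((\<lambda>t. init x 0 \<xi> + integral {0..t} (\<lambda>\<tau>. coef x [] \<tau> (\<xi> + \<tau>) (flow x \<tau> \<xi>))) has_real_derivative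
      coef x [] t (\<xi> + t) (flow x t \<xi>)) (at t)"
    by (auto intro!: derivative_eq_intros)
  then show ?thesis
    by (rule has_field_derivative_transform_within_open[of _ _ _ "{0<..<T}"])
      (use assms flow_eq[OF c(1)] in auto)
qed

lemma dc_derivative:
  assumes "good x u" "t \<in> {0<..<T}"
  shows "((\<lambda>t. ev e x u t \<xi>) has_real_derivative ev (dc e) x u t \<xi>) (at t)"
proof (induction e)
  case Sol
  then show ?case using flow_derivative[OF assms] by simp
next
  case (Coef i ks)
  let ?d = "case_option x u i"
  note d = goodD(4)[OF assms(1), of i]
  have t: "t \<in> I" using assms by auto
  have z: "((\<lambda>t. flow x t \<xi>) has_real_derivative coef x [] t (\<xi> + t) (flow x t \<xi>)) (at t)"
    using flow_derivative[OF assms] .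
  \<comment> \<open>Differentiability in time, space and value is built by adjoining one variable at
    a time, each with a continuous partial derivative. Time comes first, where only the derivative
    at the point is required.\<close>
  have 1: "((\<lambda>p. coef ?d ks (fst p) (snd p) v) has_derivative
      (\<lambda>h. coef ?d (Time # ks) t \<eta> v * fst h + coef ?d (Space # ks) t \<eta> v * snd h)) (at (t, \<eta>))" for \<eta> v
  proof (rule has_derivative_two_variables[of "{0<..<T}"])
    show "((\<lambda>t. coef ?d ks t \<eta> v) has_derivative (\<lambda>h. coef ?d (Time # ks) t \<eta> v * h)) (at t)"
      using coef_derivative_Time[OF d assms(2)] by (simp add: has_field_derivative_def)
    show "((\<lambda>\<eta>. coef ?d ks y \<eta> v) has_real_derivative coef ?d (Space # ks) y w v) (at w)"
      if "y \<in> {0<..<T}" for y w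
      using coef_derivative_Space[OF d] that by auto
    show "continuous_on ({0<..<T} \<times> UNIV) (\<lambda>(t, \<eta>). coef ?d (Space # ks) t \<eta> v)"
      unfolding case_prod_beta
      by (intro continuous_on_compose_triple[OF coef_continuous[OF d]] continuous_intros) auto
  qed (use assms in auto)
  have 2: "((\<lambda>p. coef ?d ks (fst (fst p)) (snd (fst p)) (snd p)) has_derivative
      (\<lambda>h. (coef ?d (Time # ks) t \<eta> v * fst (fst h) + coef ?d (Space # ks) t \<eta> v * snd (fst h)) +
        coef ?d (Value # ks) t \<eta> v * snd h)) (at ((t, \<eta>), v))" for \<eta> v
  proof -
    have "continuous_on (({0<..<T} \<times> UNIV) \<times> UNIV) (\<lambda>(p, v). coef ?d (Value # ks) (fst p) (snd p) v)"
      unfolding case_prod_beta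
      by (intro continuous_on_compose_triple[OF coef_continuous[OF d]] continuous_intros) auto
    then show ?thesis
      using has_derivative_two_variables[of "{0<..<T} \<times> UNIV" "(t, \<eta>)" "\<lambda>p v. coef ?d ks (fst p) (snd p) v" v _
        "\<lambda>p v. coef ?d (Value # ks) (fst p) (snd p) v", OF _ _ 1] assms coef_derivative_Value[OF d]
      by (auto simp: open_Times)
  qed
  have "((\<lambda>t. ((t, \<xi> + t), flow x t \<xi>)) has_derivative (\<lambda>h. ((h, h), coef x [] t (\<xi> + t) (flow x t \<xi>) * h))) (at t)"
    using z by (auto intro!: derivative_eq_intros simp: has_field_derivative_def)
  from diff_chain_at[OF this 2]
  have "((\<lambda>t. coef ?d ks t (\<xi> + t) (flow x t \<xi>)) has_derivative
     (\<lambda>h. (coef ?d (Time # ks) t (\<xi> + t) (flow x t \<xi>) * h + coef ?d (Space # ks) t (\<xi> + t) (flow x t \<xi>) * h) +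
        coef ?d (Value # ks) t (\<xi> + t) (flow x t \<xi>) * (coef x [] t (\<xi> + t) (flow x t \<xi>) * h))) (at t)"
    by (simp add: o_def)
  then show ?case
    unfolding has_field_derivative_def ev.simps dc.simps
    by (rule has_derivative_eq_rhs) (auto simp: algebra_simps)
next
  case (Integ a)
  have t: "t \<in> I" using assms by auto
  from integral_upto_has_derivative[OF ev_continuous_slice[OF assms(1)] t, of a \<xi>]
  show ?case using assms(2) by (simp add: at_within_Icc_at)
qed (auto intro!: derivative_eq_intros)

end

context time_interval
begin

section \<open>Smoothness of the solutions\<close>

text \<open>Returns from characteristic coordinates to the original ones by \<xi> = \<eta> -
  \<open>t\<close>, and vanishes off the strip as elements of \<open>C_on\<close> must.\<close>

definition Fn :: "expr \<Rightarrow> datum \<Rightarrow> (nat \<Rightarrow> datum) \<Rightarrow> real \<times> real \<Rightarrow> real" where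
  "Fn e x u p = (if fst p \<in> I then ev e x u (fst p) (snd p - fst p) else 0)"

text \<open>The time derivative is the one along characteristics minus the space derivative.\<close>

definition pd :: "real \<times> real \<Rightarrow> expr \<Rightarrow> expr" where
  "pd b e = (if b = (0, 1) then dv Shift e else Plus (dc e) (Times (Const (- 1)) (dv Shift e)))"

primrec pds :: "(real \<times> real) list \<Rightarrow> expr \<Rightarrow> expr" where
  "pds [] e = e"
| "pds (b # bs) e = pd b (pds bs e)"

lemma interior_strip: "interior (I \<times> (UNIV :: real set)) = {0<..<T} \<times> UNIV"
  by (simp add: interior_Times)

lemma Fn_continuous:
  assumes "good x u" shows "continuous_on (I \<times> UNIV) (Fn e x u)"
proof -
  have "continuous_on (I \<times> UNIV) (\<lambda>p. ev e x u (fst p) (snd p - fst p))"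
    by (intro continuous_on_compose_pair[OF ev_continuous[OF assms]] continuous_intros) auto
  then show ?thesis by (rule continuous_on_eq) (auto simp: Fn_def)
qed

lemma space_derivative:
  assumes "good x u" "t \<in> I"
  shows "((\<lambda>\<xi>. ev e x u t \<xi>) has_real_derivative ev (dv Shift e) x u t \<xi>) (at \<xi>)"
  using dv_derivative[OF assms, of e Shift \<xi>] DERIV_shift[of "ev e x u t" "ev (dv Shift e) x u t \<xi>" 0 \<xi>]
  by (simp add: add.commute)

lemma Fn_partial:
  assumes g: "good x u" and p: "p \<in> interior (I \<times> UNIV)" and b: "b \<in> Basis"
  shows "((\<lambda>s. Fn e x u (p + s *\<^sub>R b)) has_real_derivative Fn (pd b e) x u p) (at 0)"
proof -
  obtain t \<eta> where pt: "p = (t, \<eta>)" by fastforce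
  have t: "t \<in> {0<..<T}" "t \<in> I" using p by (auto simp: pt interior_strip)
  consider "b = (0, 1)" | "b = (1, 0)" using b by (auto simp: Basis_prod_def)
  then show ?thesis
  proof cases
    case 1
    have "((\<lambda>s. ev e x u t (\<eta> - t + s)) has_real_derivative ev (dv Shift e) x u t (\<eta> - t)) (at 0)"
      using dv_derivative[OF g t(2), of e Shift "\<eta> - t"] by simp
    then show ?thesis using t(2) by (simp add: 1 pt Fn_def pd_def algebra_simps)
  next
    case 2
    have "((\<lambda>p. ev e x u (fst p) (snd p)) has_derivative
        (\<lambda>h. ev (dc e) x u t (\<eta> - t) * fst h + ev (dv Shift e) x u t (\<eta> - t) * snd h)) (at (t, \<eta> - t))"
    proof (rule has_derivative_two_variables[of "{0<..<T}"])
      show "((\<lambda>t. ev e x u t (\<eta> - t')) has_derivative (\<lambda>h. ev (dc e) x u t (\<eta> - t') * h)) (at t)" for t'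
        using dc_derivative[OF g t(1)] by (simp add: has_field_derivative_def)
      show "(ev e x u y has_real_derivative ev (dv Shift e) x u y w) (at w)" if "y \<in> {0<..<T}" for y w
        using space_derivative[OF g] that by auto
      show "continuous_on ({0<..<T} \<times> UNIV) (\<lambda>(t, \<xi>). ev (dv Shift e) x u t \<xi>)"
        by (rule continuous_on_subset[OF ev_continuous[OF g]]) auto
    qed (use t in auto)
    then have "((\<lambda>p. ev e x u (fst p) (snd p)) has_derivative
        (\<lambda>h. ev (dc e) x u t (\<eta> - t) * fst h + ev (dv Shift e) x u t (\<eta> - t) * snd h)) (at (t + 0, \<eta> - t - 0))"
      by simp
    \<comment> \<open>Advancing time at fixed \<eta> moves \<xi> backwards, which produces the minus
      sign in \<open>pd\<close>.\<close>
    moreover have "((\<lambda>s. (t + s, \<eta> - t - s)) has_derivative (\<lambda>h. (h, - h))) (at 0)"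
      by (auto intro!: derivative_eq_intros)
    ultimately have "((\<lambda>s. ev e x u (t + s) (\<eta> - t - s)) has_derivative
        (\<lambda>h. ev (dc e) x u t (\<eta> - t) * h + ev (dv Shift e) x u t (\<eta> - t) * (- h))) (at 0)"
      using diff_chain_at[of "\<lambda>s. (t + s, \<eta> - t - s)"] by (fastforce simp: o_def)
    then have "((\<lambda>s. ev e x u (t + s) (\<eta> - t - s)) has_real_derivative Fn (pd b e) x u p) (at 0)"
      unfolding has_field_derivative_def
      by (rule has_derivative_eq_rhs) (use t(2) in \<open>auto simp: Fn_def pd_def 2 pt algebra_simps\<close>)
    then show ?thesis
    proof (rule has_field_derivative_transform_within_open[of _ _ _ "{- t<..<T - t}"])
      show "ev e x u (t + s) (\<eta> - t - s) = Fn e x u (p + s *\<^sub>R b)" if "s \<in> {- t<..<T - t}" for s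
        using that by (simp add: Fn_def 2 pt algebra_simps)
    qed (use t in auto)
  qed
qed

lemma partial_Fn:
  assumes "good x u" "set bs \<subseteq> Basis" "p \<in> interior (I \<times> UNIV)"
  shows "partial bs (Fn e x u) p = Fn (pds bs e) x u p"
  using assms(2,3)
proof (induction bs arbitrary: p)
  case (Cons b bs)
  show ?case
    by (rule partial_Cons_eqI(2)[of "interior (I \<times> UNIV)", OF _ _ Cons.IH])
      (use Cons.prems Fn_partial[OF assms(1) Cons.prems(2)] in auto)
qed simp

section \<open>Expressions as elements of the target space\<close>

lemma Fn_C_infinity:
  assumes "good x u" shows "Fn e x u \<in> C_on \<infinity> (I \<times> UNIV)"
  unfolding C_on_def
proof (intro CollectI conjI allI impI ballI)
  fix b p :: "real \<times> real" and bs
  assume b: "set (b # bs) \<subseteq> Basis \<and> enat (length (b # bs)) < \<infinity> + 1" and p: "p \<in> interior (I \<times> (UNIV :: real set))"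
  have "((\<lambda>t. partial bs (Fn e x u) (p + t *\<^sub>R b)) has_real_derivative Fn (pd b (pds bs e)) x u p) (at 0)"
    by (rule partial_Cons_eqI(1)[of "interior (I \<times> UNIV)", OF _ p partial_Fn[OF assms]])
      (use b Fn_partial[OF assms p] in auto)
  then show "(\<lambda>t. partial bs (Fn e x u) (p + t *\<^sub>R b)) field_differentiable at 0"
    unfolding field_differentiable_def by blast
next
  fix bs :: "(real \<times> real) list" assume "set bs \<subseteq> Basis \<and> enat (length bs) < \<infinity> + 1"
  then show "\<exists>g. continuous_on (I \<times> UNIV) g \<and> (\<forall>p \<in> interior (I \<times> UNIV). g p = partial bs (Fn e x u) p)"
    using partial_Fn[OF assms] Fn_continuous[OF assms] by (intro exI[of _ "Fn (pds bs e) x u"]) simp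
qed (use Fn_continuous[OF assms] in \<open>auto simp: Fn_def\<close>)

text \<open>Derivatives up to the boundary are again expressions, so convergence in the target is
  uniform convergence of finitely many expressions for each seminorm.\<close>

lemma ext_partial_Fn:
  assumes "good x u" "set bs \<subseteq> Basis" "p \<in> I \<times> UNIV"
  shows "ext_partial (I \<times> UNIV) bs (Fn e x u) p = Fn (pds bs e) x u p"
  using assms by (intro strip.ext_partial_eqI Fn_continuous partial_Fn)

lemma topspace_F: "topspace (F_space \<infinity> T) = {f \<in> C_on \<infinity> (I \<times> UNIV). \<forall>p. f (p + (0, 1)) = f p}"
  unfolding F_space_def by (rule strip.topspace_C_periodic)

lemma Fn_periodic: "good x u \<Longrightarrow> Fn e x u (p + (0, 1)) = Fn e x u p"
  using ev_periodic[of x u "fst p" e "snd p - fst p"] by (simp add: Fn_def algebra_simps)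

lemma Fn_F: "good x u \<Longrightarrow> Fn e x u \<in> topspace (F_space \<infinity> T)"
  unfolding topspace_F using Fn_C_infinity Fn_periodic by blast

lemma Fn_diff_seminorm_le:
  assumes g: "good x u" "good x' u'" and "c \<ge> 0"
    and le: "\<And>bs t \<xi>. \<lbrakk>set bs \<subseteq> Basis; length bs \<le> n; t \<in> I\<rbrakk> \<Longrightarrow>
      \<bar>ev (pds bs e) x u t \<xi> - ev (pds bs e) x' u' t \<xi>\<bar> \<le> c"
  shows "strip.C_seminorm n (Fn e x u - Fn e x' u') \<le> c"
proof (rule strip.C_seminorm_le[OF assms(3)])
  fix bs :: "(real \<times> real) list" and p :: "real \<times> real"
  assume A: "set bs \<subseteq> Basis" "length bs \<le> n" "p \<in> I \<times> UNIV"
  then have "fst p \<in> I" by auto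
  then show "\<bar>ext_partial (I \<times> UNIV) bs (Fn e x u - Fn e x' u') p\<bar> \<le> c"
    unfolding strip.ext_partial_diff[OF Fn_C_infinity[OF g(1)] A(1,3) Fn_C_infinity[OF g(2)]]
      ext_partial_Fn[OF g(1) A(1,3)] ext_partial_Fn[OF g(2) A(1,3)]
    using le[OF A(1,2)] by (simp add: Fn_def)
qed

section \<open>The solution relation as the graph of an expression\<close>

lemma C_on_antimono: "C_on \<infinity> D \<subseteq> C_on 1 D"
  unfolding C_on_def by auto

lemma topspace_F_1: "topspace (F_space 1 T) = {f \<in> C_on 1 (I \<times> UNIV). \<forall>p. f (p + (0, 1)) = f p}"
  by (auto simp: F_space_def C_periodic_def topspace_C_topology)

text \<open>The directions are fixed while the datum varies; \<open>dir_deriv\<close> then maps such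
  graphs to such graphs, which makes it possible to iterate.\<close>

definition graph :: "expr \<Rightarrow> (nat \<Rightarrow> datum) \<Rightarrow> (datum \<times> (real \<times> real \<Rightarrow> real)) set" where
  "graph e u = (\<lambda>x. (x, Fn e x u)) ` solvable"

lemma Domain_graph: "Domain (graph e u) = solvable"
  by (auto simp: graph_def)

lemma graph_app_graph: "x \<in> solvable \<Longrightarrow> graph_app (graph e u) x = Fn e x u"
  unfolding graph_app_def by (rule the_equality) (auto simp: graph_def)

text \<open>Regularity is gained here: read along characteristics, a \<open>C_on 1\<close> solution
  is a flow, and by uniqueness it is the smooth function \<open>Fn Sol\<close>. The list
  \<open>u\<close> is arbitrary because \<open>Sol\<close> mentions no direction.\<close>

lemma solution_graph_eq: "solution_graph T = graph Sol u"
proof (intro equalityI subsetI)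
  fix q assume "q \<in> solution_graph T"
  then obtain y0 \<phi> y where q: "q = ((y0, \<phi>), y)" and x: "(y0, \<phi>) \<in> carrier" and y: "y \<in> C_on 1 (I \<times> UNIV)"
    and eq: "\<And>t \<eta>. t \<in> I \<Longrightarrow> y (t, \<eta>) = y0 (\<eta> - t) + integral {0..t} (\<lambda>\<tau>. \<phi> (\<tau>, \<eta> - t + \<tau>, y (\<tau>, \<eta> - t + \<tau>)))"
    by (auto simp: solution_graph_def topspace_F_1)
  define z where "z t \<xi> = y (t, \<xi> + t)" for t \<xi>
  have yc: "continuous_on (I \<times> UNIV) (\<lambda>(t, \<eta>). y (t, \<eta>))" using y by (simp add: C_on_def)
  have z: "is_flow (y0, \<phi>) z"
    unfolding is_flow_def
  proof (intro conjI ballI allI)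
    show "continuous_on (I \<times> UNIV) (\<lambda>(t, \<xi>). z t \<xi>)"
      unfolding z_def case_prod_beta
      by (rule continuous_on_compose_pair[OF yc]) (auto intro!: continuous_intros)
    fix t \<xi> assume t: "t \<in> I"
    have "integral {0..t} (\<lambda>\<tau>. \<phi> (\<tau>, \<xi> + \<tau>, z \<tau> \<xi>)) = integral {0..t} (\<lambda>\<tau>. coef (y0, \<phi>) [] \<tau> (\<xi> + \<tau>) (z \<tau> \<xi>))"
      using t by (intro integral_cong) (simp add: coef_Nil[OF x])
    then show "z t \<xi> = init (y0, \<phi>) 0 \<xi> + integral {0..t} (\<lambda>\<tau>. coef (y0, \<phi>) [] \<tau> (\<xi> + \<tau>) (z \<tau> \<xi>))"
      using eq[OF t, of "\<xi> + t"] by (simp add: z_def init_0[OF x])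
  qed
  have "y p = Fn Sol (y0, \<phi>) u p" for p
    using is_flow_unique[OF x z, of "fst p" "snd p - fst p"] y
    by (cases p) (auto simp: Fn_def z_def C_on_def)
  then have "y = Fn Sol (y0, \<phi>) u" by (rule ext)
  with x z show "q \<in> graph Sol u"
    unfolding q graph_def solvable_def by blast
next
  fix q assume "q \<in> graph Sol u"
  then obtain x where q: "q = (x, Fn Sol x u)" and x: "x \<in> solvable" by (auto simp: graph_def)
  have xc: "x \<in> carrier" using x solvable_carrier by blast
  have g: "good x (\<lambda>_. 0)" using x E.carrier_closed(1) by (auto simp: good_def)
  have e: "Fn Sol x u = Fn Sol x (\<lambda>_. 0)" by (auto simp: Fn_def)
  have "Fn Sol x u \<in> topspace (F_space 1 T)"
    using Fn_C_infinity[OF g, of Sol] Fn_periodic[OF g, of Sol] C_on_antimono unfolding topspace_F_1 e by blast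
  moreover have "Fn Sol x u (t, \<eta>) = fst x (\<eta> - t) + integral {0..t} (\<lambda>\<tau>. snd x (\<tau>, \<eta> - t + \<tau>, Fn Sol x u (\<tau>, \<eta> - t + \<tau>)))"
    if t: "t \<in> I" for t \<eta>
  proof -
    have "integral {0..t} (\<lambda>\<tau>. snd x (\<tau>, \<eta> - t + \<tau>, Fn Sol x u (\<tau>, \<eta> - t + \<tau>))) =
        integral {0..t} (\<lambda>\<tau>. coef x [] \<tau> (\<eta> - t + \<tau>) (flow x \<tau> (\<eta> - t)))"
      using t by (intro integral_cong) (simp add: coef_Nil[OF xc] Fn_def)
    then show ?thesis
      using flow_eq[OF x t, of "\<eta> - t"] t by (simp add: Fn_def init_0[OF xc])
  qed
  ultimately show "q \<in> solution_graph T"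
    using xc by (cases x) (auto simp: solution_graph_def q)
qed

section \<open>Directional derivatives\<close>

lemma mean_value_zero:
  fixes f f' :: "real \<Rightarrow> real"
  assumes "\<And>r. \<bar>r\<bar> \<le> \<bar>s\<bar> \<Longrightarrow> (f has_real_derivative f' r) (at r)"
  obtains r where "\<bar>r\<bar> \<le> \<bar>s\<bar>" "f s - f 0 = s * f' r"
proof (cases s "0 :: real" rule: linorder_cases)
  case less
  then obtain r where "s < r" "r < 0" "f 0 - f s = (0 - s) * f' r"
    using MVT2[of s 0 f f'] assms by auto
  with less that[of r] show ?thesis by simp
next
  case greater
  then obtain r where "0 < r" "r < s" "f s - f 0 = (s - 0) * f' r"
    using MVT2[of 0 s f f'] assms by auto
  with greater that[of r] show ?thesis by simp
qed (use that[of 0] in simp)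

text \<open>By the mean value theorem the quotient is the derivative at an intermediate datum. That
  datum depends on the point of the strip, but it lies on a short segment where
  \<open>ev_uniform_limit\<close> gives one estimate for all points.\<close>

lemma difference_quotient_uniform:
  assumes "good x u" "\<epsilon> > 0"
  shows "\<forall>\<^sub>F s in at 0. good (x + s *\<^sub>R u j) u \<and> (\<forall>t \<in> I. \<forall>\<xi>.
    \<bar>inverse s * (ev e (x + s *\<^sub>R u j) u t \<xi> - ev e x u t \<xi>) - ev (dv (Dir j) e) x u t \<xi>\<bar> < \<epsilon>)"
proof -
  note filt = filterlim_env_line[OF goodD(2,5)[OF assms(1)], of j 0]
  have "good (x + 0 *\<^sub>R u j) u" using assms(1) by simp
  from eventually_compose_filterlim[OF eventually_conj[OF eventually_env_flow[OF this zero_less_one]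
      uniform_limitD[OF ev_uniform_limit[OF this, of "dv (Dir j) e"] assms(2)]] filt]
  obtain d where d: "d > 0" "\<And>s. \<bar>s\<bar> < d \<Longrightarrow> good (x + s *\<^sub>R u j) u"
    "\<And>s t \<xi>. \<bar>s\<bar> < d \<Longrightarrow> t \<in> I \<Longrightarrow> \<bar>ev (dv (Dir j) e) (x + s *\<^sub>R u j) u t \<xi> - ev (dv (Dir j) e) x u t \<xi>\<bar> < \<epsilon>"
    unfolding eventually_nhds_metric by (auto simp: dist_real_def)
  have "\<bar>inverse s * (ev e (x + s *\<^sub>R u j) u t \<xi> - ev e x u t \<xi>) - ev (dv (Dir j) e) x u t \<xi>\<bar> < \<epsilon>"
    if s: "s \<noteq> 0" "\<bar>s\<bar> < d" and t: "t \<in> I" for s t \<xi>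
  proof -
    have "((\<lambda>s. ev e (x + s *\<^sub>R u j) u t \<xi>) has_real_derivative ev (dv (Dir j) e) (x + r *\<^sub>R u j) u t \<xi>) (at r)"
      if "\<bar>r\<bar> \<le> \<bar>s\<bar>" for r
      using dv_derivative_at[of "Dir j" x u r t e \<xi>] d(2)[of r] that s t by simp
    then obtain r where r: "\<bar>r\<bar> \<le> \<bar>s\<bar>"
      "ev e (x + s *\<^sub>R u j) u t \<xi> - ev e (x + 0 *\<^sub>R u j) u t \<xi> = s * ev (dv (Dir j) e) (x + r *\<^sub>R u j) u t \<xi>"
      by (rule mean_value_zero)
    from r(2) s(1) have "inverse s * (ev e (x + s *\<^sub>R u j) u t \<xi> - ev e x u t \<xi>) = ev (dv (Dir j) e) (x + r *\<^sub>R u j) u t \<xi>"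
      by (simp add: mult.assoc[symmetric])
    then show ?thesis using d(3)[of r t \<xi>] r(1) s t by simp
  qed
  then show ?thesis
    unfolding eventually_at using d(1,2) by (intro exI[of _ d]) (auto simp: dist_real_def)
qed

text \<open>The two expressions differ as syntax, so equality of their values is proved
  analytically. Difference quotients in the data converge uniformly together with their partial
  derivatives along \<open>b\<close>, hence the limit may be differentiated term by term.\<close>

lemma pd_dv_commute:
  assumes g: "good x u" and p: "p \<in> interior (I \<times> UNIV)" and b: "b \<in> Basis"
  shows "Fn (pd b (dv (Dir j) e)) x u p = Fn (dv (Dir j) (pd b e)) x u p"
proof -
  obtain r where r: "r > 0" "\<And>s. \<bar>s\<bar> < r \<Longrightarrow> p + s *\<^sub>R b \<in> interior (I \<times> UNIV)"
  proof -
    have "((\<lambda>s. p + s *\<^sub>R b) \<longlongrightarrow> p + 0 *\<^sub>R b) (nhds 0)"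
      by (intro tendsto_intros filterlim_ident)
    then have "\<forall>\<^sub>F s in nhds 0. p + s *\<^sub>R b \<in> interior (I \<times> UNIV)"
      using p by (intro topological_tendstoD) auto
    then show ?thesis using that unfolding eventually_nhds_metric by (auto simp: dist_real_def)
  qed
  have fst_I: "fst (p + s *\<^sub>R b) \<in> I" if "\<bar>s\<bar> < r" for s
    using r(2)[OF that] by (simp add: interior_strip mem_Times_iff)
  obtain d where d: "d > 0" "\<And>s. \<bar>s\<bar> < d \<Longrightarrow> good (x + s *\<^sub>R u j) u"
    by (rule moved_continuous[OF g, of "Dir j"]) auto
  \<comment> \<open>With \<open>n + 2\<close> in the denominator already the first term is strictly
    smaller than \<open>d\<close>.\<close>
  define \<sigma> where "\<sigma> n = d / real (n + 2)" for n
  have \<sigma>: "\<sigma> n \<noteq> 0" "good (x + \<sigma> n *\<^sub>R u j) u" for n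
    using d(1) by (auto simp: \<sigma>_def field_simps intro!: d(2) add_pos_nonneg)
  have "\<sigma> \<longlonglongrightarrow> 0"
    unfolding \<sigma>_def by (rule LIMSEQ_ignore_initial_segment) (rule lim_const_over_n)
  then have \<sigma>0: "filterlim \<sigma> (at 0) sequentially"
    using \<sigma>(1) by (auto simp: filterlim_at)
  \<comment> \<open>The derivative of the quotient for \<open>e\<close> along \<open>b\<close> is
    the quotient for \<open>pd b e\<close>, so \<open>lim\<close> below covers both
    convergences.\<close>
  define Q where "Q e n y = inverse (\<sigma> n) * (Fn e (x + \<sigma> n *\<^sub>R u j) u y - Fn e x u y)" for e n y
  have lim: "\<forall>\<^sub>F n in sequentially. \<forall>s. \<bar>s\<bar> < r \<longrightarrow> \<bar>Q e n (p + s *\<^sub>R b) - Fn (dv (Dir j) e) x u (p + s *\<^sub>R b)\<bar> < \<epsilon>"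
    if "\<epsilon> > 0" for e \<epsilon>
    using eventually_compose_filterlim[OF difference_quotient_uniform[OF g that, of j e] \<sigma>0]
    by (rule eventually_mono) (use fst_I in \<open>simp add: Q_def Fn_def\<close>)
  have pt: "(\<lambda>n. Q e n (p + s *\<^sub>R b)) \<longlonglongrightarrow> Fn (dv (Dir j) e) x u (p + s *\<^sub>R b)" if "\<bar>s\<bar> < r" for s
    by (rule tendstoI, rule eventually_mono[OF lim]) (use that in \<open>auto simp: dist_real_def\<close>)
  have "\<exists>h. \<forall>s\<in>{- r<..<r}. (\<lambda>n. Q e n (p + s *\<^sub>R b)) \<longlonglongrightarrow> h s \<and>
      (h has_derivative (\<lambda>k. Fn (dv (Dir j) (pd b e)) x u (p + s *\<^sub>R b) * k)) (at s within {- r<..<r})"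
  proof (rule has_derivative_sequence)
    fix n s assume s: "s \<in> {- r<..<r}"
    have dF: "((\<lambda>s. Fn e y u (p + s *\<^sub>R b)) has_real_derivative Fn (pd b e) y u (p + s *\<^sub>R b)) (at s)" if "good y u" for y
      using Fn_partial[OF that r(2)[of s] b, of e] s
        DERIV_shift[of "\<lambda>s. Fn e y u (p + s *\<^sub>R b)" "Fn (pd b e) y u (p + s *\<^sub>R b)" 0 s]
      by (simp add: scaleR_add_left algebra_simps abs_less_iff)
    have "((\<lambda>s. Q e n (p + s *\<^sub>R b)) has_real_derivative Q (pd b e) n (p + s *\<^sub>R b)) (at s)"
      unfolding Q_def by (intro DERIV_cmult DERIV_diff dF \<sigma>(2) g)
    then show "((\<lambda>s. Q e n (p + s *\<^sub>R b)) has_derivative (\<lambda>k. Q (pd b e) n (p + s *\<^sub>R b) * k)) (at s within {- r<..<r})"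
      by (simp add: has_field_derivative_def has_derivative_at_withinI)
  next
    fix \<epsilon> :: real assume "\<epsilon> > 0"
    from lim[OF this, of "pd b e"]
    show "\<forall>\<^sub>F n in sequentially. \<forall>s\<in>{- r<..<r}. \<forall>k. norm (Q (pd b e) n (p + s *\<^sub>R b) * k -
        Fn (dv (Dir j) (pd b e)) x u (p + s *\<^sub>R b) * k) \<le> \<epsilon> * norm k"
    proof (rule eventually_mono, intro ballI allI)
      fix n s k assume A: "\<forall>s. \<bar>s\<bar> < r \<longrightarrow> \<bar>Q (pd b e) n (p + s *\<^sub>R b) - Fn (dv (Dir j) (pd b e)) x u (p + s *\<^sub>R b)\<bar> < \<epsilon>"
        and s: "s \<in> {- r<..<r}"
      have "\<bar>Q (pd b e) n (p + s *\<^sub>R b) - Fn (dv (Dir j) (pd b e)) x u (p + s *\<^sub>R b)\<bar> \<le> \<epsilon>"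
        using A s by (auto simp: less_imp_le)
      then show "norm (Q (pd b e) n (p + s *\<^sub>R b) * k - Fn (dv (Dir j) (pd b e)) x u (p + s *\<^sub>R b) * k) \<le> \<epsilon> * norm k"
        by (simp add: left_diff_distrib[symmetric] abs_mult mult_right_mono)
    qed
  next
    show "(\<lambda>n. Q e n (p + 0 *\<^sub>R b)) \<longlonglongrightarrow> Fn (dv (Dir j) e) x u (p + 0 *\<^sub>R b)"
      using pt[of 0] r(1) by simp
  qed (use r(1) in auto)
  then obtain h where h: "\<And>s. s \<in> {- r<..<r} \<Longrightarrow> (\<lambda>n. Q e n (p + s *\<^sub>R b)) \<longlonglongrightarrow> h s"
    "\<And>s. s \<in> {- r<..<r} \<Longrightarrow> (h has_derivative (\<lambda>k. Fn (dv (Dir j) (pd b e)) x u (p + s *\<^sub>R b) * k)) (at s within {- r<..<r})"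
    by blast
  have he: "h s = Fn (dv (Dir j) e) x u (p + s *\<^sub>R b)" if "s \<in> {- r<..<r}" for s
    using LIMSEQ_unique[OF h(1)[OF that] pt] that by auto
  have "at 0 within {- r<..<r} = at (0 :: real)"
    using r(1) by (intro at_within_open) auto
  then have "(h has_real_derivative Fn (dv (Dir j) (pd b e)) x u p) (at 0)"
    using h(2)[of 0] r(1) by (simp add: has_field_derivative_def)
  then have "((\<lambda>s. Fn (dv (Dir j) e) x u (p + s *\<^sub>R b)) has_real_derivative Fn (dv (Dir j) (pd b e)) x u p) (at 0)"
    by (rule has_field_derivative_transform_within_open[of _ _ _ "{- r<..<r}"]) (use r(1) he in auto)
  with Fn_partial[OF g p b] show ?thesis by (rule DERIV_unique)
qed

lemma pds_dv_commute:
  assumes g: "good x u" and bs: "set bs \<subseteq> Basis" and p: "p \<in> I \<times> UNIV"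
  shows "Fn (pds bs (dv (Dir j) e)) x u p = Fn (dv (Dir j) (pds bs e)) x u p"
proof -
  have i: "Fn (pds bs (dv (Dir j) e)) x u p = Fn (dv (Dir j) (pds bs e)) x u p"
    if "p \<in> interior (I \<times> UNIV)" for p
    using bs that
  proof (induction bs arbitrary: p)
    case (Cons b bs)
    have b: "b \<in> Basis" using Cons.prems by simp
    have "((\<lambda>t. partial [] (Fn (pds bs (dv (Dir j) e)) x u) (p + t *\<^sub>R b)) has_real_derivative Fn (pd b (dv (Dir j) (pds bs e))) x u p) (at 0)"
      by (rule partial_Cons_eqI(1)[of "interior (I \<times> UNIV)"])
        (use Cons Fn_partial[OF g Cons.prems(2) b] in auto)
    from DERIV_unique[OF Fn_partial[OF g Cons.prems(2) b] this[unfolded partial.simps]]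
    show ?case using pd_dv_commute[OF g Cons.prems(2) b, of j "pds bs e"] by simp
  qed simp
  \<comment> \<open>Both sides are continuous on the closed strip and agree in its interior, so each
    is the extension of the same function.\<close>
  show ?thesis
    using strip.ext_partial_eqI[of "Fn (pds bs (dv (Dir j) e)) x u" "[]" "Fn (dv (Dir j) (pds bs e)) x u" p]
      strip.ext_partial_eqI[of "Fn (dv (Dir j) (pds bs e)) x u" "[]" "Fn (dv (Dir j) (pds bs e)) x u" p]
      Fn_continuous[OF g] i p by simp
qed

lemma finite_multi_indices: "finite {bs :: (real \<times> real) list. set bs \<subseteq> Basis \<and> length bs \<le> n}"
  by (rule finite_lists_length_le) simp

text \<open>The partial derivatives of the quotient are quotients of \<open>pds bs e\<close>, which
  tend to \<open>dv (Dir j) (pds bs e)\<close>; commutation identifies these limits with the partial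
  derivatives of the asserted limit.\<close>

lemma Fn_directional_limit:
  assumes g: "good x u"
  shows "limitin (F_space \<infinity> T) (\<lambda>s. inverse s *\<^sub>R (Fn e (x + s *\<^sub>R u j) u - Fn e x u)) (Fn (dv (Dir j) e) x u) (at 0)"
  unfolding F.limitin_iff
proof (intro conjI allI impI)
  show "Fn (dv (Dir j) e) x u \<in> topspace (F_space \<infinity> T)" using Fn_F[OF g] .
  fix n and \<epsilon> :: real assume "\<epsilon> > 0"
  let ?B = "{bs :: (real \<times> real) list. set bs \<subseteq> Basis \<and> length bs \<le> n}"
  have "\<forall>\<^sub>F s in at 0. \<forall>bs\<in>?B. good (x + s *\<^sub>R u j) u \<and> (\<forall>t \<in> I. \<forall>\<xi>.
    \<bar>inverse s * (ev (pds bs e) (x + s *\<^sub>R u j) u t \<xi> - ev (pds bs e) x u t \<xi>) - ev (dv (Dir j) (pds bs e)) x u t \<xi>\<bar> < \<epsilon> / 2)"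
    using \<open>\<epsilon> > 0\<close> by (intro eventually_ball_finite finite_multi_indices ballI difference_quotient_uniform g) simp
  then show "\<forall>\<^sub>F s in at 0. inverse s *\<^sub>R (Fn e (x + s *\<^sub>R u j) u - Fn e x u) \<in> topspace (F_space \<infinity> T) \<and>
      strip.C_seminorm n (inverse s *\<^sub>R (Fn e (x + s *\<^sub>R u j) u - Fn e x u) - Fn (dv (Dir j) e) x u) < \<epsilon>"
  proof eventually_elim
    case (elim s)
    have gs: "good (x + s *\<^sub>R u j) u" using bspec[OF elim, of "[]"] by simp
    let ?D = "Fn e (x + s *\<^sub>R u j) u - Fn e x u"
    have D: "?D \<in> topspace (F_space \<infinity> T)" "inverse s *\<^sub>R ?D \<in> topspace (F_space \<infinity> T)"
      using F.carrier_closed Fn_F g gs by auto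
    then have DC: "?D \<in> C_on \<infinity> (I \<times> UNIV)" "inverse s *\<^sub>R ?D \<in> C_on \<infinity> (I \<times> UNIV)"
      unfolding topspace_F by blast+
    have "strip.C_seminorm n (inverse s *\<^sub>R ?D - Fn (dv (Dir j) e) x u) \<le> \<epsilon> / 2"
    proof (rule strip.C_seminorm_le)
      fix bs :: "(real \<times> real) list" and p :: "real \<times> real"
      assume A: "set bs \<subseteq> Basis" "length bs \<le> n" "p \<in> I \<times> UNIV"
      have "ext_partial (I \<times> UNIV) bs (inverse s *\<^sub>R ?D - Fn (dv (Dir j) e) x u) p =
          inverse s * (Fn (pds bs e) (x + s *\<^sub>R u j) u p - Fn (pds bs e) x u p) - Fn (dv (Dir j) (pds bs e)) x u p"
        unfolding strip.ext_partial_diff[OF DC(2) A(1,3) Fn_C_infinity[OF g]]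
          strip.ext_partial_scale[OF DC(1) A(1,3)]
          strip.ext_partial_diff[OF Fn_C_infinity[OF gs] A(1,3) Fn_C_infinity[OF g]]
          ext_partial_Fn[OF g A(1,3)] ext_partial_Fn[OF gs A(1,3)] pds_dv_commute[OF g A(1,3)] ..
      moreover have "fst p \<in> I" using A by auto
      ultimately show "\<bar>ext_partial (I \<times> UNIV) bs (inverse s *\<^sub>R ?D - Fn (dv (Dir j) e) x u) p\<bar> \<le> \<epsilon> / 2"
        using elim A by (auto simp: Fn_def less_imp_le)
    qed (use \<open>\<epsilon> > 0\<close> in simp)
    with D \<open>\<epsilon> > 0\<close> show ?case by simp
  qed
qed

text \<open>One inclusion is the limit just computed, with openness of \<open>solvable\<close> along
  lines; the other is uniqueness of limits in a Hausdorff space.\<close>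

lemma dir_deriv_graph:
  assumes "range u \<subseteq> carrier"
  shows "dir_deriv (F_space \<infinity> T) (u j) (graph e u) = graph (dv (Dir j) e) u"
proof -
  have ev: "\<forall>\<^sub>F s in at 0. x + s *\<^sub>R u j \<in> solvable" if x: "x \<in> solvable" for x
  proof -
    have "good x u" using x assms by (simp add: good_def)
    from difference_quotient_uniform[OF this zero_less_one, of j Sol] show ?thesis
      by (rule eventually_mono) (auto simp: good_def)
  qed
  have lim: "limitin (F_space \<infinity> T) (\<lambda>s. inverse s *\<^sub>R (graph_app (graph e u) (x + s *\<^sub>R u j) - graph_app (graph e u) x))
      (Fn (dv (Dir j) e) x u) (at 0)" if x: "x \<in> solvable" for x
  proof (rule limitin_transform_eventually[OF _ Fn_directional_limit])
    show "good x u" using x assms by (simp add: good_def)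
    show "\<forall>\<^sub>F s in at 0. inverse s *\<^sub>R (Fn e (x + s *\<^sub>R u j) u - Fn e x u) =
        inverse s *\<^sub>R (graph_app (graph e u) (x + s *\<^sub>R u j) - graph_app (graph e u) x)"
      using ev[OF x] by (rule eventually_mono) (simp add: graph_app_graph x)
  qed
  show ?thesis
  proof (intro equalityI subsetI)
    fix q assume "q \<in> dir_deriv (F_space \<infinity> T) (u j) (graph e u)"
    then obtain x v where q: "q = (x, v)" "x \<in> solvable"
      "limitin (F_space \<infinity> T) (\<lambda>s. inverse s *\<^sub>R (graph_app (graph e u) (x + s *\<^sub>R u j) - graph_app (graph e u) x)) v (at 0)"
      by (auto simp: dir_deriv_def Domain_graph)
    from limitin_Hausdorff_unique[OF q(3) lim[OF q(2)] _ F.Hausdorff]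
    have "v = Fn (dv (Dir j) e) x u" by simp
    with q(1,2) show "q \<in> graph (dv (Dir j) e) u" unfolding graph_def by blast
  next
    fix q assume "q \<in> graph (dv (Dir j) e) u"
    then obtain x where "q = (x, Fn (dv (Dir j) e) x u)" "x \<in> solvable" by (auto simp: graph_def)
    then show "q \<in> dir_deriv (F_space \<infinity> T) (u j) (graph e u)"
      using lim ev by (simp add: dir_deriv_def Domain_graph)
  qed
qed

end

section \<open>Multilinearity\<close>

text \<open>Tracks the directions on which a value can depend, so that a direction can be recognised
  as new; the datum itself is not counted.\<close>

primrec vars :: "expr \<Rightarrow> nat set" where
  "vars Sol = {}"
| "vars (Init i m) = set_option i"
| "vars (Coef i ks) = set_option i"
| "vars (Const c) = {}"
| "vars (Plus a b) = vars a \<union> vars b"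
| "vars (Times a b) = vars a \<union> vars b"
| "vars (Expo a) = vars a"
| "vars (Integ a) = vars a"

lemma vars_dv_Shift: "vars (dv Shift e) \<subseteq> vars e"
  by (induction e) (auto simp: dsol_def Let_def)

lemma vars_dv_Dir: "vars (dv (Dir j) e) \<subseteq> insert j (vars e)"
  by (induction e) (auto simp: dsol_def Let_def split: option.splits)

lemma vars_dc: "vars (dc e) \<subseteq> vars e"
  by (induction e) auto

context time_interval
begin

lemma vars_pds: "vars (pds bs e) \<subseteq> vars e"
proof (induction bs)
  case (Cons b bs)
  have "vars (pd b (pds bs e)) \<subseteq> vars (pds bs e)"
    using vars_dv_Shift[of "pds bs e"] vars_dc[of "pds bs e"] by (auto simp: pd_def)
  with Cons show ?case by simp
qed simp

lemma ev_cong: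
  "(\<And>i. i \<in> vars e \<Longrightarrow> u i = u' i) \<Longrightarrow> ev e x u t \<xi> = ev e x u' t \<xi>"
proof (induction e arbitrary: t)
  case (Init i m)
  then show ?case by (cases i) auto
next
  case (Coef i ks)
  then show ?case by (cases i) auto
qed simp_all

definition linear_in :: "nat \<Rightarrow> expr \<Rightarrow> bool" where
  "linear_in j e \<longleftrightarrow> (\<forall>x u a b c. \<forall>t \<in> I. \<forall>\<xi>. good x u \<and> a \<in> carrier \<and> b \<in> carrier \<longrightarrow>
     ev e x (u(j := c *\<^sub>R a + b)) t \<xi> = c * ev e x (u(j := a)) t \<xi> + ev e x (u(j := b)) t \<xi>)"

lemma linear_inD:
  assumes "linear_in j e" "good x u" "a \<in> carrier" "b \<in> carrier" "t \<in> I"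
  shows "ev e x (u(j := c *\<^sub>R a + b)) t \<xi> = c * ev e x (u(j := a)) t \<xi> + ev e x (u(j := b)) t \<xi>"
  using assms unfolding linear_in_def by blast

lemma linear_in_zero:
  assumes "linear_in j e" "good x u" "t \<in> I"
  shows "ev e x (u(j := 0)) t \<xi> = 0"
  using linear_inD[OF assms(1,2) E.carrier_closed(1) E.carrier_closed(1) assms(3), of 1 \<xi>] by simp

lemma linear_in_scale:
  assumes "linear_in j e" "good x u" "a \<in> carrier" "t \<in> I"
  shows "ev e x (u(j := c *\<^sub>R a)) t \<xi> = c * ev e x (u(j := a)) t \<xi>"
  using linear_inD[OF assms(1-3) E.carrier_closed(1) assms(4), of c \<xi>] linear_in_zero[OF assms(1,2,4)] by simp

lemma good_upd: "good x u \<Longrightarrow> a \<in> carrier \<Longrightarrow> good x (u(j := a))"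
  by (auto simp: good_def)

lemma linear_in_basic:
  "linear_in j (Const 0)" "linear_in j (Init (Some j) m)" "linear_in j (Coef (Some j) ks)"
  unfolding linear_in_def
  using init_lincomb(1)[OF E.carrier_closed(4)] init_lincomb(3) coef_lincomb(1)[OF E.carrier_closed(4)] coef_lincomb(3)
  by simp_all

lemma linear_in_Plus: "linear_in j a \<Longrightarrow> linear_in j b \<Longrightarrow> linear_in j (Plus a b)"
  unfolding linear_in_def by (simp add: distrib_left)

lemma linear_in_Times:
  assumes "linear_in j a" "j \<notin> vars b"
  shows "linear_in j (Times a b)" "linear_in j (Times b a)"
proof -
  have "ev b x (u(j := d)) t \<xi> = ev b x u t \<xi>" for x u d t \<xi>
    using assms(2) by (intro ev_cong) auto
  then show "linear_in j (Times a b)" "linear_in j (Times b a)"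
    using assms(1) unfolding linear_in_def by (simp_all add: algebra_simps)
qed

lemma linear_in_Integ:
  assumes "linear_in j a" shows "linear_in j (Integ a)"
  unfolding linear_in_def
proof (intro allI ballI impI)
  fix x u d b c t \<xi> assume A: "good x u \<and> d \<in> carrier \<and> b \<in> carrier" and t: "t \<in> I"
  have i: "(\<lambda>\<tau>. ev a x (u(j := w)) \<tau> \<xi>) integrable_on {0..t}" if "w \<in> carrier" for w
    using A that by (intro ev_integrable good_upd t) auto
  have "integral {0..t} (\<lambda>\<tau>. ev a x (u(j := c *\<^sub>R d + b)) \<tau> \<xi>) =
      integral {0..t} (\<lambda>\<tau>. c * ev a x (u(j := d)) \<tau> \<xi> + ev a x (u(j := b)) \<tau> \<xi>)"
    using A t by (intro integral_cong linear_inD[OF assms]) auto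
  also have "\<dots> = c * integral {0..t} (\<lambda>\<tau>. ev a x (u(j := d)) \<tau> \<xi>) + integral {0..t} (\<lambda>\<tau>. ev a x (u(j := b)) \<tau> \<xi>)"
    using A i[of d] i[of b] by (subst integral_add) (auto intro: integrable_on_mult_right)
  finally show "ev (Integ a) x (u(j := c *\<^sub>R d + b)) t \<xi> =
      c * ev (Integ a) x (u(j := d)) t \<xi> + ev (Integ a) x (u(j := b)) t \<xi>" by simp
qed

text \<open>A new direction enters only through \<open>dinit\<close> and \<open>dcoef\<close>, and
  every product formed by \<open>dv\<close> contains it in at most one factor.\<close>

lemma linear_in_dv_new: "j \<notin> vars e \<Longrightarrow> linear_in j (dv (Dir j) e)"
proof -
  have c: "linear_in j (dcoef (Dir j) i ks)" and i: "linear_in j (dinit (Dir j) i m)" for i ks m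
    by (cases i; simp add: linear_in_basic)+
  have s: "linear_in j (dsol (Dir j))"
    unfolding dsol_def Let_def
    by (intro linear_in_Times(2) linear_in_Plus linear_in_Integ c i) auto
  show "j \<notin> vars e \<Longrightarrow> linear_in j (dv (Dir j) e)"
  proof (induction e)
    case (Coef i ks)
    then show ?case using c s by (auto intro!: linear_in_Plus linear_in_Times(2) simp del: dcoef.simps)
  next
    case (Times a b)
    then show ?case by (auto intro!: linear_in_Plus linear_in_Times(1)[of _ "dv (Dir j) a"] linear_in_Times(2)[of _ "dv (Dir j) b"])
  next
    case (Expo a)
    then show ?case by (auto intro!: linear_in_Times(2))
  qed (use c i s linear_in_basic(1) in \<open>auto intro!: linear_in_Plus linear_in_Integ simp del: dinit.simps\<close>)
qed

text \<open>The linearity identity is differentiated along \<open>u j\<close> and derivatives are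
  unique. Structural induction would fail, as linearity of a sum or product says nothing about its
  parts. Since \<open>i\<close> and \<open>j\<close> differ, updating slot \<open>i\<close> leaves
  the path of data unchanged.\<close>

lemma linear_in_dv:
  assumes "linear_in i e" "i \<noteq> j" shows "linear_in i (dv (Dir j) e)"
  unfolding linear_in_def
proof (intro allI ballI impI)
  fix x u a b c t \<xi> assume A: "good x u \<and> a \<in> carrier \<and> b \<in> carrier" and t: "t \<in> I"
  have d: "((\<lambda>s. ev e (x + s *\<^sub>R u j) (u(i := w)) t \<xi>) has_real_derivative ev (dv (Dir j) e) x (u(i := w)) t \<xi>) (at 0)"
    if "w \<in> carrier" for w
    using dv_derivative[OF good_upd[of x u w i] t, of e "Dir j" \<xi>] A that assms(2) by simp
  have "c *\<^sub>R a + b \<in> carrier" using A E.carrier_closed by blast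
  then have l: "((\<lambda>s. ev e (x + s *\<^sub>R u j) (u(i := c *\<^sub>R a + b)) t \<xi>) has_real_derivative
      ev (dv (Dir j) e) x (u(i := c *\<^sub>R a + b)) t \<xi>) (at 0)" by (rule d)
  have r: "((\<lambda>s. c * ev e (x + s *\<^sub>R u j) (u(i := a)) t \<xi> + ev e (x + s *\<^sub>R u j) (u(i := b)) t \<xi>) has_real_derivative
      c * ev (dv (Dir j) e) x (u(i := a)) t \<xi> + ev (dv (Dir j) e) x (u(i := b)) t \<xi>) (at 0)"
    using A by (intro DERIV_add DERIV_cmult d) auto
  have g: "good x u" using A by blast
  obtain \<rho> where \<rho>: "\<rho> > 0" "\<And>s. \<bar>s\<bar> < \<rho> \<Longrightarrow> good (x + s *\<^sub>R u j) u"
    by (rule moved_continuous[OF g, of "Dir j"]) auto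
  have "((\<lambda>s. ev e (x + s *\<^sub>R u j) (u(i := c *\<^sub>R a + b)) t \<xi>) has_real_derivative
      c * ev (dv (Dir j) e) x (u(i := a)) t \<xi> + ev (dv (Dir j) e) x (u(i := b)) t \<xi>) (at 0)"
  proof (rule has_field_derivative_transform_within_open[OF r, of "{- \<rho><..<\<rho>}"])
    show "c * ev e (x + s *\<^sub>R u j) (u(i := a)) t \<xi> + ev e (x + s *\<^sub>R u j) (u(i := b)) t \<xi> =
        ev e (x + s *\<^sub>R u j) (u(i := c *\<^sub>R a + b)) t \<xi>" if "s \<in> {- \<rho><..<\<rho>}" for s
      using linear_inD[OF assms(1) \<rho>(2)[of s], of a b t c \<xi>] that A t by auto
  qed (use \<rho>(1) in auto)
  from DERIV_unique[OF l this]
  show "ev (dv (Dir j) e) x (u(i := c *\<^sub>R a + b)) t \<xi> =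
      c * ev (dv (Dir j) e) x (u(i := a)) t \<xi> + ev (dv (Dir j) e) x (u(i := b)) t \<xi>" .
qed

section \<open>Higher derivatives of the solution operator\<close>

primrec dsols :: "nat \<Rightarrow> expr" where
  "dsols 0 = Sol"
| "dsols (Suc l) = dv (Dir l) (dsols l)"

lemma vars_dsols: "vars (dsols l) \<subseteq> {..<l}"
proof (induction l)
  case (Suc l)
  then show ?case using vars_dv_Dir[of l "dsols l"] by (auto simp: lessThan_Suc)
qed simp

lemma linear_in_dsols: "i < l \<Longrightarrow> linear_in i (dsols l)"
proof (induction l)
  case (Suc l)
  show ?case
  proof (cases "i = l")
    case True
    then show ?thesis using vars_dsols[of l] by (auto intro!: linear_in_dv_new)
  next
    case False
    then show ?thesis using Suc by (auto intro!: linear_in_dv)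
  qed
qed simp

text \<open>Generalised over the starting index because \<open>dir_derivs\<close> consumes the list
  of directions from the front.\<close>

lemma dir_derivs_graph:
  assumes "range u \<subseteq> carrier" "k \<le> l"
  shows "dir_derivs (F_space \<infinity> T) (map u [k..<l]) (graph (dsols k) u) = graph (dsols l) u"
  using assms(2)
proof (induction "l - k" arbitrary: k)
  case (Suc n)
  then have k: "[k..<l] = k # [Suc k..<l]" by (intro upt_conv_Cons) simp
  show ?case
    using Suc.hyps(1)[of "Suc k"] Suc.hyps(2)
    by (simp add: k dir_deriv_graph[OF assms(1)])
qed simp

text \<open>Extensional functions are \<open>undefined\<close> beyond \<open>l\<close>, which need
  not be a datum; zero keeps all directions in the carrier, as \<open>good\<close> demands.\<close>

definition pad :: "nat \<Rightarrow> (nat \<Rightarrow> datum) \<Rightarrow> nat \<Rightarrow> datum" where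
  "pad l u i = (if i < l then u i else 0)"

lemma good_pad: "x \<in> solvable \<Longrightarrow> u \<in> {..<l} \<rightarrow>\<^sub>E carrier \<Longrightarrow> good x (pad l u)"
  using E.carrier_closed(1) by (auto simp: good_def pad_def PiE_def Pi_def)

lemma dir_derivs_solution_graph:
  assumes "u \<in> {..<l} \<rightarrow>\<^sub>E carrier"
  shows "dir_derivs (F_space \<infinity> T) (map u [0..<l]) (solution_graph T) = graph (dsols l) (pad l u)"
proof -
  have r: "range (pad l u) \<subseteq> carrier"
    using assms E.carrier_closed(1) by (auto simp: pad_def PiE_def Pi_def)
  have m: "map u [0..<l] = map (pad l u) [0..<l]" by (simp add: pad_def)
  show ?thesis
    using dir_derivs_graph[OF r, of 0 l] unfolding m solution_graph_eq[of "pad l u"] by simp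
qed

section \<open>The derivatives of the solution operator as multilinear maps\<close>

abbreviation sol_deriv :: "nat \<Rightarrow> datum \<Rightarrow> (nat \<Rightarrow> datum) \<Rightarrow> real \<times> real \<Rightarrow> real" where
  "sol_deriv l \<equiv> nth_deriv (F_space \<infinity> T) l (solution_graph T)"

lemma sol_deriv_eq:
  assumes "u \<in> {..<l} \<rightarrow>\<^sub>E carrier" "x \<in> solvable"
  shows "sol_deriv l x u = Fn (dsols l) x (pad l u)"
  by (simp only: nth_deriv_def dir_derivs_solution_graph[OF assms(1)] graph_app_graph[OF assms(2)])

lemma pad_upd: "i < l \<Longrightarrow> pad l (u(i := a)) = (pad l u)(i := a)"
  by (auto simp: pad_def)

lemma multilinear_sol_deriv:
  assumes "x \<in> solvable"
  shows "multilinear_on carrier l (sol_deriv l x)"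
  unfolding multilinear_on_def
proof (intro ballI allI impI)
  fix u i a b and c :: real
  assume u: "u \<in> {..<l} \<rightarrow>\<^sub>E carrier" and i: "i < l" and a: "a \<in> carrier" and b: "b \<in> carrier"
  have upd: "u(i := w) \<in> {..<l} \<rightarrow>\<^sub>E carrier" if "w \<in> carrier" for w
    using u that i by (auto simp: PiE_iff extensional_def)
  have g: "good x (pad l u)" using good_pad[OF assms u] .
  note lin = linear_in_dsols[OF i]
  note [simp] = sol_deriv_eq[OF upd assms] pad_upd[OF i] a b E.carrier_closed(2)[OF a b] E.carrier_closed(4)[OF a]
  show "sol_deriv l x (u(i := a + b)) =
      sol_deriv l x (u(i := a)) + sol_deriv l x (u(i := b)) \<and>
      sol_deriv l x (u(i := c *\<^sub>R a)) = c *\<^sub>R sol_deriv l x (u(i := a))"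
  proof
    show "sol_deriv l x (u(i := a + b)) =
      sol_deriv l x (u(i := a)) + sol_deriv l x (u(i := b))"
      using linear_inD[OF lin g a b, of _ 1] by (intro ext) (simp add: Fn_def)
    show "sol_deriv l x (u(i := c *\<^sub>R a)) = c *\<^sub>R sol_deriv l x (u(i := a))"
      using linear_in_scale[OF lin g a] by (intro ext) (simp add: Fn_def scaleR_fun_def)
  qed
qed

section \<open>Continuity and uniform estimates of the derivatives\<close>

lemma eventually_env_exprs:
  assumes "good x u" "\<epsilon> > 0" "finite A"
  obtains m d where "d > 0" "\<And>q e t \<xi>. \<lbrakk>q \<in> env_ball m d x u; e \<in> A; t \<in> I\<rbrakk> \<Longrightarrow>
    good (fst q) (snd q) \<and> \<bar>ev e (fst q) (snd q) t \<xi> - ev e x u t \<xi>\<bar> < \<epsilon>"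
proof -
  have "\<forall>\<^sub>F q in env_nhds x u. \<forall>e\<in>A. good (fst q) (snd q) \<and>
      (\<forall>p\<in>I \<times> UNIV. dist (ev e (fst q) (snd q) (fst p) (snd p)) (ev e x u (fst p) (snd p)) < \<epsilon>)"
    using eventually_env_flow[OF assms(1) zero_less_one]
    by (intro eventually_ball_finite assms(3) ballI eventually_conj uniform_limitD[OF ev_uniform_limit[OF assms(1)] assms(2)])
      (auto elim: eventually_mono)
  then show ?thesis
    unfolding eventually_env_nhds[OF goodD(2,5)[OF assms(1)]] using that by (fastforce simp: dist_real_def)
qed

lemma continuous_sol_deriv:
  assumes x: "x \<in> solvable"
  shows "continuous_map (product_topology (\<lambda>_. E_space T) {..<l}) (F_space \<infinity> T)
    (sol_deriv l x)"
proof (rule F.continuous_map_into)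
  fix u assume "u \<in> topspace (product_topology (\<lambda>_. E_space T) {..<l})"
  then have u: "u \<in> {..<l} \<rightarrow>\<^sub>E carrier" by simp
  show "sol_deriv l x u \<in> topspace (F_space \<infinity> T)"
    using Fn_F[OF good_pad[OF x u]] by (simp add: sol_deriv_eq[OF u x])
next
  fix u n and \<epsilon> :: real
  assume "u \<in> topspace (product_topology (\<lambda>_. E_space T) {..<l})" and \<epsilon>: "\<epsilon> > 0"
  then have u: "u \<in> {..<l} \<rightarrow>\<^sub>E carrier" by simp
  note g = good_pad[OF x u]
  \<comment> \<open>These finitely many expressions determine the seminorm of index
    \<open>n\<close>.\<close>
  let ?A = "(\<lambda>bs. pds bs (dsols l)) ` {bs. set bs \<subseteq> Basis \<and> length bs \<le> n}"
  have e2: "\<epsilon> / 2 > 0" using \<epsilon> by simp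
  have fin: "finite ?A" by (intro finite_imageI finite_multi_indices)
  obtain m d where md: "d > 0" "\<And>q e t \<xi>. \<lbrakk>q \<in> env_ball m d x (pad l u); e \<in> ?A; t \<in> I\<rbrakk> \<Longrightarrow>
    good (fst q) (snd q) \<and> \<bar>ev e (fst q) (snd q) t \<xi> - ev e x (pad l u) t \<xi>\<bar> < \<epsilon> / 2"
    by (rule eventually_env_exprs[OF g e2 fin]) (rule that)
  define U where "U = (\<Pi>\<^sub>E i\<in>{..<l}. {v \<in> carrier. E_seminorm m (v - u i) < d})"
  have ui: "u i \<in> carrier" if "i < l" for i using u that by auto
  have "openin (product_topology (\<lambda>_. E_space T) {..<l}) U"
    unfolding U_def by (subst openin_PiE) (use E.openin_ball ui in auto)
  moreover have "u \<in> U"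
    using u ui md(1) by (auto simp: U_def PiE_iff E.seminorm_zero)
  moreover have "strip.C_seminorm n (sol_deriv l x u' -
      sol_deriv l x u) < \<epsilon>" if u': "u' \<in> U" for u'
  proof -
    have u'c: "u' \<in> {..<l} \<rightarrow>\<^sub>E carrier" using u' by (auto simp: U_def PiE_iff)
    note g' = good_pad[OF x u'c]
    have "(x, pad l u') \<in> env_ball m d x (pad l u)"
      using goodD(2,5)[OF g'] u' md(1) by (auto simp: env_ball_def pad_def U_def PiE_iff E.seminorm_zero)
    from md(2)[OF this]
    have "strip.C_seminorm n (Fn (dsols l) x (pad l u') - Fn (dsols l) x (pad l u)) \<le> \<epsilon> / 2"
      using \<epsilon> by (intro Fn_diff_seminorm_le g g') (auto simp: less_imp_le)
    then show ?thesis using \<epsilon> by (simp add: sol_deriv_eq[OF u x] sol_deriv_eq[OF u'c x])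
  qed
  ultimately show "\<exists>U. openin (product_topology (\<lambda>_. E_space T) {..<l}) U \<and> u \<in> U \<and>
      (\<forall>y\<in>U. strip.C_seminorm n (sol_deriv l x y -
        sol_deriv l x u) < \<epsilon>)"
    by blast
qed

lemma mean_value_direction:
  assumes g: "\<And>s. s \<in> {0..1} \<Longrightarrow> good (x + s *\<^sub>R u j) u" and t: "t \<in> I"
    and b: "\<And>s. s \<in> {0..1} \<Longrightarrow> \<bar>ev (dv (Dir j) e) (x + s *\<^sub>R u j) u t \<xi>\<bar> \<le> c"
  shows "\<bar>ev e (x + u j) u t \<xi> - ev e x u t \<xi>\<bar> \<le> c"
proof -
  have "norm (ev e (x + 1 *\<^sub>R u j) u t \<xi> - ev e (x + 0 *\<^sub>R u j) u t \<xi>) \<le> c * norm (1 - 0 :: real)"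
  proof (rule field_differentiable_bound[of "{0..1}" "\<lambda>s. ev e (x + s *\<^sub>R u j) u t \<xi>" "\<lambda>s. ev (dv (Dir j) e) (x + s *\<^sub>R u j) u t \<xi>"])
    show "((\<lambda>s. ev e (x + s *\<^sub>R u j) u t \<xi>) has_real_derivative ev (dv (Dir j) e) (x + s *\<^sub>R u j) u t \<xi>) (at s within {0..1})"
      if "s \<in> {0..1}" for s
      using dv_derivative_at[of "Dir j" x u s t e \<xi>] g[OF that] t
      by (simp add: has_field_derivative_at_within)
  qed (use b in auto)
  then show ?thesis by simp
qed

text \<open>
  The estimate required by \<open>C\<^sup>\<infinity>\<^sub>\<pi>\<close> follows from the boundedness of the derivative of order \<open>l + 1\<close> near
  \<open>(x, 0)\<close> and its homogeneity in the last direction, by the mean value theorem.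
\<close>

lemma sol_deriv_uniform:
  assumes x: "x \<in> solvable" and W: "zero_nhd (F_space \<infinity> T) W"
  shows "\<exists>U. zero_nhd (E_space T) U \<and> (\<forall>\<epsilon>>0. \<exists>V. zero_nhd (E_space T) V \<and>
     (\<forall>v \<in> V. x + v \<in> solvable \<and>
        (\<lambda>u. sol_deriv l (x + v) u -
           sol_deriv l x u) ` ({..<l} \<rightarrow>\<^sub>E U) \<subseteq> (\<lambda>w. \<epsilon> *\<^sub>R w) ` W))"
proof -
  obtain n r where r: "r > 0" "\<And>w. w \<in> topspace (F_space \<infinity> T) \<Longrightarrow> strip.C_seminorm n w < r \<Longrightarrow> w \<in> W"
    using W unfolding F.zero_nhd_iff by blast
  have g0: "good x (\<lambda>_. 0)" using x E.carrier_closed(1) by (auto simp: good_def)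
  let ?B = "{bs :: (real \<times> real) list. set bs \<subseteq> Basis \<and> length bs \<le> n}"
  \<comment> \<open>The derivatives of order \<open>l + 1\<close> together with all space-time
    derivatives that enter the seminorm of index \<open>n\<close>.\<close>
  let ?A = "(\<lambda>bs. dv (Dir l) (pds bs (dsols l))) ` ?B"
  have fin: "finite ?A" by (intro finite_imageI finite_multi_indices)
  obtain m d where md: "d > 0" "\<And>q e t \<xi>. \<lbrakk>q \<in> env_ball m d x (\<lambda>_. 0); e \<in> ?A; t \<in> I\<rbrakk> \<Longrightarrow>
    good (fst q) (snd q) \<and> \<bar>ev e (fst q) (snd q) t \<xi> - ev e x (\<lambda>_. 0) t \<xi>\<bar> < 1"
    by (rule eventually_env_exprs[OF g0 zero_less_one fin]) (rule that)
  have new: "l \<notin> vars (pds bs (dsols l))" for bs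
    using vars_pds[of bs "dsols l"] vars_dsols[of l] by auto
  have lin: "linear_in l (dv (Dir l) (pds bs (dsols l)))" for bs
    by (rule linear_in_dv_new[OF new])
  \<comment> \<open>Vanishing at zero directions turns closeness to the value there into the
    absolute bound 1.\<close>
  have z: "ev (dv (Dir l) (pds bs (dsols l))) x (\<lambda>_. 0) t \<xi> = 0" if "t \<in> I" for bs t \<xi>
    using linear_in_zero[OF lin g0 that, of bs \<xi>] by (simp add: fun_upd_idem)
  \<comment> \<open>\<open>m\<close> and \<open>d\<close> come from \<open>W\<close> alone, so
    \<open>U\<close> is fixed before \<epsilon> is given.\<close>
  define U where "U = {v \<in> carrier. E_seminorm m v < d}"
  have "\<exists>V. zero_nhd (E_space T) V \<and> (\<forall>v \<in> V. x + v \<in> solvable \<and>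
      (\<lambda>u. sol_deriv l (x + v) u -
         sol_deriv l x u) ` ({..<l} \<rightarrow>\<^sub>E U) \<subseteq> (\<lambda>w. \<epsilon> *\<^sub>R w) ` W)"
    if \<epsilon>: "\<epsilon> > 0" for \<epsilon>
  proof -
    \<comment> \<open>\<open>c < \<epsilon> * r\<close> is the estimate aimed at;
      \<open>c <= 1\<close> keeps the segment from \<open>x\<close> to \<open>x + v\<close> inside
      the ball of radius \<open>d\<close>.\<close>
    define c where "c = min 1 (\<epsilon> * r / 2)"
    have c: "c > 0" "c \<le> 1" "c < \<epsilon> * r" using \<epsilon> r(1) by (auto simp: c_def min_less_iff_disj)
    define V where "V = {v \<in> carrier. E_seminorm m v < c * d}"
    have main: "x + v \<in> solvable \<and> strip.C_seminorm n (Fn (dsols l) (x + v) (pad l u) - Fn (dsols l) x (pad l u)) \<le> c"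
      if v: "v \<in> V" and u: "u \<in> {..<l} \<rightarrow>\<^sub>E U" for v u
    proof -
      have vc: "v \<in> carrier" "E_seminorm m v < c * d" using v by (auto simp: V_def)
      \<comment> \<open>\<open>V\<close> is the ball scaled by \<open>c\<close>, so the rescaled
        \<open>w\<close> is again admissible as a direction.\<close>
      define w where "w = inverse c *\<^sub>R v"
      have "E_seminorm m w = E_seminorm m v / c"
        using c(1) by (simp add: w_def E.scale[OF vc(1)] divide_inverse mult.commute)
      then have w: "w \<in> carrier" "E_seminorm m w < d" "v = c *\<^sub>R w"
        using vc(2) c(1) E.carrier_closed(4)[OF vc(1)]
        by (auto simp: w_def pos_divide_less_eq mult.commute)
      have uc: "u \<in> {..<l} \<rightarrow>\<^sub>E carrier" using u by (auto simp: U_def PiE_iff)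
      have padU: "E_seminorm m (pad l u i) < d" for i
        using u md(1) E.seminorm_zero by (auto simp: pad_def U_def PiE_iff)
      have padc: "pad l u i \<in> carrier" for i
        using goodD(3)[OF good_pad[OF x uc]] .
      have ball: "(x + s *\<^sub>R v, (pad l u)(l := w)) \<in> env_ball m d x (\<lambda>_. 0)" if s: "s \<in> {0..1}" for s
      proof -
        have "E_seminorm m (s *\<^sub>R v) \<le> 1 * E_seminorm m v"
          using E.scale[OF vc(1), of m s] s E.seminorm_nonneg[OF vc(1), of m] mult_right_mono[of s 1 "E_seminorm m v"] by simp
        also have "\<dots> < d" using vc(2) mult_right_mono[OF c(2), of d] md(1) by linarith
        finally have "E_seminorm m (s *\<^sub>R v) < d" .
        moreover have "x + s *\<^sub>R v \<in> carrier"
          using solvable_carrier[OF x] vc(1) E.carrier_closed by blast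
        ultimately show ?thesis using w padc padU by (auto simp: env_ball_def)
      qed
      \<comment> \<open>A member of \<open>?A\<close> is needed, besides a time in the interval, to
        read off solvability along the segment.\<close>
      have "dv (Dir l) (pds [] (dsols l)) \<in> ?A" by (rule imageI) simp
      from md(2)[OF ball this] T_pos have gw: "good (x + s *\<^sub>R v) ((pad l u)(l := w))" if "s \<in> {0..1}" for s
        using that by fastforce
      have gp: "good (x + s *\<^sub>R v) (pad l u)" if "s \<in> {0..1}" for s
        using gw[OF that] padc by (auto simp: good_def)
      have bd: "\<bar>ev (pds bs (dsols l)) (x + v) (pad l u) t \<xi> - ev (pds bs (dsols l)) x (pad l u) t \<xi>\<bar> \<le> c"
        if bs: "set bs \<subseteq> Basis" "length bs \<le> n" and t: "t \<in> I" for bs t \<xi>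
      proof -
        let ?u = "(pad l u)(l := v)" and ?e = "pds bs (dsols l)"
        have "\<bar>ev ?e (x + ?u l) ?u t \<xi> - ev ?e x ?u t \<xi>\<bar> \<le> c"
        proof (rule mean_value_direction[OF _ t])
          fix s :: real assume s: "s \<in> {0..1}"
          show "good (x + s *\<^sub>R ?u l) ?u" using good_upd[OF gp[OF s] vc(1)] by simp
          \<comment> \<open>Homogeneity in the last slot extracts the factor \<open>c\<close>,
            leaving a value bounded by 1 on the fixed ball.\<close>
          have "ev (dv (Dir l) ?e) (x + s *\<^sub>R v) ?u t \<xi> = c * ev (dv (Dir l) ?e) (x + s *\<^sub>R v) ((pad l u)(l := w)) t \<xi>"
            by (rule linear_in_scale[OF lin gp[OF s] w(1) t, where c = c, folded w(3)])
          moreover have "\<bar>ev (dv (Dir l) ?e) (x + s *\<^sub>R v) ((pad l u)(l := w)) t \<xi>\<bar> \<le> 1"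
            using md(2)[OF ball[OF s] _ t, of "dv (Dir l) ?e" \<xi>] z[OF t, of bs \<xi>] bs by (simp add: less_imp_le)
          ultimately show "\<bar>ev (dv (Dir l) ?e) (x + s *\<^sub>R ?u l) ?u t \<xi>\<bar> \<le> c"
            using c(1) by (simp add: abs_mult mult_left_le)
        qed
        \<comment> \<open>Slot \<open>l\<close> held \<open>v\<close> only to serve as the direction
          of the mean value estimate; the derivative of order \<open>l\<close> does not read
          it.\<close>
        moreover have "ev ?e y ?u t \<xi> = ev ?e y (pad l u) t \<xi>" for y
          using new by (intro ev_cong) auto
        ultimately show ?thesis by simp
      qed
      have g1: "good (x + v) (pad l u)" using gp[of 1] by simp
      show ?thesis
        using Fn_diff_seminorm_le[OF g1 good_pad[OF x uc] _ bd] c(1) goodD(1)[OF g1] by simp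
    qed
    show ?thesis
    proof (intro exI[of _ V] conjI ballI)
      show "zero_nhd (E_space T) V"
        unfolding V_def using c(1) md(1) by (intro E.zero_nhd_ball) simp
      fix v assume v: "v \<in> V"
      \<comment> \<open>Solvability of \<open>x + v\<close> has to be obtained independently of the
        directions; \<open>main\<close> needs some tuple, and the zero tuple always lies in the
        product.\<close>
      have "(\<lambda>i\<in>{..<l}. 0) \<in> {..<l} \<rightarrow>\<^sub>E U"
        using md(1) E.carrier_closed(1) E.seminorm_zero by (auto simp: U_def)
      from main[OF v this] show sv: "x + v \<in> solvable" by blast
      show "(\<lambda>u. sol_deriv l (x + v) u -
         sol_deriv l x u) ` ({..<l} \<rightarrow>\<^sub>E U) \<subseteq> (\<lambda>w. \<epsilon> *\<^sub>R w) ` W"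
      proof (rule image_subsetI)
        fix u assume u: "u \<in> {..<l} \<rightarrow>\<^sub>E U"
        have uc: "u \<in> {..<l} \<rightarrow>\<^sub>E carrier" using u by (auto simp: U_def PiE_iff)
        let ?D = "Fn (dsols l) (x + v) (pad l u) - Fn (dsols l) x (pad l u)"
        have D: "?D \<in> topspace (F_space \<infinity> T)"
          by (intro F.carrier_closed Fn_F good_pad sv x uc)
        have "strip.C_seminorm n (inverse \<epsilon> *\<^sub>R ?D) = inverse \<epsilon> * strip.C_seminorm n ?D"
          using F.scale[OF D, of n "inverse \<epsilon>"] \<epsilon> by simp
        also have "\<dots> < r"
          using main[OF v u] c(3) \<epsilon> by (simp add: field_simps)
        finally have "inverse \<epsilon> *\<^sub>R ?D \<in> W" using r(2) F.carrier_closed(4)[OF D] by blast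
        then have "\<epsilon> *\<^sub>R (inverse \<epsilon> *\<^sub>R ?D) \<in> (\<lambda>w. \<epsilon> *\<^sub>R w) ` W" by (rule imageI)
        then show "sol_deriv l (x + v) u -
            sol_deriv l x u \<in> (\<lambda>w. \<epsilon> *\<^sub>R w) ` W"
          using \<epsilon> unfolding sol_deriv_eq[OF uc sv] sol_deriv_eq[OF uc x] scaleR_scaleR by simp
      qed
    qed
  qed
  moreover have "zero_nhd (E_space T) U" unfolding U_def by (rule E.zero_nhd_ball[OF md(1)])
  ultimately show ?thesis by blast
qed

lemma solution_graph_C_inf_pi: "(E_space T, F_space \<infinity> T, solution_graph T) \<in> C_inf_pi"
proof -
  have dom: "Domain (solution_graph T) = solvable"
    unfolding solution_graph_eq[of "\<lambda>_. 0"] by (rule Domain_graph)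
  have sv: "single_valued (solution_graph T)"
    unfolding solution_graph_eq[of "\<lambda>_. 0"] by (auto simp: single_valued_def graph_def)
  have range: "Range (solution_graph T) \<subseteq> topspace (F_space \<infinity> T)"
  proof -
    have "good x (\<lambda>_. 0)" if "x \<in> solvable" for x
      using that E.carrier_closed(1) by (auto simp: good_def)
    then show ?thesis
      unfolding solution_graph_eq[of "\<lambda>_. 0"] using Fn_F by (auto simp: graph_def)
  qed
  have d: "x \<in> Domain (dir_derivs (F_space \<infinity> T) (map u [0..<l]) (solution_graph T))"
    if "x \<in> solvable" "u \<in> {..<l} \<rightarrow>\<^sub>E carrier" for x u l
    using that by (simp add: dir_derivs_solution_graph Domain_graph)
  show ?thesis
    unfolding C_inf_pi_def mem_Collect_eq prod.case dom
    using E.locally_convex F.locally_convex sv range openin_solvable d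
      multilinear_sol_deriv continuous_sol_deriv sol_deriv_uniform
    by (intro conjI allI ballI impI) simp_all
qed

end

theorem theorem5p8:
  fixes T :: real
  assumes "T > 0"
  shows "(E_space T, F_space \<infinity> T, solution_graph T) \<in> C_inf_pi"
proof -
  interpret time_interval T by standard (rule assms)
  show ?thesis by (rule solution_graph_C_inf_pi)
qed

end
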